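(* For $\phi,\psi\in\mathcal A$, the functional $h(\phi)=\int\phi(p,q,r)\,dp\,dq\,dr$ satisfies the left invariance property $$(\operatorname{id}\otimes h)\bigl((1\otimes\phi)(\Delta\psi)\bigr)=\kappa\Bigl((\operatorname{id}\otimes h)\bigl((\Delta\phi)(1\otimes\psi)\bigr)\Bigr).$$
   Context: Fix an integer $n\ge1$ and a nonzero real $\lambda$. $\beta$ is the usual inner product on $\mathbb R^n$, $e(t)=e^{2\pi it}$, $\bar e(t)=e^{-2\pi it}$, $\eta_\lambda(r)=\frac{e^{2\lambda r}-1}{2\lambda}$. $\mathcal A$ is the space of Schwartz functions $\phi(p,q,r)$ on $G=\mathbb R^n\times\mathbb R^n\times\mathbb R$ with compact support in $r$, and $\mathcal H=L^2(\mathbb R^n\times\mathbb R^n\times\mathbb R)$ in the variables $(x,y,r)$ (Lebesgue measures). For $\phi\in\mathcal A$ let $\phi^\vee(x,y,r)=\int e(p\cdot x+q\cdot y)\phi(p,q,r)\,dp\,dq$ and $$(L_\phi\xi)(x,y,r)=\int\phi^\vee(x',y',r)\,\xi(x-x',y-y',r)\,\bar e[\eta_\lambda(r)\beta(x',y-y')]\,dx'dy'.$$ The operators $L_\phi$ form a ${}^*$-algebra; $A$ is its norm closure in $\mathcal B(\mathcal H)$, and $\phi\in\mathcal A$ is identified with $L_\phi\in A$. $U$ is the unitary operator on $\mathcal H\otimes\mathcal H$ $$U\xi(x,y,r,x',y',r')=(e^{-\lambda r'})^n\,\bar e[\eta_\lambda(r')\beta(e^{-\lambda r'}x,y'-e^{-\lambda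 r'}y)]\,\xi(e^{-\lambda r'}x,e^{-\lambda r'}y,r+r',x'-e^{-\lambda r'}x,y'-e^{-\lambda r'}y,r'),$$ and $\Delta:A\to M(A\otimes A)$, $\Delta(a)=U(a\otimes1)U^*$. For a Schwartz function $F(p,q,r,p',q',r')$ on $G\times G$ with compact support in $r$ and $r'$, let $F^\vee$ be its inverse Fourier transform (kernel $e(\cdot)$) in $(p,q,p',q')$ and let $(L\otimes L)_F$ be the operator $$((L\otimes L)_F\xi)(x,y,r,x',y',r')=\int F^\vee(a,b,r,a',b',r')\,\bar e[\eta_\lambda(r)\beta(a,y-b)+\eta_\lambda(r')\beta(a',y'-b')]\,\xi(x-a,y-b,r,x'-a',y'-b',r')\,da\,db\,da'db',$$ which belongs to $A\otimes A$. For $\phi,\psi\in\mathcal A$ both $(1\otimes\phi)(\Delta\psi)$ and $(\Delta\phi)(1\otimes\psi)$ are of the form $(L\otimes L)_F$, and $\operatorname{id}\otimes h$ is defined on such elements by $((\operatorname{id}\otimes h)F)(p,q,r)=\int F(p,q,r,p',q',r')\,dp'dq'dr'$. $\kappa$ is the map on $\mathcal A$ (extending to an anti-automorphism of $A$) given by $$\kappa(\phi)(p,q,r)=\int\phi(-e^{-\lambda r}\tilde p,-e^{-\lambda r}\tilde q,-r)\,\bar e[(p-\tilde p)\cdot x+(q-\tilde q)\cdot y]\,\bar e[\eta_\lambda(r)\beta(x,y)]\,d\tilde p\,d\tilde q\,dx\,dy;$$ at the operator level $\kappa(\phi)=T\phi^*T$ with $T\xi(x,y,r)=(e^{\lambda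 r})^n\,\overline{\xi(e^{\lambda r}x,e^{\lambda r}y,-r)}$. *)

theory Defs
  imports "HOL-Analysis.Analysis"
begin

section \<open>Notation\<close>

text \<open>
  The dimension n is \<open>CARD('n)\<close>.  The same type serves for the coordinates \<open>(p, q, r)\<close> and
  for the coordinates \<open>(x, y, r)\<close> obtained from them by a partial Fourier transform.
\<close>

type_synonym 'n G = "(real ^ 'n) \<times> (real ^ 'n) \<times> real"

definition e :: "real \<Rightarrow> complex" where
  "e t = exp (2 * of_real pi * \<i> * of_real t)"

definition ebar :: "real \<Rightarrow> complex" where
  "ebar t = exp (- (2 * of_real pi * \<i> * of_real t))"

definition eta :: "real \<Rightarrow> real \<Rightarrow> real" where
  "eta lam r = (exp (2 * lam * r) - 1) / (2 * lam)"


section \<open>Schwartz functions\<close>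

primrec iter_deriv :: "'a list \<Rightarrow> ('a::euclidean_space \<Rightarrow> complex) \<Rightarrow> 'a \<Rightarrow> complex" where
  "iter_deriv [] f = f"
| "iter_deriv (v # vs) f = (\<lambda>x. frechet_derivative (iter_deriv vs f) (at x) v)"

definition schwartz :: "('a::euclidean_space \<Rightarrow> complex) \<Rightarrow> bool" where
  "schwartz f \<longleftrightarrow> (\<forall>vs \<in> lists Basis.
     (\<forall>x. iter_deriv vs f differentiable (at x)) \<and>
     (\<forall>k::nat. bounded (range (\<lambda>x. norm x ^ k *\<^sub>R iter_deriv vs f x))))"

definition \<A> :: "('n::finite G \<Rightarrow> complex) set" where
  "\<A> = {\<phi>. schwartz \<phi> \<and> (\<exists>R. \<forall>p q r. \<bar>r\<bar> > R \<longrightarrow> \<phi> (p, q, r) = 0)}"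

definition \<A>2 :: "('n::finite G \<times> 'n G \<Rightarrow> complex) set" where
  "\<A>2 = {F. schwartz F \<and>
     (\<exists>R. \<forall>p q r p' q' r'. \<bar>r\<bar> > R \<or> \<bar>r'\<bar> > R \<longrightarrow> F ((p, q, r), (p', q', r')) = 0)}"


section \<open>Operators on square-integrable functions\<close>

text \<open>
  The space $L^2$ is represented by its Borel functions, and operators by maps on functions;
  vectors are identified when they agree almost everywhere, and operators when they agree
  (almost everywhere) on every square-integrable function.  The Hilbert space
  $L^2(G) \otimes L^2(G)$ is identified with $L^2(G \times G)$.
\<close>

definition L2 :: "('a::euclidean_space \<Rightarrow> complex) set" where
  "L2 = {\<xi>. \<xi> \<in> borel_measurable borel \<and> integrable lborel (\<lambda>z. (norm (\<xi> z))\<^sup>2)}"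

definition L2_inner :: "('a::euclidean_space \<Rightarrow> complex) \<Rightarrow> ('a \<Rightarrow> complex) \<Rightarrow> complex" where
  "L2_inner \<xi> \<zeta> = (LINT z|lborel. \<xi> z * cnj (\<zeta> z))"

type_synonym 'a oper = "('a \<Rightarrow> complex) \<Rightarrow> ('a \<Rightarrow> complex)"

definition oper_eq :: "'a::euclidean_space oper \<Rightarrow> 'a oper \<Rightarrow> bool" where
  "oper_eq S T \<longleftrightarrow> (\<forall>\<xi> \<in> L2. AE z in lborel. S \<xi> z = T \<xi> z)"

text \<open>
  The Hilbert space adjoint.  The chosen function is determined by \<open>T\<close> and \<open>\<zeta>\<close> up to a null set.
\<close>

definition L2_adjoint :: "'a::euclidean_space oper \<Rightarrow> 'a oper" where
  "L2_adjoint T \<zeta> =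
     (SOME \<zeta>'. \<zeta>' \<in> L2 \<and> (\<forall>\<xi> \<in> L2. L2_inner \<xi> \<zeta>' = L2_inner (T \<xi>) \<zeta>))"

text \<open>
  The operators $a \otimes 1$ and $1 \otimes a$, acting on one variable with the other one
  held fixed.  They are applied to the operators \<open>L lam \<phi>\<close> below, whose values are given by an
  integral, so that changing the argument on a null set of the product changes the result only
  on a null set.
\<close>

definition tensor_one :: "'a oper \<Rightarrow> ('a \<times> 'a) oper" where
  "tensor_one a \<xi> = (\<lambda>(z, z'). a (\<lambda>w. \<xi> (w, z')) z)"

definition one_tensor :: "'a oper \<Rightarrow> ('a \<times> 'a) oper" where
  "one_tensor a \<xi> = (\<lambda>(z, z'). a (\<lambda>w. \<xi> (z, w)) z')"


section \<open>The representation and the comultiplication\<close>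

definition inv_fourier :: "('n::finite G \<Rightarrow> complex) \<Rightarrow> 'n G \<Rightarrow> complex" where
  "inv_fourier \<phi> = (\<lambda>(x, y, r). LINT (p, q)|lborel. e (p \<bullet> x + q \<bullet> y) * \<phi> (p, q, r))"

definition L :: "real \<Rightarrow> ('n::finite G \<Rightarrow> complex) \<Rightarrow> 'n G oper" where
  "L lam \<phi> \<xi> = (\<lambda>(x, y, r). LINT (x', y')|lborel.
     inv_fourier \<phi> (x', y', r) * \<xi> (x - x', y - y', r) * ebar (eta lam r * (x' \<bullet> (y - y'))))"

definition inv_fourier2 :: "('n::finite G \<times> 'n G \<Rightarrow> complex) \<Rightarrow> 'n G \<times> 'n G \<Rightarrow> complex" where
  "inv_fourier2 F = (\<lambda>((a, b, r), (a', b', r')). LINT ((p, q), (p', q'))|lborel.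
     e (p \<bullet> a + q \<bullet> b + p' \<bullet> a' + q' \<bullet> b') * F ((p, q, r), (p', q', r')))"

definition LL :: "real \<Rightarrow> ('n::finite G \<times> 'n G \<Rightarrow> complex) \<Rightarrow> ('n G \<times> 'n G) oper" where
  "LL lam F \<xi> = (\<lambda>((x, y, r), (x', y', r')). LINT ((a, b), (a', b'))|lborel.
     inv_fourier2 F ((a, b, r), (a', b', r'))
     * ebar (eta lam r * (a \<bullet> (y - b)) + eta lam r' * (a' \<bullet> (y' - b')))
     * \<xi> ((x - a, y - b, r), (x' - a', y' - b', r')))"

definition U :: "real \<Rightarrow> ('n::finite G \<times> 'n G) oper" where
  "U lam \<xi> = (\<lambda>((x, y, r), (x', y', r')).
     of_real (exp (- lam * r') ^ CARD('n))
     * ebar (eta lam r' * ((exp (- lam * r') *\<^sub>R x) \<bullet> (y' - exp (- lam * r') *\<^sub>R y)))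
     * \<xi> ((exp (- lam * r') *\<^sub>R x, exp (- lam * r') *\<^sub>R y, r + r'),
          (x' - exp (- lam * r') *\<^sub>R x, y' - exp (- lam * r') *\<^sub>R y, r')))"

definition Delta :: "real \<Rightarrow> 'n::finite G oper \<Rightarrow> ('n G \<times> 'n G) oper" where
  "Delta lam a = U lam \<circ> tensor_one a \<circ> L2_adjoint (U lam)"


section \<open>The Haar functional and the antipode\<close>

definition h :: "('n::finite G \<Rightarrow> complex) \<Rightarrow> complex" where
  "h \<phi> = (LINT (p, q, r)|lborel. \<phi> (p, q, r))"

definition is_symbol ::
  "real \<Rightarrow> ('n::finite G \<times> 'n G) oper \<Rightarrow> ('n G \<times> 'n G \<Rightarrow> complex) \<Rightarrow> bool" where
  "is_symbol lam T F \<longleftrightarrow> F \<in> \<A>2 \<and> oper_eq T (LL lam F)"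

definition has_symbol :: "real \<Rightarrow> ('n::finite G \<times> 'n G) oper \<Rightarrow> bool" where
  "has_symbol lam T \<longleftrightarrow> (\<exists>!F. is_symbol lam T F)"

text \<open>
  The slice map $\mathrm{id} \otimes h$; it is meaningful for operators \<open>T\<close> with
  \<open>has_symbol lam T\<close>, and its value is the element of \<open>\<A>\<close> (as a function).
\<close>

definition id_tensor_h :: "real \<Rightarrow> ('n::finite G \<times> 'n G) oper \<Rightarrow> 'n G \<Rightarrow> complex" where
  "id_tensor_h lam T = (\<lambda>z. h (\<lambda>z'. (THE F. is_symbol lam T F) (z, z')))"

text \<open>
  The integral defining the antipode is not absolutely convergent in all of its variables
  jointly; it is an iterated integral, with \<open>(p', q')\<close> on the inside.
\<close>

definition kappa :: "real \<Rightarrow> ('n::finite G \<Rightarrow> complex) \<Rightarrow> 'n G \<Rightarrow> complex" where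
  "kappa lam \<phi> = (\<lambda>(p, q, r). LINT (x, y)|lborel. LINT (p', q')|lborel.
     \<phi> (- exp (- lam * r) *\<^sub>R p', - exp (- lam * r) *\<^sub>R q', - r)
     * ebar ((p - p') \<bullet> x + (q - q') \<bullet> y) * ebar (eta lam r * (x \<bullet> y)))"

end

theory Submission
  imports Defs "HOL-Probability.Characteristic_Functions"
begin

text \<open>
  Write \<open>f\<close>, \<open>g\<close> for the inverse Fourier transforms of \<open>\<phi>\<close>, \<open>\<psi>\<close> and \<open>s = exp (- lam r')\<close>.  Substituting
  the formula for \<open>U\<close> and its inverse, both products become integral operators whose kernels are
  \<open>s^2n f(A' - sA, B' - sB, r') g(sA, sB, r + r') ebar(eta(r') (A' - sA).sB)\<close> and
  \<open>s^2n f(sA, sB, r + r') g(A' - sA, B' - sB, r') ebar(eta(r') sA.(B' - sB))\<close>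
  up to the phase built into \<open>LL\<close>.  These are Schwartz functions, since \<open>s\<close> is bounded above and below
  on their supports, so their Fourier transforms are the symbols; a symbol is unique because testing
  against indicators of shrinking balls recovers the kernel.  Integrating a symbol over the second copy
  of the group evaluates its kernel at \<open>A' = B' = 0\<close> and integrates over \<open>r'\<close>.  In these terms the antipode
  is \<open>k \<mapsto> exp(lam r)^2n k(- exp(lam r) x, - exp(lam r) y, - r) ebar(eta(r) x.y)\<close>, and the translation
  \<open>r' \<mapsto> r + r'\<close> together with \<open>eta(r + r') = eta(r') + exp(2 lam r') eta(r)\<close> carries the second kernel to the
  first one.
\<close>

subsection \<open>Schwartz functions\<close>

text \<open>Two obstacles shape the argument. The factor exp (- lam r') grows exponentially in one
  direction, so decay cannot be obtained from polynomial bounds on the whole space; the multipliers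
  below are bounded only on a region \<open>S\<close>, and off \<open>S\<close> the function being
  pulled back has to vanish. Moreover \<open>Delta\<close> contains an adjoint that is picked by
  choice, hence known only up to null sets and only on square-integrable vectors: operator
  identities hold almost everywhere, exceptional sets must survive translations and shears, and in
  (\<Delta>\<phi>)(1 \<otimes> \<psi>) the vector fed to the adjoint must first be shown to lie in
  \<open>L2\<close>. The kernels arise by reading the operators as superpositions of translations
  with phases. Conjugation by \<open>U\<close> turns the translation by (a, b) in the first factor
  into a simultaneous translation by (a/s, b/s) in the first and (a, b) in the second. Composed with
  a translation by c in the second factor this gives the total displacements A = a/s and A' = a + c,
  and likewise for B, B'; s^(2n) is the Jacobian of passing from these to (c, a).\<close>

abbreviation pd :: "'a \<Rightarrow> ('a::euclidean_space \<Rightarrow> complex) \<Rightarrow> 'a \<Rightarrow> complex" where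
  "pd b f \<equiv> (\<lambda>x. frechet_derivative f (at x) b)"

lemma iter_deriv_append: "iter_deriv (vs @ ws) f = iter_deriv vs (iter_deriv ws f)"
  by (induction vs) auto

lemma schwartz_iter_deriv:
  assumes "schwartz f" "vs \<in> lists Basis"
  shows "schwartz (iter_deriv vs f)"
  using assms unfolding schwartz_def by (simp add: iter_deriv_append[symmetric])

lemma schwartz_pd: "schwartz f \<Longrightarrow> b \<in> Basis \<Longrightarrow> schwartz (pd b f)"
  using schwartz_iter_deriv[of f "[b]"] by simp

lemma schwartz_differentiable: "schwartz f \<Longrightarrow> f differentiable (at x)"
  unfolding schwartz_def by (metis iter_deriv.simps(1) lists.Nil)

lemma schwartz_continuous_on: "schwartz f \<Longrightarrow> continuous_on S f"
  by (meson continuous_at_imp_continuous_on differentiable_imp_continuous_within schwartz_differentiable)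

lemma schwartz_borel [measurable_dest]: "schwartz f \<Longrightarrow> f \<in> borel_measurable borel"
  by (simp add: borel_measurable_continuous_onI schwartz_continuous_on)

text \<open>\<open>schwartz\<close> speaks only of derivatives in basis directions; linearity
  expands the Frechet derivative in them, so bounds on all \<open>pd b f\<close> bound the whole
  derivative.\<close>

lemma differentiable_has_derivative_pd:
  fixes f :: "'a::euclidean_space \<Rightarrow> complex"
  assumes "f differentiable (at x)"
  shows "(f has_derivative (\<lambda>h. \<Sum>b\<in>Basis. (h \<bullet> b) *\<^sub>R pd b f x)) (at x)"
proof -
  have d: "(f has_derivative frechet_derivative f (at x)) (at x)"
    using assms by (simp add: frechet_derivative_works)
  interpret bounded_linear "frechet_derivative f (at x)"
    using d by (rule has_derivative_bounded_linear)
  have "frechet_derivative f (at x) = (\<lambda>h. \<Sum>b\<in>Basis. (h \<bullet> b) *\<^sub>R pd b f x)"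
  proof
    fix h
    have "frechet_derivative f (at x) h = frechet_derivative f (at x) (\<Sum>b\<in>Basis. (h \<bullet> b) *\<^sub>R b)"
      by (simp add: euclidean_representation)
    also have "\<dots> = (\<Sum>b\<in>Basis. (h \<bullet> b) *\<^sub>R pd b f x)"
      by (simp add: sum scaleR)
    finally show "frechet_derivative f (at x) h = (\<Sum>b\<in>Basis. (h \<bullet> b) *\<^sub>R pd b f x)" .
  qed
  then show ?thesis using d by simp
qed

lemma frechet_derivative_eqI: "(f has_derivative f') (at x) \<Longrightarrow> frechet_derivative f (at x) = f'"
  by (metis frechet_derivative_at)

text \<open>If a class is closed under basis derivatives, every iterated derivative of a member
  stays in it, so smoothness and decay are checked once for a general member. Each use exhibits a
  suitable class instead of a formula for higher derivatives.\<close>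

lemma schwartz_coinduct [consumes 1, case_names diff deriv decay]:
  assumes "f \<in> C"
    and diff: "\<And>g x. g \<in> C \<Longrightarrow> g differentiable (at x)"
    and deriv: "\<And>g b. g \<in> C \<Longrightarrow> b \<in> Basis \<Longrightarrow> pd b g \<in> C"
    and decay: "\<And>g k. g \<in> C \<Longrightarrow> \<exists>B. \<forall>x. norm x ^ k * norm (g x) \<le> B"
  shows "schwartz f"
proof -
  have *: "iter_deriv vs f \<in> C" if "vs \<in> lists Basis" for vs
    using that by (induction vs) (auto simp: assms)
  show ?thesis unfolding schwartz_def
  proof (intro ballI conjI allI)
    fix vs :: "'a list" and x assume "vs \<in> lists Basis"
    then show "iter_deriv vs f differentiable (at x)" using * diff by blast
  next
    fix vs :: "'a list" and k assume "vs \<in> lists Basis"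
    then obtain B where "\<forall>x. norm x ^ k * norm (iter_deriv vs f x) \<le> B" using * decay by metis
    then show "bounded (range (\<lambda>x. norm x ^ k *\<^sub>R iter_deriv vs f x))"
      unfolding bounded_iff by (intro exI[of _ B]) auto
  qed
qed

lemma one_plus_power_le:
  fixes t :: real assumes "0 \<le> t" shows "(1 + t) ^ k \<le> 2 ^ k * (1 + t ^ k)"
proof -
  have "(1 + t) ^ k \<le> (2 * max 1 t) ^ k" using assms by (intro power_mono) auto
  also have "\<dots> = 2 ^ k * max 1 t ^ k" by (simp add: power_mult_distrib)
  also have "max 1 t ^ k \<le> 1 + t ^ k" using assms by (auto simp: max_def)
  finally show ?thesis by simp
qed

lemma schwartz_bound_norm:
  assumes "schwartz f"
  shows "\<exists>B. \<forall>x. norm x ^ k * norm (f x) \<le> B"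
proof -
  have "bounded (range (\<lambda>x. norm x ^ k *\<^sub>R iter_deriv [] f x))"
    using assms unfolding schwartz_def by blast
  then show ?thesis unfolding bounded_iff by auto
qed

text \<open>The weight 1 + norm x, unlike norm x, is at least 1, so its powers increase with the
  exponent and can be split among several factors.\<close>

lemma schwartz_bound:
  assumes "schwartz f"
  obtains B where "0 \<le> B" "\<And>x. (1 + norm x) ^ k * norm (f x) \<le> B"
proof -
  obtain B where B: "\<forall>x. norm x ^ k * norm (f x) \<le> B" using schwartz_bound_norm[OF assms] by blast
  obtain B0 where B0: "\<forall>x. norm x ^ 0 * norm (f x) \<le> B0" using schwartz_bound_norm[OF assms] by blast
  have "(1 + norm x) ^ k * norm (f x) \<le> 2 ^ k * (B0 + B)" for x
  proof -
    have "(1 + norm x) ^ k * norm (f x) \<le> (2 ^ k * (1 + norm x ^ k)) * norm (f x)"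
      by (intro mult_right_mono one_plus_power_le) auto
    also have "\<dots> = 2 ^ k * (norm x ^ 0 * norm (f x) + norm x ^ k * norm (f x))"
      by (simp add: algebra_simps)
    also have "\<dots> \<le> 2 ^ k * (B0 + B)" using B B0 by (intro mult_left_mono add_mono) auto
    finally show ?thesis .
  qed
  moreover have "0 \<le> 2 ^ k * (B0 + B)"
    by (rule order_trans[OF _ calculation[of 0]]) simp
  ultimately show ?thesis using that by blast
qed

text \<open>
  Multipliers: smooth functions whose derivatives are polynomially bounded on \<open>S\<close> (but
  possibly not outside \<open>S\<close>), generated by linear forms.
\<close>

inductive_set multipliers :: "'a set \<Rightarrow> ('a::euclidean_space \<Rightarrow> complex) set" for S where
  const: "(\<lambda>_. c) \<in> multipliers S"
| lin: "bounded_linear l \<Longrightarrow> (\<lambda>z. of_real (l z)) \<in> multipliers S"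
| add: "m \<in> multipliers S \<Longrightarrow> n \<in> multipliers S \<Longrightarrow> (\<lambda>z. m z + n z) \<in> multipliers S"
| mul: "m \<in> multipliers S \<Longrightarrow> n \<in> multipliers S \<Longrightarrow> (\<lambda>z. m z * n z) \<in> multipliers S"
| re: "m \<in> multipliers S \<Longrightarrow> (\<lambda>z. of_real (Re (m z))) \<in> multipliers S"
| exp: "m \<in> multipliers S \<Longrightarrow> (\<And>z. z \<in> S \<Longrightarrow> Re (m z) \<le> B) \<Longrightarrow> (\<lambda>z. exp (m z)) \<in> multipliers S"

lemma multipliers_sum:
  "finite I \<Longrightarrow> (\<And>i. i \<in> I \<Longrightarrow> m i \<in> multipliers S) \<Longrightarrow> (\<lambda>z. \<Sum>i\<in>I. m i z) \<in> multipliers S"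
  by (induction I rule: finite_induct) (auto intro: multipliers.intros)

lemma multipliers_power: "m \<in> multipliers S \<Longrightarrow> (\<lambda>z. m z ^ k) \<in> multipliers S"
  by (induction k) (auto intro: multipliers.intros)

text \<open>Differentiability holds on the whole space. \<open>S\<close> enters only through the
  side condition of the rule \<open>exp\<close>, which the derivative exp m * m' inherits because it
  reuses the same exponential.\<close>

lemma multipliers_deriv:
  assumes "m \<in> multipliers S"
  shows "\<exists>m'. (\<forall>z. (m has_derivative m' z) (at z)) \<and> (\<forall>v. (\<lambda>z. m' z v) \<in> multipliers S)"
  using assms
proof induction
  case (const c)
  then show ?case by (intro exI[of _ "\<lambda>_ _. 0"]) (auto intro: multipliers.intros)
next
  case (lin l)
  then show ?case
    by (intro exI[of _ "\<lambda>_ v. of_real (l v)"] conjI allI)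
       (auto intro!: multipliers.intros derivative_eq_intros bounded_linear_imp_has_derivative
        bounded_linear.has_derivative[OF bounded_linear_of_real])
next
  case (add m n)
  then obtain m' n' where "\<forall>z. (m has_derivative m' z) (at z)" "\<forall>v. (\<lambda>z. m' z v) \<in> multipliers S"
    "\<forall>z. (n has_derivative n' z) (at z)" "\<forall>v. (\<lambda>z. n' z v) \<in> multipliers S" by metis
  then show ?case
    by (intro exI[of _ "\<lambda>z v. m' z v + n' z v"]) (auto intro!: multipliers.intros has_derivative_add)
next
  case (mul m n)
  then obtain m' n' where "\<forall>z. (m has_derivative m' z) (at z)" "\<forall>v. (\<lambda>z. m' z v) \<in> multipliers S"
    "\<forall>z. (n has_derivative n' z) (at z)" "\<forall>v. (\<lambda>z. n' z v) \<in> multipliers S" by metis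
  with mul show ?case
    by (intro exI[of _ "\<lambda>z v. m z * n' z v + m' z v * n z"])
       (auto intro!: multipliers.intros has_derivative_mult)
next
  case (re m)
  then obtain m' where "\<forall>z. (m has_derivative m' z) (at z)" "\<forall>v. (\<lambda>z. m' z v) \<in> multipliers S"
    by metis
  then show ?case
    by (intro exI[of _ "\<lambda>z v. of_real (Re (m' z v))"])
       (auto intro!: multipliers.intros bounded_linear.has_derivative[OF bounded_linear_of_real]
         bounded_linear.has_derivative[OF bounded_linear_Re])
next
  case (exp m B)
  then obtain m' where "\<forall>z. (m has_derivative m' z) (at z)" "\<forall>v. (\<lambda>z. m' z v) \<in> multipliers S"
    by metis
  moreover have "((\<lambda>z. exp (m z)) has_derivative (\<lambda>v. exp (m z) * m' z v)) (at z)" for z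
    by (rule has_derivative_compose[where f=m and f'="m' z" and g=exp and g'="\<lambda>h. exp (m z) * h"])
       (use calculation DERIV_exp[of "m z", unfolded has_field_derivative_def] in auto)
  ultimately show ?case using exp
    by (intro exI[of _ "\<lambda>z v. exp (m z) * m' z v"]) (auto intro!: multipliers.intros)
qed

text \<open>Sums and products keep polynomial growth, and norm (exp w) = exp (Re w) turns the bound
  on the real part into a constant. The last case is what confines the estimate to
  \<open>S\<close>.\<close>

lemma multipliers_bound:
  assumes "m \<in> multipliers S"
  shows "\<exists>C k. 0 \<le> C \<and> (\<forall>z\<in>S. norm (m z) \<le> C * (1 + norm z) ^ k)"
  using assms
proof induction
  case (const c)
  show ?case by (intro exI[of _ "norm c"] exI[of _ 0]) auto
next
  case (lin l)
  then obtain K where "0 < K" "\<And>z. norm (l z) \<le> norm z * K" by (metis bounded_linear.pos_bounded)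
  moreover have "norm z * K \<le> K * (1 + norm z) ^ 1" for z using \<open>0 < K\<close> by (simp add: algebra_simps)
  ultimately show ?case
    by (intro exI[of _ K] exI[of _ 1]) (auto intro: order_trans)
next
  case (add m n)
  then obtain C k D j where *: "0 \<le> C" "0 \<le> D" "\<forall>z\<in>S. norm (m z) \<le> C * (1 + norm z) ^ k"
    "\<forall>z\<in>S. norm (n z) \<le> D * (1 + norm z) ^ j" by metis
  have "norm (m z + n z) \<le> (C + D) * (1 + norm z) ^ max k j" if "z \<in> S" for z
  proof -
    have "norm (m z + n z) \<le> C * (1 + norm z) ^ k + D * (1 + norm z) ^ j"
      using * that by (meson add_mono norm_triangle_ineq order_trans)
    also have "\<dots> \<le> C * (1 + norm z) ^ max k j + D * (1 + norm z) ^ max k j"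
      using * by (intro add_mono mult_left_mono power_increasing) auto
    finally show ?thesis by (simp add: algebra_simps)
  qed
  then show ?case using * by (intro exI[of _ "C + D"] exI[of _ "max k j"]) auto
next
  case (mul m n)
  then obtain C k D j where *: "0 \<le> C" "0 \<le> D" "\<forall>z\<in>S. norm (m z) \<le> C * (1 + norm z) ^ k"
    "\<forall>z\<in>S. norm (n z) \<le> D * (1 + norm z) ^ j" by metis
  have "norm (m z * n z) \<le> (C * D) * (1 + norm z) ^ (k + j)" if "z \<in> S" for z
  proof -
    have "norm (m z * n z) \<le> (C * (1 + norm z) ^ k) * (D * (1 + norm z) ^ j)"
      using * that unfolding norm_mult by (intro mult_mono) auto
    then show ?thesis by (simp add: power_add algebra_simps)
  qed
  then show ?case using * by (intro exI[of _ "C * D"] exI[of _ "k + j"]) auto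
next
  case (re m)
  then obtain C k where "0 \<le> C" "\<forall>z\<in>S. norm (m z) \<le> C * (1 + norm z) ^ k" by metis
  then show ?case using abs_Re_le_cmod
    by (intro exI[of _ C] exI[of _ k]) (auto intro: order_trans)
next
  case (exp m B)
  then show ?case by (intro exI[of _ "exp B"] exI[of _ 0]) auto
qed

text \<open>Sums of products of a multiplier with a derivative of \<open>H\<close> composed with
  \<open>T\<close>: the chain and product rules, started at a multiple of \<open>H\<close> composed
  with \<open>T\<close>, never leave this class.\<close>

inductive_set pullbacks :: "'a set \<Rightarrow> ('b::euclidean_space \<Rightarrow> complex) \<Rightarrow> ('a::euclidean_space \<Rightarrow> 'b)
    \<Rightarrow> ('a \<Rightarrow> complex) set" for S H T where
  base: "m \<in> multipliers S \<Longrightarrow> vs \<in> lists Basis \<Longrightarrow> (\<lambda>z. m z * iter_deriv vs H (T z)) \<in> pullbacks S H T"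
| add: "f \<in> pullbacks S H T \<Longrightarrow> g \<in> pullbacks S H T \<Longrightarrow> (\<lambda>z. f z + g z) \<in> pullbacks S H T"

lemma pullbacks_sum:
  "finite I \<Longrightarrow> (\<And>i. i \<in> I \<Longrightarrow> m i \<in> pullbacks S H T) \<Longrightarrow> (\<lambda>z. \<Sum>i\<in>I. m i z) \<in> pullbacks S H T"
proof (induction I rule: finite_induct)
  case empty
  then show ?case using pullbacks.base[OF multipliers.const[of 0], of "[]"] by simp
next
  case (insert i I)
  then show ?case by (auto intro: pullbacks.intros)
qed

lemma pullbacks_deriv:
  fixes T :: "'a::euclidean_space \<Rightarrow> 'b::euclidean_space"
  assumes "f \<in> pullbacks S H T" and H: "schwartz H"
    and T: "\<And>w. w \<in> Basis \<Longrightarrow> (\<lambda>z. of_real (T z \<bullet> w)) \<in> multipliers S"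
  shows "\<exists>f'. (\<forall>z. (f has_derivative f' z) (at z)) \<and> (\<forall>v. (\<lambda>z. f' z v) \<in> pullbacks S H T)"
  using assms(1)
proof induction
  case (add f g)
  then obtain m' n' where "\<forall>z. (f has_derivative m' z) (at z)" "\<forall>v. (\<lambda>z. m' z v) \<in> pullbacks S H T"
    "\<forall>z. (g has_derivative n' z) (at z)" "\<forall>v. (\<lambda>z. n' z v) \<in> pullbacks S H T" by metis
  then show ?case
    by (intro exI[of _ "\<lambda>z v. m' z v + n' z v"]) (auto intro!: pullbacks.add has_derivative_add)
next
  case (base m vs)
  from T have "\<forall>w. \<exists>d. w \<in> Basis \<longrightarrow> (\<forall>z. ((\<lambda>z. complex_of_real (T z \<bullet> w)) has_derivative d z) (at z))
      \<and> (\<forall>v. (\<lambda>z. d z v) \<in> multipliers S)"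
    using multipliers_deriv by metis
  then obtain d where d: "\<And>w z. w \<in> Basis \<Longrightarrow> ((\<lambda>z. complex_of_real (T z \<bullet> w)) has_derivative d w z) (at z)"
    "\<And>w v. w \<in> Basis \<Longrightarrow> (\<lambda>z. d w z v) \<in> multipliers S" by metis
  obtain m' where m': "\<forall>z. (m has_derivative m' z) (at z)" "\<forall>v. (\<lambda>z. m' z v) \<in> multipliers S"
    using multipliers_deriv base by metis
  \<comment> \<open>The components of \<open>T\<close> are given as complex-valued multipliers, so
    the real derivative of \<open>T\<close> is recovered through \<open>Re\<close>; the rule
    \<open>re\<close> keeps these coefficients among the multipliers.\<close>
  define T' where "T' z v = (\<Sum>w\<in>Basis. Re (d w z v) *\<^sub>R w)" for z v
  have T': "(T has_derivative T' z) (at z)" for z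
  proof -
    have "((\<lambda>z. T z \<bullet> w) has_derivative (\<lambda>v. T' z v \<bullet> w)) (at z)" if "w \<in> Basis" for w
      using bounded_linear.has_derivative[OF bounded_linear_Re d(1)[OF that, of z]] that
      by (simp add: T'_def inner_sum_left inner_Basis if_distrib sum.delta' cong: if_cong)
    then show ?thesis by (subst has_derivative_componentwise_within) auto
  qed
  let ?H = "iter_deriv vs H"
  have sH: "schwartz ?H" using H base by (simp add: schwartz_iter_deriv)
  have dH: "((\<lambda>z. ?H (T z)) has_derivative (\<lambda>v. \<Sum>w\<in>Basis. of_real (Re (d w z v)) * iter_deriv (w # vs) H (T z))) (at z)" for z
  proof -
    have "(?H has_derivative (\<lambda>h. \<Sum>b\<in>Basis. (h \<bullet> b) *\<^sub>R pd b ?H (T z))) (at (T z))"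
      using differentiable_has_derivative_pd schwartz_differentiable sH by blast
    from has_derivative_compose[OF T' this]
    have "((\<lambda>z. ?H (T z)) has_derivative (\<lambda>v. \<Sum>b\<in>Basis. (T' z v \<bullet> b) *\<^sub>R pd b ?H (T z))) (at z)" .
    also have "(\<lambda>v. \<Sum>b\<in>Basis. (T' z v \<bullet> b) *\<^sub>R pd b ?H (T z)) =
       (\<lambda>v. \<Sum>w\<in>Basis. of_real (Re (d w z v)) * iter_deriv (w # vs) H (T z))"
      by (intro ext sum.cong) (auto simp: T'_def inner_sum_left inner_Basis if_distrib sum.delta' scaleR_conv_of_real cong: if_cong)
    finally show ?thesis .
  qed
  show ?case
  proof (intro exI conjI allI)
    show "((\<lambda>z. m z * ?H (T z)) has_derivative
       (\<lambda>v. m z * (\<Sum>w\<in>Basis. of_real (Re (d w z v)) * iter_deriv (w # vs) H (T z)) + m' z v * ?H (T z))) (at z)" for z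
      using m' dH by (intro has_derivative_mult) auto
    show "(\<lambda>z. m z * (\<Sum>w\<in>Basis. of_real (Re (d w z v)) * iter_deriv (w # vs) H (T z)) + m' z v * ?H (T z))
       \<in> pullbacks S H T" for v
    proof (rule pullbacks.add)
      show "(\<lambda>z. m' z v * ?H (T z)) \<in> pullbacks S H T" using base m' by (intro pullbacks.base) auto
      have "(\<lambda>z. \<Sum>w\<in>Basis. (m z * of_real (Re (d w z v))) * iter_deriv (w # vs) H (T z)) \<in> pullbacks S H T"
        using base d by (intro pullbacks_sum pullbacks.base multipliers.intros) auto
      then show "(\<lambda>z. m z * (\<Sum>w\<in>Basis. of_real (Re (d w z v)) * iter_deriv (w # vs) H (T z))) \<in> pullbacks S H T"
        by (simp add: sum_distrib_left mult.assoc)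
    qed
  qed
qed

text \<open>Off \<open>S\<close> the multiplier is uncontrolled, but there every derivative of
  \<open>H\<close> vanishes at \<open>T z\<close>. On \<open>S\<close> the growth condition bounds 1
  + norm z by a power of 1 + norm (T z), so any polynomial weight in z is paid for by the rapid
  decay of \<open>H\<close> at \<open>T z\<close>.\<close>

lemma pullbacks_decay:
  fixes T :: "'a::euclidean_space \<Rightarrow> 'b::euclidean_space"
  assumes "f \<in> pullbacks S H T" and H: "schwartz H"
    and supp: "\<And>vs z. vs \<in> lists Basis \<Longrightarrow> z \<notin> S \<Longrightarrow> iter_deriv vs H (T z) = 0"
    and growth: "\<And>z. z \<in> S \<Longrightarrow> norm z \<le> C * (1 + norm (T z)) ^ j"
  shows "\<exists>B. \<forall>z. norm z ^ k * norm (f z) \<le> B"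
  using assms(1)
proof induction
  case (add f g)
  then obtain B D where *: "\<forall>z. norm z ^ k * norm (f z) \<le> B" "\<forall>z. norm z ^ k * norm (g z) \<le> D" by metis
  have "norm z ^ k * norm (f z + g z) \<le> B + D" for z
  proof -
    have "norm z ^ k * norm (f z + g z) \<le> norm z ^ k * (norm (f z) + norm (g z))"
      by (intro mult_left_mono norm_triangle_ineq) auto
    also have "\<dots> \<le> B + D" using * by (simp add: distrib_left add_mono)
    finally show ?thesis .
  qed
  then show ?case by blast
next
  case (base m vs)
  obtain D l where D: "0 \<le> D" "\<And>z. z \<in> S \<Longrightarrow> norm (m z) \<le> D * (1 + norm z) ^ l"
    using multipliers_bound base by metis
  let ?H = "iter_deriv vs H"
  have sH: "schwartz ?H" using H base by (simp add: schwartz_iter_deriv)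
  \<comment> \<open>k powers come from the weight and l from the growth of \<open>m\<close>; each
    power of 1 + norm z costs j powers of 1 + norm (T z).\<close>
  obtain B where B: "0 \<le> B" "\<And>x. (1 + norm x) ^ (j * (k + l)) * norm (?H x) \<le> B"
    by (rule schwartz_bound[OF sH, of "j * (k + l)"]) blast
  let ?C = "max C 0"
  have "norm z ^ k * norm (m z * ?H (T z)) \<le> D * (1 + ?C) ^ (k + l) * B" for z
  proof (cases "z \<in> S")
    case True
    have g: "1 + norm z \<le> (1 + ?C) * (1 + norm (T z)) ^ j"
    proof -
      have "1 \<le> (1 + norm (T z)) ^ j" by simp
      moreover have "norm z \<le> ?C * (1 + norm (T z)) ^ j"
        by (rule order_trans[OF growth[OF True]]) (auto intro: mult_right_mono)
      ultimately have "1 + norm z \<le> (1 + norm (T z)) ^ j + ?C * (1 + norm (T z)) ^ j" by (rule add_mono)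
      then show ?thesis by (simp only: distrib_right mult_1_left)
    qed
    have "norm z ^ k * norm (m z * ?H (T z)) \<le> (1 + norm z) ^ k * ((D * (1 + norm z) ^ l) * norm (?H (T z)))"
      unfolding norm_mult using D True by (intro mult_mono power_mono mult_right_mono) auto
    also have "\<dots> = D * (1 + norm z) ^ (k + l) * norm (?H (T z))" by (simp add: power_add)
    also have "\<dots> \<le> D * ((1 + ?C) * (1 + norm (T z)) ^ j) ^ (k + l) * norm (?H (T z))"
      using D g by (intro mult_right_mono mult_left_mono power_mono) auto
    also have "\<dots> = D * (1 + ?C) ^ (k + l) * ((1 + norm (T z)) ^ (j * (k + l)) * norm (?H (T z)))"
      by (simp add: power_mult_distrib power_mult)
    also have "\<dots> \<le> D * (1 + ?C) ^ (k + l) * B"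
      using D B by (intro mult_left_mono) auto
    finally show ?thesis .
  next
    case False
    then show ?thesis using supp base D B by auto
  qed
  then show ?case by blast
qed

text \<open>\<open>m\<close> and \<open>T\<close> may grow exponentially outside \<open>S\<close>,
  as the factors exp (- lam r') require; in that application \<open>S\<close> is the region where r'
  and r + r' are bounded.\<close>

theorem schwartz_pullback:
  fixes T :: "'a::euclidean_space \<Rightarrow> 'b::euclidean_space"
  assumes H: "schwartz H" and m: "m \<in> multipliers S"
    and T: "\<And>w. w \<in> Basis \<Longrightarrow> (\<lambda>z. of_real (T z \<bullet> w)) \<in> multipliers S"
    and supp: "\<And>vs z. vs \<in> lists Basis \<Longrightarrow> z \<notin> S \<Longrightarrow> iter_deriv vs H (T z) = 0"
    and growth: "\<And>z. z \<in> S \<Longrightarrow> norm z \<le> C * (1 + norm (T z)) ^ j"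
  shows "schwartz (\<lambda>z. m z * H (T z))"
proof -
  have "(\<lambda>z. m z * H (T z)) \<in> pullbacks S H T"
    using pullbacks.base[OF m, of "[]" H T] by simp
  then show ?thesis
  proof (induction rule: schwartz_coinduct)
    case (diff g x)
    then show ?case using pullbacks_deriv[OF diff H T] by (meson differentiable_def)
  next
    case (deriv g b)
    obtain g' where "\<forall>z. (g has_derivative g' z) (at z)" "\<forall>v. (\<lambda>z. g' z v) \<in> pullbacks S H T"
      using pullbacks_deriv[OF deriv(1) H T] by blast
    then have "pd b g = (\<lambda>z. g' z b)" using frechet_derivative_eqI by (metis (no_types))
    then show ?case using \<open>\<forall>v. (\<lambda>z. g' z v) \<in> pullbacks S H T\<close> by simp
  next
    case (decay g k)
    then show ?case using pullbacks_decay[OF decay H supp growth] by blast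
  qed
qed

section \<open>Products, linear substitutions and tensor products of Schwartz functions\<close>

lemma schwartz_mult:
  assumes "schwartz H" "m \<in> multipliers UNIV"
  shows "schwartz (\<lambda>z. m z * H z)"
  using assms(1,2)
  by (rule schwartz_pullback[where T="\<lambda>z. z" and S=UNIV and C=1 and j=1])
     (auto intro: multipliers.lin bounded_linear_inner_left)

lemma schwartz_linear:
  fixes T :: "'a::euclidean_space \<Rightarrow> 'b::euclidean_space"
  assumes "schwartz H" "bounded_linear T" "\<And>z. norm z \<le> C * norm (T z)" "0 \<le> C"
  shows "schwartz (\<lambda>z. H (T z))"
proof -
  have "schwartz (\<lambda>z. 1 * H (T z))"
  proof (rule schwartz_pullback[where S=UNIV and C=C and j=1 and H=H and T=T and m="\<lambda>_. 1"])
    show "(\<lambda>z. complex_of_real (T z \<bullet> w)) \<in> multipliers UNIV" for w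
      using assms by (intro multipliers.lin bounded_linear_inner_left_comp)
    show "norm z \<le> C * (1 + norm (T z)) ^ 1" for z
      using assms(3)[of z] assms(4) by (simp add: algebra_simps)
  qed (auto intro: multipliers.const assms)
  then show ?thesis by simp
qed

text \<open>Every basis vector of the product space lies in one of the two factors, so a basis
  derivative hits only one of f and g. The products of a derivative of f with a derivative of g are
  therefore closed under differentiation without taking sums.\<close>

lemma schwartz_tensor:
  assumes f: "schwartz f" and g: "schwartz g"
  shows "schwartz (\<lambda>(z, w). f z * g w)"
proof -
  have has_derivative_tensor: "((\<lambda>(z, w). iter_deriv vs f z * iter_deriv ws g w) has_derivative
       (\<lambda>h. iter_deriv vs f (fst x) * frechet_derivative (iter_deriv ws g) (at (snd x)) (snd h)
         + frechet_derivative (iter_deriv vs f) (at (fst x)) (fst h) * iter_deriv ws g (snd x))) (at x)"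
    if "vs \<in> lists Basis" "ws \<in> lists Basis" for vs ws x
  proof -
    have "iter_deriv vs f differentiable at (fst x)" "iter_deriv ws g differentiable at (snd x)"
      using that f g unfolding schwartz_def by blast+
    then have "(iter_deriv vs f has_derivative frechet_derivative (iter_deriv vs f) (at (fst x))) (at (fst x))"
       "(iter_deriv ws g has_derivative frechet_derivative (iter_deriv ws g) (at (snd x))) (at (snd x))"
       by (simp_all add: frechet_derivative_works)
    then have "((\<lambda>y. iter_deriv vs f (fst y)) has_derivative
          (\<lambda>h. frechet_derivative (iter_deriv vs f) (at (fst x)) (fst h))) (at x)"
        "((\<lambda>y. iter_deriv ws g (snd y)) has_derivative
          (\<lambda>h. frechet_derivative (iter_deriv ws g) (at (snd x)) (snd h))) (at x)"
      by (auto intro: has_derivative_compose[where f=fst and f'=fst] has_derivative_compose[where f=snd and f'=snd]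
          bounded_linear_imp_has_derivative bounded_linear_fst bounded_linear_snd)
    then show ?thesis unfolding case_prod_beta by (rule has_derivative_mult)
  qed
  define C where "C = {\<lambda>(z, w). iter_deriv vs f z * iter_deriv ws g w |vs ws.
     vs \<in> lists Basis \<and> ws \<in> lists Basis}"
  have "(\<lambda>(z, w). f z * g w) \<in> C"
    unfolding C_def by (rule CollectI, rule exI[of _ "[]"], rule exI[of _ "[]"]) auto
  then show ?thesis
  proof (induction rule: schwartz_coinduct)
    case (diff F x)
    then obtain vs ws where *: "F = (\<lambda>(z, w). iter_deriv vs f z * iter_deriv ws g w)"
      "vs \<in> lists Basis" "ws \<in> lists Basis" unfolding C_def by blast
    show ?case unfolding differentiable_def *(1) using has_derivative_tensor[OF *(2,3)] by blast
  next
    case (deriv F b)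
    then obtain vs ws where *: "F = (\<lambda>(z, w). iter_deriv vs f z * iter_deriv ws g w)"
      "vs \<in> lists Basis" "ws \<in> lists Basis" unfolding C_def by blast
    have pdF: "pd b F x = iter_deriv vs f (fst x) * frechet_derivative (iter_deriv ws g) (at (snd x)) (snd b)
       + frechet_derivative (iter_deriv vs f) (at (fst x)) (fst b) * iter_deriv ws g (snd x)" for x
      unfolding *(1) by (simp add: frechet_derivative_eqI[OF has_derivative_tensor[OF *(2,3)]])
    have zero: "frechet_derivative (iter_deriv ws g) (at z) 0 = 0"
       "frechet_derivative (iter_deriv vs f) (at y) 0 = 0" for z y
      using * f g unfolding schwartz_def
      by (metis bounded_linear.linear frechet_derivative_works has_derivative_bounded_linear linear_0)+
    from deriv(2) consider u where "b = (u, 0)" "u \<in> Basis" | v where "b = (0, v)" "v \<in> Basis"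
      by (auto simp: Basis_prod_def)
    then show ?case
    proof cases
      case (1 u)
      then have "pd b F = (\<lambda>(z, w). iter_deriv (u # vs) f z * iter_deriv ws g w)"
        using pdF zero by (auto simp: fun_eq_iff)
      with * 1 show ?thesis unfolding C_def
        by (intro CollectI exI[of _ "u # vs"] exI[of _ ws]) auto
    next
      case (2 v)
      then have "pd b F = (\<lambda>(z, w). iter_deriv vs f z * iter_deriv (v # ws) g w)"
        using pdF zero by (auto simp: fun_eq_iff)
      with * 2 show ?thesis unfolding C_def
        by (intro CollectI exI[of _ vs] exI[of _ "v # ws"]) auto
    qed
  next
    case (decay F k)
    then obtain vs ws where *: "F = (\<lambda>(z, w). iter_deriv vs f z * iter_deriv ws g w)"
      "vs \<in> lists Basis" "ws \<in> lists Basis" unfolding C_def by blast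
    obtain B where B: "0 \<le> B" "\<And>x. (1 + norm x) ^ k * norm (iter_deriv vs f x) \<le> B"
      by (rule schwartz_bound[OF schwartz_iter_deriv[OF f *(2)], of k]) blast
    obtain D where D: "0 \<le> D" "\<And>x. (1 + norm x) ^ k * norm (iter_deriv ws g x) \<le> D"
      by (rule schwartz_bound[OF schwartz_iter_deriv[OF g *(3)], of k]) blast
    have "norm (z, w) ^ k * norm (F (z, w)) \<le> B * D" for z w
    proof -
      have "norm (z, w) \<le> (1 + norm z) * (1 + norm w)"
        using norm_Pair_le[of z w] by (simp add: algebra_simps)
           (smt (verit) mult_nonneg_nonneg norm_ge_zero)
      then have "norm (z, w) ^ k \<le> (1 + norm z) ^ k * (1 + norm w) ^ k"
        unfolding power_mult_distrib[symmetric] by (rule power_mono) auto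
      then have "norm (z, w) ^ k * norm (F (z, w)) \<le>
          ((1 + norm z) ^ k * (1 + norm w) ^ k) * (norm (iter_deriv vs f z) * norm (iter_deriv ws g w))"
        unfolding * by (simp only: prod.case norm_mult) (intro mult_right_mono, auto)
      also have "\<dots> = ((1 + norm z) ^ k * norm (iter_deriv vs f z)) * ((1 + norm w) ^ k * norm (iter_deriv ws g w))"
        by (simp add: algebra_simps)
      also have "\<dots> \<le> B * D" using B D by (intro mult_mono) auto
      finally show ?thesis .
    qed
    then show ?case by auto
  qed
qed

text \<open>Vanishing near a point, unlike vanishing at it, passes to derivatives. This provides the
  support hypothesis of \<open>schwartz_pullback\<close>.\<close>

lemma iter_deriv_eq_0_open:
  assumes "open V" "\<And>x. x \<in> V \<Longrightarrow> H x = 0" "x \<in> V"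
  shows "iter_deriv vs H x = 0"
  using assms(3)
proof (induction vs arbitrary: x)
  case Nil
  then show ?case using assms by simp
next
  case (Cons v vs)
  have "((\<lambda>_. 0) has_derivative (\<lambda>_. 0)) (at x)" by simp
  then have "(iter_deriv vs H has_derivative (\<lambda>_. 0)) (at x)"
    by (rule has_derivative_transform_within_open[OF _ assms(1) Cons.prems]) (simp add: Cons.IH)
  then show ?case by (simp add: frechet_derivative_eqI)
qed

subsection \<open>Integration over Euclidean spaces\<close>

lemma e_borel [measurable]: "e \<in> borel_measurable borel"
  unfolding e_def by measurable

lemma norm_e [simp]: "norm (e t) = 1"
proof -
  have "e t = exp (\<i> * complex_of_real (2 * pi * t))" unfolding e_def by (simp add: mult_ac)
  then show ?thesis by (simp only: norm_exp_i_times)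
qed

lemma e_add: "e (a + b) = e a * e b"
  unfolding e_def by (simp add: exp_add distrib_left)

lemma e_0 [simp]: "e 0 = 1"
  unfolding e_def by simp

lemma ebar_eq: "ebar t = e (- t)"
  unfolding e_def ebar_def by simp

lemma cnj_e: "cnj (e t) = e (- t)"
  unfolding e_def by (simp add: exp_cnj)

lemma continuous_on_e [continuous_intros]: "continuous_on A f \<Longrightarrow> continuous_on A (\<lambda>x. e (f x))"
  unfolding e_def by (intro continuous_intros)

lemma has_derivative_e:
  assumes "(f has_derivative f') (at z)"
  shows "((\<lambda>z. e (f z)) has_derivative (\<lambda>h. e (f z) * (2 * of_real pi * \<i> * of_real (f' h)))) (at z)"
proof -
  have 1: "((\<lambda>z. 2 * of_real pi * \<i> * of_real (f z)) has_derivative (\<lambda>h. 2 * of_real pi * \<i> * of_real (f' h))) (at z)"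
    by (intro has_derivative_mult_right has_derivative_of_real assms)
  have "(exp has_derivative (\<lambda>h. e (f z) * h)) (at (2 * of_real pi * \<i> * of_real (f z)))"
    using DERIV_exp[of "2 * of_real pi * \<i> * of_real (f z) :: complex"]
    unfolding has_field_derivative_def e_def by simp
  from has_derivative_compose[OF 1 this] show ?thesis unfolding e_def .
qed

text \<open>The common dominating function for Schwartz integrands: as a product over coordinates it
  has an integral that factors into one-dimensional ones, and it dominates anything with polynomial
  decay of order twice the dimension.\<close>

definition decay :: "'a::euclidean_space \<Rightarrow> real" where
  "decay x = (\<Prod>b\<in>Basis. 1 / (1 + (x \<bullet> b)\<^sup>2))"

lemma decay_pos: "0 < decay x"
  unfolding decay_def by (intro prod_pos) (auto intro!: divide_pos_pos add_pos_nonneg)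

lemma decay_borel [measurable]: "decay \<in> borel_measurable borel"
  unfolding decay_def by measurable

lemma nn_integral_inverse_square: "(\<integral>\<^sup>+x. ennreal (1 / (1 + x\<^sup>2)) \<partial>lborel) < \<infinity>"
proof -
  let ?f = "\<lambda>x::real. ennreal (1 / (1 + x\<^sup>2))"
  have d: "DERIV arctan x :> 1 / (1 + x\<^sup>2)" for x
    using DERIV_arctan[of x] by (simp add: inverse_eq_divide)
  have 1: "(\<integral>\<^sup>+x. ?f x * indicator {0..} x \<partial>lborel) = ennreal (pi / 2 - arctan 0)"
    by (rule nn_integral_FTC_atLeast[of "\<lambda>x. 1 / (1 + x\<^sup>2)" 0 arctan "pi/2"])
       (use d tendsto_arctan_at_top in auto)
  have "(\<integral>\<^sup>+x. ?f x * indicator {..0} x \<partial>lborel) = (\<integral>\<^sup>+x. ?f x * indicator {0..} x \<partial>lborel)"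
    by (subst nn_integral_real_affine[where c="-1" and t=0])
       (auto intro!: nn_integral_cong split: split_indicator)
  with 1 have 2: "(\<integral>\<^sup>+x. ?f x * indicator {..0} x \<partial>lborel) = ennreal (pi / 2 - arctan 0)" by simp
  have "(\<integral>\<^sup>+x. ?f x \<partial>lborel) \<le> (\<integral>\<^sup>+x. ?f x * indicator {0..} x + ?f x * indicator {..0} x \<partial>lborel)"
    by (intro nn_integral_mono) (auto split: split_indicator)
  also have "\<dots> = ennreal (pi / 2 - arctan 0) + ennreal (pi / 2 - arctan 0)"
    by (subst nn_integral_add) (auto simp: 1 2)
  also have "\<dots> < \<infinity>" by simp
  finally show ?thesis .
qed

lemma integrable_decay: "integrable lborel (decay :: 'a::euclidean_space \<Rightarrow> real)"
proof -
  have "(\<integral>\<^sup>+x. ennreal (decay (x::'a)) \<partial>lborel) = (\<integral>\<^sup>+x. (\<Prod>b\<in>Basis. ennreal (1 / (1 + ((x::'a) \<bullet> b)\<^sup>2))) \<partial>lborel)"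
    unfolding decay_def by (intro nn_integral_cong) (simp add: prod_ennreal)
  also have "\<dots> = (\<Prod>b\<in>(Basis::'a set). (\<integral>\<^sup>+x. ennreal (1 / (1 + x\<^sup>2)) \<partial>lborel))"
    by (rule nn_integral_lborel_prod) auto
  also have "\<dots> < \<infinity>" using nn_integral_inverse_square
    by (simp add: power_less_top_ennreal)
  finally show ?thesis
    by (intro integrableI_bounded) (auto simp: less_imp_le[OF decay_pos])
qed

text \<open>Each of the DIM factors 1 + (x . b)^2 is at most (1 + norm x)^2, hence the exponent 2 *
  DIM.\<close>

lemma one_le_decay: "1 \<le> (1 + norm x) ^ (2 * DIM('a)) * decay (x::'a::euclidean_space)"
proof -
  have "1 + (x \<bullet> b)\<^sup>2 \<le> (1 + norm x)\<^sup>2" if "b \<in> Basis" for b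
  proof -
    have "(x \<bullet> b)\<^sup>2 \<le> (norm x)\<^sup>2" using Basis_le_norm[OF that, of x] by (metis abs_le_square_iff abs_norm_cancel)
    moreover have "(1 + norm x)\<^sup>2 = 1 + 2 * norm x + (norm x)\<^sup>2"
      by (simp add: power2_eq_square algebra_simps)
    ultimately show ?thesis using norm_ge_zero[of x] by linarith
  qed
  then have "(\<Prod>b\<in>(Basis::'a set). 1 + (x \<bullet> b)\<^sup>2) \<le> (\<Prod>b\<in>(Basis::'a set). (1 + norm x)\<^sup>2)"
    by (intro prod_mono) auto
  also have "\<dots> = (1 + norm x) ^ (2 * DIM('a))" by (simp add: power_mult)
  finally have *: "(\<Prod>b\<in>Basis. 1 + (x \<bullet> b)\<^sup>2) \<le> (1 + norm x) ^ (2 * DIM('a))" .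
  have "(\<Prod>b\<in>Basis. 1 + (x \<bullet> b)\<^sup>2) * decay x = 1"
    unfolding decay_def prod.distrib[symmetric]
    by (intro prod.neutral ballI) (simp add: add_nonneg_eq_0_iff)
  with mult_right_mono[OF *, of "decay x"] decay_pos[of x] show ?thesis by simp
qed

lemma le_decay:
  assumes "(1 + norm x) ^ (2 * DIM('a)) * y \<le> B" "0 \<le> y" "0 \<le> B"
  shows "y \<le> B * decay (x::'a::euclidean_space)"
proof -
  have "1 * y \<le> ((1 + norm x) ^ (2 * DIM('a)) * decay x) * y"
    by (intro mult_right_mono one_le_decay assms)
  also have "\<dots> = ((1 + norm x) ^ (2 * DIM('a)) * y) * decay x" by simp
  also have "\<dots> \<le> B * decay x" using assms less_imp_le[OF decay_pos] by (intro mult_right_mono)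
  finally show ?thesis by simp
qed

text \<open>A Schwartz bound of high enough order in the joint norm leaves an integrable function of
  w, uniformly in t, with spare powers of both variables.\<close>

lemma schwartz_slice_decay:
  fixes H :: "'w::euclidean_space \<times> 't::euclidean_space \<Rightarrow> complex"
  assumes "schwartz H"
  obtains B where "0 \<le> B" "\<And>w t. (1 + norm t) ^ j * ((1 + norm w) ^ k * norm (H (w, t))) \<le> B * decay w"
proof -
  obtain B where B: "0 \<le> B" "\<And>x. (1 + norm x) ^ (j + (2 * DIM('w) + k)) * norm (H x) \<le> B"
    by (rule schwartz_bound[OF assms, of "j + (2 * DIM('w) + k)"]) blast
  have "(1 + norm t) ^ j * ((1 + norm w) ^ k * norm (H (w, t))) \<le> B * decay w" for w t
  proof (rule le_decay)
    have "(1 + norm w) ^ (2 * DIM('w)) * ((1 + norm t) ^ j * ((1 + norm w) ^ k * norm (H (w, t))))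
      = ((1 + norm t) ^ j * (1 + norm w) ^ (2 * DIM('w) + k)) * norm (H (w, t))" by (simp add: power_add)
    also have "\<dots> \<le> ((1 + norm (w, t)) ^ j * (1 + norm (w, t)) ^ (2 * DIM('w) + k)) * norm (H (w, t))"
      using norm_fst_le[of w t] norm_snd_le[of t w] by (intro mult_right_mono mult_mono power_mono) auto
    also have "\<dots> \<le> B" using B(2)[of "(w, t)"] by (simp add: power_add)
    finally show "(1 + norm w) ^ (2 * DIM('w)) * ((1 + norm t) ^ j * ((1 + norm w) ^ k * norm (H (w, t)))) \<le> B" .
  qed (use B in auto)
  with B(1) that show ?thesis by blast
qed

lemma integrable_decay_bound:
  fixes f :: "'a::euclidean_space \<Rightarrow> complex"
  assumes "f \<in> borel_measurable borel" "\<And>x. norm (f x) \<le> B * decay x"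
  shows "integrable lborel f"
  by (rule Bochner_Integration.integrable_bound[where f="\<lambda>x. B * decay x"])
     (use assms integrable_decay in \<open>auto intro: order_trans[OF _ abs_ge_self]\<close>)

text \<open>Testing the limit at \<open>z0\<close> along sequences lets dominated convergence act on
  the difference quotients; the mean value inequality on the ball supplies the dominating
  function.\<close>

lemma has_derivative_integral:
  fixes f :: "'w::euclidean_space \<Rightarrow> 'z::euclidean_space \<Rightarrow> complex"
  assumes int: "\<And>z. integrable lborel (\<lambda>w. f w z)"
    and der: "\<And>w z. (f w has_derivative f' w z) (at z)"
    and bnd: "\<And>w z h. z \<in> ball z0 r \<Longrightarrow> norm (f' w z h) \<le> g w * norm h"
    and g: "integrable lborel g" "\<And>w. 0 \<le> g w" and "0 < r"
    and meas [measurable]: "\<And>h. (\<lambda>w. f' w z0 h) \<in> borel_measurable borel"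
  shows "((\<lambda>z. LINT w|lborel. f w z) has_derivative (\<lambda>h. LINT w|lborel. f' w z0 h)) (at z0)"
proof -
  have z0: "z0 \<in> ball z0 r" using \<open>0 < r\<close> by simp
  have int': "integrable lborel (\<lambda>w. f' w z0 h)" for h
    by (rule Bochner_Integration.integrable_bound[where f="\<lambda>w. g w * norm h"])
       (use g bnd[OF z0] in \<open>auto intro: order_trans[OF _ abs_ge_self]\<close>)
  have lin: "linear (f' w z0)" for w by (rule bounded_linear.linear[OF has_derivative_bounded_linear[OF der]])
  show ?thesis unfolding has_derivative_at
  proof
    show "bounded_linear (\<lambda>h. LINT w|lborel. f' w z0 h)"
    proof (rule bounded_linear_intro)
      show "(LINT w|lborel. f' w z0 (x + y)) = (LINT w|lborel. f' w z0 x) + (LINT w|lborel. f' w z0 y)" for x y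
        using int' by (simp add: linear_add[OF lin])
      show "(LINT w|lborel. f' w z0 (c *\<^sub>R x)) = c *\<^sub>R (LINT w|lborel. f' w z0 x)" for c x
        by (simp add: linear_scale[OF lin])
      show "norm (LINT w|lborel. f' w z0 x) \<le> norm x * (LINT w|lborel. g w)" for x
      proof -
        have "norm (LINT w|lborel. f' w z0 x) \<le> (LINT w|lborel. g w * norm x)"
          by (rule Bochner_Integration.integral_norm_bound_integral[OF int']) (use g bnd[OF z0] in auto)
        then show ?thesis by (simp add: mult.commute)
      qed
    qed
    show "(\<lambda>h. norm ((LINT w|lborel. f w (z0 + h)) - (LINT w|lborel. f w z0) - (LINT w|lborel. f' w z0 h)) / norm h) \<midarrow>0\<rightarrow> 0"
      unfolding tendsto_at_iff_sequentially comp_def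
    proof (intro allI impI)
      fix X :: "nat \<Rightarrow> 'z" assume X: "\<forall>i. X i \<in> UNIV - {0}" "X \<longlonglongrightarrow> 0"
      define q where "q i w = (f w (z0 + X i) - f w z0 - f' w z0 (X i)) /\<^sub>R norm (X i)" for i w
      have [measurable]: "(\<lambda>w. f w z) \<in> borel_measurable borel" for z
        using borel_measurable_integrable[OF int[of z]] by simp
      have ev: "\<forall>\<^sub>F i in sequentially. norm (X i) < r"
        using X(2) \<open>0 < r\<close> unfolding tendsto_iff dist_norm by auto
      \<comment> \<open>The bound by \<open>g\<close> is available only inside the ball, so the
        sequence is shifted until its increments stay there.\<close>
      then obtain N where N: "\<And>i. i \<ge> N \<Longrightarrow> norm (X i) < r" unfolding eventually_sequentially by blast
      have "(\<lambda>i. LINT w|lborel. q (i + N) w) \<longlonglongrightarrow> (LINT w|(lborel::'w measure). 0)"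
      proof (rule integral_dominated_convergence[where w="\<lambda>w. 2 * g w"])
        show "AE w in lborel. (\<lambda>i. q (i + N) w) \<longlonglongrightarrow> 0"
        proof (rule AE_I2, rule LIMSEQ_ignore_initial_segment)
          fix w
          have "(\<lambda>h. norm (f w (z0 + h) - f w z0 - f' w z0 h) / norm h) \<midarrow>0\<rightarrow> 0"
            using der[of w z0] unfolding has_derivative_at by blast
          then have "(\<lambda>i. norm (f w (z0 + X i) - f w z0 - f' w z0 (X i)) / norm (X i)) \<longlonglongrightarrow> 0"
            using X unfolding tendsto_at_iff_sequentially comp_def by blast
          then have "(\<lambda>i. norm (q i w)) \<longlonglongrightarrow> 0"
            unfolding q_def by (simp add: divide_inverse mult.commute)
          then show "(\<lambda>i. q i w) \<longlonglongrightarrow> 0" by (rule tendsto_norm_zero_cancel)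
        qed
        show "AE w in lborel. norm (q (i + N) w) \<le> 2 * g w" for i
        proof (rule AE_I2)
          fix w
          let ?h = "X (i + N)"
          have h: "?h \<noteq> 0" "norm ?h < r" using X N by auto
          \<comment> \<open>One g w accounts for the increment of f and a second one for the linear
            term, which gives the factor 2.\<close>
          have "norm (f w (z0 + ?h) - f w z0) \<le> g w * norm (z0 + ?h - z0)"
          proof (rule differentiable_bound[of "ball z0 r" "f w" "f' w"])
            show "onorm (f' w z) \<le> g w" if "z \<in> ball z0 r" for z
              by (rule onorm_le) (use bnd[OF that] in auto)
            show "z0 + ?h \<in> ball z0 r" using h by (simp add: dist_norm)
          qed (use der \<open>0 < r\<close> in \<open>auto intro: has_derivative_at_withinI\<close>)
          moreover have "norm (f' w z0 ?h) \<le> g w * norm ?h" using bnd[OF z0] .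
          ultimately have "norm (f w (z0 + ?h) - f w z0 - f' w z0 ?h) \<le> 2 * g w * norm ?h"
            using norm_triangle_ineq4[of "f w (z0 + ?h) - f w z0" "f' w z0 ?h"] by simp
          then show "norm (q (i + N) w) \<le> 2 * g w"
            unfolding q_def using h by (simp add: pos_divide_le_eq divide_inverse[symmetric] mult.commute[of "inverse _"])
        qed
      qed (use g in \<open>auto simp: q_def\<close>)
      then have "(\<lambda>i. LINT w|lborel. q i w) \<longlonglongrightarrow> 0" by (simp add: LIMSEQ_offset[of _ N])
      then have "(\<lambda>i. norm (LINT w|lborel. q i w)) \<longlonglongrightarrow> 0" by (rule tendsto_norm_zero)
      moreover have "norm (LINT w|lborel. q i w) =
         norm ((LINT w|lborel. f w (z0 + X i)) - (LINT w|lborel. f w z0) - (LINT w|lborel. f' w z0 (X i))) / norm (X i)" for i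
        unfolding q_def using int int' by (simp add: divide_inverse mult.commute)
      ultimately show "(\<lambda>i. norm ((LINT w|lborel. f w (z0 + X i)) - (LINT w|lborel. f w z0) - (LINT w|lborel. f' w z0 (X i))) / norm (X i)) \<longlonglongrightarrow> 0"
        by simp
    qed
  qed
qed

subsection \<open>The partial Fourier transform of a Schwartz function\<close>

text \<open>The parameter \<open>c\<close> covers the inverse transform (1) and the forward one
  (-1). The untransformed variables are carried along as t, so the result lives on the same space as
  \<open>H\<close> and transforms can be composed.\<close>

definition pft :: "real \<Rightarrow> ('w::euclidean_space \<times> 't::euclidean_space \<Rightarrow> complex) \<Rightarrow> 'w \<times> 't \<Rightarrow> complex" where
  "pft c H = (\<lambda>(x, t). LINT w|lborel. e (c * (w \<bullet> x)) * H (w, t))"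

lemma schwartz_slice_borel:
  assumes "schwartz H"
  shows "(\<lambda>w. H (w, t)) \<in> borel_measurable borel"
  by (intro borel_measurable_continuous_onI continuous_on_compose2[OF schwartz_continuous_on[OF assms, of UNIV]])
     (auto intro: continuous_intros)

lemma pft_integrable:
  assumes "schwartz H"
  shows "integrable lborel (\<lambda>w. e (c * (w \<bullet> x)) * H (w, t))"
proof -
  obtain B where B: "0 \<le> B" "\<And>w t. (1 + norm t) ^ 0 * ((1 + norm w) ^ 0 * norm (H (w, t))) \<le> B * decay w"
    by (rule schwartz_slice_decay[OF assms, of 0 0]) blast
  have [measurable]: "(\<lambda>w. H (w, t)) \<in> borel_measurable borel" by (rule schwartz_slice_borel[OF assms])
  show ?thesis by (rule integrable_decay_bound[where B=B]) (use B in \<open>auto simp: norm_mult\<close>)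
qed

lemma pft_bounded:
  assumes "schwartz H"
  shows "\<exists>B. \<forall>z. norm (pft c H z) \<le> B"
proof -
  obtain B where B: "0 \<le> B" "\<And>w t. (1 + norm t) ^ 0 * ((1 + norm w) ^ 0 * norm (H (w, t))) \<le> B * decay w"
    by (rule schwartz_slice_decay[OF assms, of 0 0]) blast
  have "norm (pft c H (x, t)) \<le> (LINT w|lborel. B * decay (w::'a))" for x t
    unfolding pft_def prod.case
    by (rule Bochner_Integration.integral_norm_bound_integral)
       (use B assms integrable_decay in \<open>auto simp: norm_mult intro: pft_integrable\<close>)
  then show ?thesis by auto
qed

lemma frechet_derivative_zero:
  "f differentiable (at x) \<Longrightarrow> frechet_derivative f (at x) 0 = 0"
  by (metis bounded_linear.linear frechet_derivative_works has_derivative_bounded_linear linear_0)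

text \<open>A derivative in x brings down a factor c (w . h), one in t falls on \<open>H\<close>.
  Both integrands are dominated by a multiple of \<open>decay\<close>, uniformly in (x, t).\<close>

lemma has_derivative_pft:
  fixes H :: "'w::euclidean_space \<times> 't::euclidean_space \<Rightarrow> complex"
  assumes H: "schwartz H"
  shows "(pft c H has_derivative (\<lambda>h. LINT w|lborel.
     e (c * (w \<bullet> x)) * (2 * of_real pi * \<i> * of_real (c * (w \<bullet> fst h))) * H (w, t) +
     e (c * (w \<bullet> x)) * frechet_derivative H (at (w, t)) (0, snd h))) (at (x, t))"
proof -
  define f where "f w z = e (c * (w \<bullet> fst z)) * H (w, snd z)" for w z
  define f' where "f' w z h = e (c * (w \<bullet> fst z)) * (2 * of_real pi * \<i> * of_real (c * (w \<bullet> fst h))) * H (w, snd z) +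
     e (c * (w \<bullet> fst z)) * frechet_derivative H (at (w, snd z)) (0, snd h)" for w z h
  have slice_deriv: "frechet_derivative H (at (w, s)) (0, k) = (\<Sum>b\<in>Basis. ((0, k) \<bullet> b) *\<^sub>R pd b H (w, s))" for w s k
    by (rule fun_cong[OF frechet_derivative_eqI[OF differentiable_has_derivative_pd[OF schwartz_differentiable[OF H]]]])
  \<comment> \<open>The spare power of 1 + norm w absorbs the factor w brought down by the
    exponential.\<close>
  obtain B1 where B1: "0 \<le> B1" "\<And>w t. (1 + norm t) ^ 0 * ((1 + norm w) ^ 1 * norm (H (w, t))) \<le> B1 * decay w"
    by (rule schwartz_slice_decay[OF H, of 0 1]) blast
  have "\<exists>B\<ge>0. \<forall>w t. norm (pd b H (w, t)) \<le> B * decay w" if "b \<in> Basis" for b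
    using schwartz_slice_decay[OF schwartz_pd[OF H that], of 0 0] by (metis mult_1 power_0)
  then obtain B2 where B2: "\<And>b. b \<in> Basis \<Longrightarrow> 0 \<le> B2 b"
    "\<And>b w t. b \<in> Basis \<Longrightarrow> norm (pd b H (w, t)) \<le> B2 b * decay w" by metis
  define g where "g w = (2 * pi * \<bar>c\<bar> * B1 + (\<Sum>b\<in>Basis. B2 b)) * decay w" for w :: 'w
  have "((\<lambda>z. LINT w|lborel. f w z) has_derivative (\<lambda>h. LINT w|lborel. f' w (x, t) h)) (at (x, t))"
  proof (rule has_derivative_integral[where g=g and r=1])
    show "integrable lborel (\<lambda>w. f w z)" for z
      unfolding f_def by (rule pft_integrable[OF H])
    show "(f w has_derivative f' w z) (at z)" for w z
    proof -
      have 1: "((\<lambda>z. c * (w \<bullet> fst z)) has_derivative (\<lambda>h. c * (w \<bullet> fst h))) (at z)"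
        by (auto intro!: derivative_eq_intros)
      have 2: "((\<lambda>z. (w, snd z)) has_derivative (\<lambda>h. (0, snd h))) (at z)"
        by (auto intro!: derivative_eq_intros)
      have "(H has_derivative frechet_derivative H (at (w, snd z))) (at (w, snd z))"
        using schwartz_differentiable[OF H] by (simp add: frechet_derivative_works)
      from has_derivative_mult[OF has_derivative_e[OF 1] has_derivative_compose[OF 2 this]]
      show ?thesis unfolding f_def f'_def by (simp add: algebra_simps)
    qed
    show "norm (f' w z h) \<le> g w * norm h" for w z h
    proof -
      have "norm (f' w z h) \<le> (2 * pi * \<bar>c\<bar>) * (\<bar>w \<bullet> fst h\<bar> * norm (H (w, snd z))) + norm (frechet_derivative H (at (w, snd z)) (0, snd h))"
        unfolding f'_def by (rule order_trans[OF norm_triangle_ineq]) (simp add: norm_mult abs_mult)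
      also have "\<dots> \<le> (2 * pi * \<bar>c\<bar>) * (B1 * decay w * norm h) + (\<Sum>b\<in>Basis. B2 b) * decay w * norm h"
      proof (intro add_mono mult_left_mono)
        have "\<bar>w \<bullet> fst h\<bar> * norm (H (w, snd z)) \<le> (norm w * norm h) * norm (H (w, snd z))"
          using Cauchy_Schwarz_ineq2[of w "fst h"] norm_fst_le[of "fst h" "snd h"]
          by (intro mult_right_mono) (auto intro: order_trans[OF _ mult_left_mono])
        also have "\<dots> \<le> ((1 + norm w) * norm h) * norm (H (w, snd z))" by (intro mult_right_mono) auto
        also have "\<dots> = ((1 + norm w) * norm (H (w, snd z))) * norm h" by simp
        also have "\<dots> \<le> B1 * decay w * norm h" using B1(2)[of "snd z" w] by (intro mult_right_mono) auto
        finally show "\<bar>w \<bullet> fst h\<bar> * norm (H (w, snd z)) \<le> B1 * decay w * norm h" .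
        have "norm (frechet_derivative H (at (w, snd z)) (0, snd h)) \<le> (\<Sum>b\<in>Basis. norm h * (B2 b * decay w))"
          unfolding slice_deriv
        proof (rule sum_norm_le)
          fix b :: "'w \<times> 't" assume b: "b \<in> Basis"
          have "\<bar>(0, snd h) \<bullet> b\<bar> \<le> norm h"
            using Basis_le_norm[OF b, of "(0, snd h)"] norm_snd_le[of "snd h" "fst h"] by simp
          then show "norm (((0, snd h) \<bullet> b) *\<^sub>R pd b H (w, snd z)) \<le> norm h * (B2 b * decay w)"
            unfolding norm_scaleR real_norm_def using B2 b by (intro mult_mono) auto
        qed
        then show "norm (frechet_derivative H (at (w, snd z)) (0, snd h)) \<le> (\<Sum>b\<in>Basis. B2 b) * decay w * norm h"
          by (simp add: sum_distrib_right sum_distrib_left mult_ac)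
      qed auto
      finally show ?thesis unfolding g_def by (simp add: algebra_simps)
    qed
    show "integrable lborel g" unfolding g_def by (intro integrable_mult_right integrable_decay)
    show "0 \<le> g w" for w unfolding g_def
      using B1 B2 less_imp_le[OF decay_pos] by (auto intro!: mult_nonneg_nonneg add_nonneg_nonneg sum_nonneg)
    show "(\<lambda>w. f' w (x, t) h) \<in> borel_measurable borel" for h
    proof -
      have [measurable]: "(\<lambda>w. H (w, t)) \<in> borel_measurable borel"
        "b \<in> Basis \<Longrightarrow> (\<lambda>w. pd b H (w, t)) \<in> borel_measurable borel" for b
        by (intro schwartz_slice_borel schwartz_pd H; assumption)+
      show ?thesis unfolding f'_def slice_deriv snd_conv fst_conv by measurable
    qed
  qed simp
  moreover have "(\<lambda>z. LINT w|lborel. f w z) = pft c H" unfolding f_def pft_def by auto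
  ultimately show ?thesis unfolding f'_def by simp
qed

text \<open>Boundary terms never appear: the integral of the translate G (w + s u) does not depend
  on s, so the integral of its s-derivative at 0 is zero, and the product rule splits that
  derivative into the two sides.\<close>

lemma pft_ibp:
  fixes H :: "'w::euclidean_space \<times> 't::euclidean_space \<Rightarrow> complex"
  assumes H: "schwartz H" and u: "u \<in> Basis"
  shows "2 * of_real pi * \<i> * of_real (c * (u \<bullet> x)) * pft c H (x, t) = - pft c (pd (u, 0) H) (x, t)"
proof -
  have ub: "(u, 0) \<in> (Basis :: ('w \<times> 't) set)" using u by (auto simp: Basis_prod_def)
  define G where "G w = e (c * (w \<bullet> x)) * H (w, t)" for w
  define G' where "G' w = e (c * (w \<bullet> x)) * (2 * of_real pi * \<i> * of_real (c * (u \<bullet> x)) * H (w, t) + pd (u, 0) H (w, t))" for w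
  define a where "a = 2 * pi * \<bar>c * (u \<bullet> x)\<bar>"
  let ?D = "2 * DIM('w)"
  obtain B1 where B1: "0 \<le> B1" "\<And>z. (1 + norm z) ^ ?D * norm (H z) \<le> B1"
    by (rule schwartz_bound[OF H, of ?D]) blast
  obtain B2 where B2: "0 \<le> B2" "\<And>z. (1 + norm z) ^ ?D * norm (pd (u, 0) H z) \<le> B2"
    by (rule schwartz_bound[OF schwartz_pd[OF H ub], of ?D]) blast
  \<comment> \<open>For |s| < 1 and a unit vector u, 1 + norm w is at most twice 1 + the norm of the
    shifted point; hence the power of 2.\<close>
  let ?B = "2 ^ ?D * (a * B1 + B2)"
  have bound: "norm (G' (w + s *\<^sub>R u)) \<le> ?B * decay w" if "\<bar>s\<bar> < 1" for w s
  proof (rule le_decay)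
    let ?z = "(w + s *\<^sub>R u, t)"
    have "norm w \<le> norm (w + s *\<^sub>R u) + norm (s *\<^sub>R u)"
      by (metis add_diff_cancel_right' norm_triangle_ineq4)
    also have "\<dots> \<le> norm ?z + 1" using that u norm_fst_le[of "w + s *\<^sub>R u" t] by simp
    finally have nw: "norm w \<le> norm ?z + 1" .
    have "(1 + norm w) ^ ?D \<le> (2 * (1 + norm ?z)) ^ ?D"
    proof (rule power_mono)
      note nw
      moreover have "a \<le> b + 1 \<Longrightarrow> 0 \<le> b \<Longrightarrow> 1 + a \<le> 2 * (1 + b)" for a b :: real by simp
      ultimately show "1 + norm w \<le> 2 * (1 + norm ?z)" using norm_ge_zero by blast
    qed simp
    then have w: "(1 + norm w) ^ ?D \<le> 2 ^ ?D * (1 + norm ?z) ^ ?D" by (simp only: power_mult_distrib)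
    have "norm (G' (w + s *\<^sub>R u)) \<le> a * norm (H ?z) + norm (pd (u, 0) H ?z)"
      unfolding G'_def a_def norm_mult norm_e mult_1_left
      by (rule order_trans[OF norm_triangle_ineq]) (simp add: norm_mult abs_mult)
    then have "(1 + norm w) ^ ?D * norm (G' (w + s *\<^sub>R u)) \<le>
        (2 ^ ?D * (1 + norm ?z) ^ ?D) * (a * norm (H ?z) + norm (pd (u, 0) H ?z))"
      by (intro mult_mono w) (auto simp: a_def)
    also have "\<dots> = 2 ^ ?D * (a * ((1 + norm ?z) ^ ?D * norm (H ?z)) + (1 + norm ?z) ^ ?D * norm (pd (u, 0) H ?z))"
      by (simp add: algebra_simps)
    also have "\<dots> \<le> ?B" using B1(2)[of ?z] B2(2)[of ?z]
      by (intro mult_left_mono add_mono) (auto simp: a_def)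
    finally show "(1 + norm w) ^ ?D * norm (G' (w + s *\<^sub>R u)) \<le> ?B" .
  qed (use B1 B2 in \<open>auto simp: a_def\<close>)
  have [measurable]: "(\<lambda>w. H (w, t)) \<in> borel_measurable borel"
    "(\<lambda>w. pd (u, 0) H (w, t)) \<in> borel_measurable borel"
    by (intro schwartz_slice_borel schwartz_pd H ub)+
  have [measurable]: "G' \<in> borel_measurable borel" "G \<in> borel_measurable borel"
    unfolding G'_def G_def by measurable
  have intG: "integrable lborel G" unfolding G_def by (rule pft_integrable[OF H])
  have shift: "integrable lborel (\<lambda>w. G (w + s *\<^sub>R u))" "(LINT w|lborel. G (w + s *\<^sub>R u)) = (LINT w|lborel. G w)" for s
  proof -
    have d: "lborel = distr lborel borel ((+) (s *\<^sub>R u))" by (simp add: lborel_distr_plus)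
    show "integrable lborel (\<lambda>w. G (w + s *\<^sub>R u))"
      using intG by (subst (asm) d) (simp add: integrable_distr_eq add.commute)
    show "(LINT w|lborel. G (w + s *\<^sub>R u)) = (LINT w|lborel. G w)"
      by (subst (2) d) (simp add: integral_distr add.commute)
  qed
  have "((\<lambda>s. LINT w|lborel. G (w + s *\<^sub>R u)) has_derivative (\<lambda>k. LINT w|lborel. k *\<^sub>R G' (w + 0 *\<^sub>R u))) (at (0::real))"
  proof (rule has_derivative_integral[where g="\<lambda>w. ?B * decay w" and r=1 and f'="\<lambda>w s k. k *\<^sub>R G' (w + s *\<^sub>R u)"])
    show "((\<lambda>s. G (w + s *\<^sub>R u)) has_derivative (\<lambda>k. k *\<^sub>R G' (w + s *\<^sub>R u))) (at s)" for w s
    proof -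
      have 1: "((\<lambda>s. c * ((w + s *\<^sub>R u) \<bullet> x)) has_derivative (\<lambda>k. k * (c * (u \<bullet> x)))) (at s)"
        by (auto intro!: derivative_eq_intros)
      have 2: "((\<lambda>s. (w + s *\<^sub>R u, t)) has_derivative (\<lambda>k. (k *\<^sub>R u, 0))) (at s)"
        by (auto intro!: derivative_eq_intros)
      let ?z = "(w + s *\<^sub>R u, t)"
      have 3: "(H has_derivative frechet_derivative H (at ?z)) (at ?z)"
        using schwartz_differentiable[OF H] by (simp add: frechet_derivative_works)
      have 4: "frechet_derivative H (at ?z) (k *\<^sub>R u, 0) = k *\<^sub>R pd (u, 0) H ?z" for k
        using linear_scale[OF bounded_linear.linear[OF has_derivative_bounded_linear[OF 3]], of k "(u, 0)"] by simp
      show ?thesis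
        using has_derivative_mult[OF has_derivative_e[OF 1] has_derivative_compose[OF 2 3]]
        unfolding G_def G'_def 4 by (simp add: algebra_simps scaleR_conv_of_real)
    qed
    show "norm (k *\<^sub>R G' (w + s *\<^sub>R u)) \<le> ?B * decay w * norm k" if "s \<in> ball 0 1" for w s k
      using bound[of s w] that by (auto simp: mult.commute intro: mult_left_mono)
    show "0 \<le> ?B * decay w" for w :: 'w
      using B1 B2 less_imp_le[OF decay_pos, of w] by (auto simp: a_def)
    show "integrable lborel (\<lambda>w::'w. ?B * decay w)" by (intro integrable_mult_right integrable_decay)
  qed (auto intro: shift)
  then have "((\<lambda>s. LINT w|lborel. G w) has_derivative (\<lambda>k. LINT w|lborel. k *\<^sub>R G' w)) (at (0::real))"
    by (simp add: shift)
  moreover have "((\<lambda>s. LINT w|lborel. G w) has_derivative (\<lambda>k. 0)) (at (0::real))" by simp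
  ultimately have "(\<lambda>k. LINT w|lborel. k *\<^sub>R G' w) = (\<lambda>k::real. 0)" by (rule has_derivative_unique)
  from fun_cong[OF this, of 1] have "(LINT w|lborel. G' w) = 0" by simp
  moreover have "(LINT w|lborel. G' w) = (LINT w|lborel. 2 * of_real pi * \<i> * of_real (c * (u \<bullet> x)) * G w + e (c * (w \<bullet> x)) * pd (u, 0) H (w, t))"
    unfolding G'_def G_def by (intro Bochner_Integration.integral_cong) (auto simp: algebra_simps)
  moreover have "\<dots> = 2 * of_real pi * \<i> * of_real (c * (u \<bullet> x)) * (LINT w|lborel. G w) + (LINT w|lborel. e (c * (w \<bullet> x)) * pd (u, 0) H (w, t))"
    by (subst Bochner_Integration.integral_add)
       (use intG pft_integrable[OF schwartz_pd[OF H ub]] in auto)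
  ultimately show ?thesis unfolding pft_def G_def by (simp add: eq_neg_iff_add_eq_0)
qed

lemma schwartz_mult_linear:
  assumes "schwartz H" "bounded_linear l"
  shows "schwartz (\<lambda>z. a * of_real (l z) * H z)"
  using assms by (intro schwartz_mult multipliers.intros)

text \<open>A coordinate in a Fourier direction becomes a derivative of \<open>H\<close> by
  \<open>pft_ibp\<close>, at the price of dividing by 2 pi |c|; a coordinate in a parameter
  direction is multiplied into \<open>H\<close>. Either way another Schwartz function is
  transformed, whence the induction over k with \<open>H\<close> arbitrary.\<close>

lemma pft_decay:
  fixes H :: "'w::euclidean_space \<times> 't::euclidean_space \<Rightarrow> complex"
  assumes "c \<noteq> 0" "schwartz H"
  shows "\<exists>B. \<forall>z. norm z ^ k * norm (pft c H z) \<le> B"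
  using assms(2)
proof (induction k arbitrary: H)
  case 0
  then show ?case using pft_bounded by auto
next
  case (Suc k)
  have "\<exists>B. \<forall>z. norm z ^ k * (\<bar>z \<bullet> b\<bar> * norm (pft c H z)) \<le> B" if b: "b \<in> Basis" for b
  proof -
    consider u where "b = (u, 0)" "u \<in> Basis" | v where "b = (0, v)" "v \<in> Basis"
      using b by (auto simp: Basis_prod_def)
    then show ?thesis
    proof cases
      case (1 u)
      obtain B where B: "\<forall>z. norm z ^ k * norm (pft c (pd b H) z) \<le> B"
        using Suc.IH[OF schwartz_pd[OF Suc.prems b]] by blast
      have "norm z ^ k * (\<bar>z \<bullet> b\<bar> * norm (pft c H z)) \<le> B / (2 * pi * \<bar>c\<bar>)" for z
      proof -
        obtain x t where z: "z = (x, t)" by (cases z)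
        have "norm (2 * of_real pi * \<i> * of_real (c * (u \<bullet> x)) * pft c H (x, t)) = norm (pft c (pd b H) (x, t))"
          using pft_ibp[OF Suc.prems 1(2), of c x t] 1 by simp
        then have "(2 * pi * \<bar>c\<bar>) * (\<bar>z \<bullet> b\<bar> * norm (pft c H z)) = norm (pft c (pd b H) z)"
          unfolding z 1 by (simp add: norm_mult abs_mult inner_commute)
        then have "norm z ^ k * ((2 * pi * \<bar>c\<bar>) * (\<bar>z \<bullet> b\<bar> * norm (pft c H z))) \<le> B" using B by metis
        then show ?thesis using assms(1) by (simp add: field_simps)
      qed
      then show ?thesis by blast
    next
      case (2 v)
      have "schwartz (\<lambda>z. 1 * of_real (z \<bullet> b) * H z)"
        by (rule schwartz_mult_linear[OF Suc.prems bounded_linear_inner_left])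
      then obtain B where B: "\<forall>z. norm z ^ k * norm (pft c (\<lambda>z. 1 * of_real (z \<bullet> b) * H z) z) \<le> B"
        using Suc.IH by blast
      have "pft c (\<lambda>z. 1 * of_real (z \<bullet> b) * H z) z = of_real (z \<bullet> b) * pft c H z" for z
        unfolding pft_def 2 by (cases z) (simp add: mult.left_commute)
      then have "norm (pft c (\<lambda>z. 1 * of_real (z \<bullet> b) * H z) z) = \<bar>z \<bullet> b\<bar> * norm (pft c H z)" for z
        by (simp add: norm_mult)
      with B show ?thesis by auto
    qed
  qed
  then obtain B where B: "\<And>b z. b \<in> Basis \<Longrightarrow> norm z ^ k * (\<bar>z \<bullet> b\<bar> * norm (pft c H z)) \<le> B b" by metis
  have "norm z ^ Suc k * norm (pft c H z) \<le> (\<Sum>b\<in>Basis. B b)" for z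
  proof -
    have "norm z ^ Suc k * norm (pft c H z) \<le> norm z ^ k * ((\<Sum>b\<in>Basis. \<bar>z \<bullet> b\<bar>) * norm (pft c H z))"
      unfolding power_Suc2 mult.assoc by (intro mult_left_mono mult_right_mono norm_le_l1) auto
    also have "\<dots> = (\<Sum>b\<in>Basis. norm z ^ k * (\<bar>z \<bullet> b\<bar> * norm (pft c H z)))"
      by (simp add: sum_distrib_left sum_distrib_right)
    also have "\<dots> \<le> (\<Sum>b\<in>Basis. B b)" by (intro sum_mono B)
    finally show ?thesis .
  qed
  then show ?case by blast
qed

text \<open>The class of all transforms of Schwartz functions is closed under derivatives: a Fourier
  direction multiplies \<open>H\<close> by a coordinate, a parameter direction differentiates
  \<open>H\<close>.\<close>

theorem schwartz_pft:
  fixes H :: "'w::euclidean_space \<times> 't::euclidean_space \<Rightarrow> complex"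
  assumes "c \<noteq> 0" "schwartz H"
  shows "schwartz (pft c H)"
proof -
  let ?C = "{pft c H |H :: 'w \<times> 't \<Rightarrow> complex. schwartz H}"
  have "pft c H \<in> ?C" using assms by blast
  then show ?thesis
  proof (induction rule: schwartz_coinduct)
    case (diff g x)
    then obtain H :: "'w \<times> 't \<Rightarrow> complex" where g: "g = pft c H" "schwartz H" by blast
    show ?case using has_derivative_pft[OF g(2), of c "fst x" "snd x"] unfolding g(1) differentiable_def by auto
  next
    case (deriv g b)
    then obtain H :: "'w \<times> 't \<Rightarrow> complex" where g: "g = pft c H" and H: "schwartz H" by blast
    have pd: "pd b g (x, t) = (LINT w|lborel.
     e (c * (w \<bullet> x)) * (2 * of_real pi * \<i> * of_real (c * (w \<bullet> fst b))) * H (w, t) +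
     e (c * (w \<bullet> x)) * frechet_derivative H (at (w, t)) (0, snd b))" for x t
      unfolding g by (rule fun_cong[OF frechet_derivative_eqI[OF has_derivative_pft[OF H]]])
    consider u where "b = (u, 0)" "u \<in> Basis" | v where "b = (0, v)" "v \<in> Basis"
      using deriv(2) by (auto simp: Basis_prod_def)
    then show ?case
    proof cases
      case (1 u)
      let ?H = "\<lambda>z. (2 * of_real pi * \<i> * of_real c) * of_real (z \<bullet> b) * H z"
      have "schwartz ?H" by (rule schwartz_mult_linear[OF H bounded_linear_inner_left])
      moreover have "pd b g = pft c ?H"
      proof
        fix z :: "'w \<times> 't"
        obtain x t where z: "z = (x, t)" by (cases z)
        show "pd b g z = pft c ?H z" unfolding z pd unfolding pft_def 1 prod.case
          by (intro Bochner_Integration.integral_cong)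
             (auto simp: frechet_derivative_zero schwartz_differentiable[OF H] zero_prod_def[symmetric])
      qed
      ultimately show ?thesis by blast
    next
      case (2 v)
      have "pd b g = pft c (pd b H)"
      proof
        fix z :: "'w \<times> 't"
        obtain x t where z: "z = (x, t)" by (cases z)
        show "pd b g z = pft c (pd b H) z" unfolding z pd unfolding pft_def 2 prod.case by simp
      qed
      then show ?thesis using schwartz_pd[OF H deriv(2)] by blast
    qed
  next
    case (decay g k)
    then show ?case using pft_decay[OF assms(1)] by blast
  qed
qed

subsection \<open>Fourier inversion\<close>

lemma
  fixes F :: "'a::euclidean_space \<Rightarrow> real \<Rightarrow> complex"
  assumes F: "\<And>b. b \<in> Basis \<Longrightarrow> integrable lborel (F b)"
  shows integrable_lborel_prod: "integrable lborel (\<lambda>x::'a. \<Prod>b\<in>Basis. F b (x \<bullet> b))"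
    and integral_lborel_prod: "(LINT x|lborel. (\<Prod>b\<in>Basis. F b ((x::'a) \<bullet> b))) = (\<Prod>b\<in>Basis. (LINT x|lborel. F b x))"
proof -
  interpret product_sigma_finite "\<lambda>_::'a. lborel :: real measure" ..
  let ?T = "\<lambda>f. \<Sum>b\<in>(Basis::'a set). f b *\<^sub>R b"
  let ?P = "\<Pi>\<^sub>M b\<in>(Basis::'a set). (lborel :: real measure)"
  have [measurable]: "b \<in> Basis \<Longrightarrow> F b \<in> borel_measurable borel" for b
    using F borel_measurable_integrable by fastforce
  have T [measurable]: "?T \<in> ?P \<rightarrow>\<^sub>M borel" by measurable
  have M [measurable]: "(\<lambda>x::'a. \<Prod>b\<in>Basis. F b (x \<bullet> b)) \<in> borel_measurable borel"
    by measurable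
  have eq: "(\<Prod>b\<in>Basis. F b (?T f \<bullet> b)) = (\<Prod>b\<in>Basis. F b (f b))" for f
    by (intro prod.cong refl) (simp add: inner_sum_left inner_Basis if_distrib sum.delta' cong: if_cong)
  show "integrable lborel (\<lambda>x::'a. \<Prod>b\<in>Basis. F b (x \<bullet> b))"
    unfolding lborel_eq[where 'a='a] integrable_distr_eq[OF T M] eq
    by (rule product_integrable_prod) (use F in auto)
  show "(LINT x|lborel. (\<Prod>b\<in>Basis. F b ((x::'a) \<bullet> b))) = (\<Prod>b\<in>Basis. (LINT x|lborel. F b x))"
    unfolding lborel_eq[where 'a='a] integral_distr[OF T M] eq
    by (rule product_integral_prod) (use F in auto)
qed

text \<open>The unnormalised standard Gaussian: its coordinates separate, and in each of them the
  transform is, up to sqrt (2 pi), the characteristic function of the standard normal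
  distribution.\<close>

definition gauss :: "'a::euclidean_space \<Rightarrow> real" where
  "gauss x = exp (- (norm x)\<^sup>2 / 2)"

lemma gauss_prod: "gauss x = (\<Prod>b\<in>Basis. exp (- (x \<bullet> b)\<^sup>2 / 2))"
  unfolding gauss_def power2_norm_eq_inner
  by (subst euclidean_inner) (simp add: exp_sum[symmetric] sum_negf sum_divide_distrib power2_eq_square)

lemma gauss_borel [measurable]: "gauss \<in> borel_measurable borel"
  unfolding gauss_def by measurable

lemma
  fixes t :: real
  shows integrable_gauss_real: "integrable lborel (\<lambda>x. iexp (x * t) * of_real (exp (- x\<^sup>2 / 2)))"
    and integral_gauss_real: "(LINT x|lborel. iexp (x * t) * of_real (exp (- x\<^sup>2 / 2))) = of_real (sqrt (2 * pi) * exp (- t\<^sup>2 / 2))"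
proof -
  have eq: "iexp (x * t) * of_real (exp (- x\<^sup>2 / 2)) = of_real (sqrt (2 * pi)) * (std_normal_density x *\<^sub>R iexp (t * x))" for x
    unfolding std_normal_density_def by (simp add: scaleR_conv_of_real mult_ac)
  have "integrable lborel (\<lambda>x. std_normal_density x *\<^sub>R iexp (t * x))"
    by (rule Bochner_Integration.integrable_bound[OF integrable_normal_density[of 1 0]])
       (auto simp: std_normal_density_def[symmetric] norm_mult)
  then show "integrable lborel (\<lambda>x. iexp (x * t) * of_real (exp (- x\<^sup>2 / 2)))"
    unfolding eq by (rule integrable_mult_right)
  have "char std_normal_distribution t = (LINT x|lborel. std_normal_density x *\<^sub>R iexp (t * x))"
    unfolding char_def
    by (subst integral_density) auto
  then show "(LINT x|lborel. iexp (x * t) * of_real (exp (- x\<^sup>2 / 2))) = of_real (sqrt (2 * pi) * exp (- t\<^sup>2 / 2))"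
    unfolding eq integral_mult_right_zero by (simp add: char_std_normal_distribution)
qed

lemma
  fixes u :: "'a::euclidean_space"
  shows integrable_gauss_exp: "integrable lborel (\<lambda>x. iexp (x \<bullet> u) * of_real (gauss x))"
    and integral_gauss_exp: "(LINT x|lborel. iexp (x \<bullet> u) * of_real (gauss x)) = of_real (sqrt (2 * pi) ^ DIM('a) * gauss u)"
proof -
  have eq: "iexp (x \<bullet> u) * of_real (gauss x) = (\<Prod>b\<in>Basis. iexp ((x \<bullet> b) * (u \<bullet> b)) * of_real (exp (- (x \<bullet> b)\<^sup>2 / 2)))" for x :: 'a
    unfolding gauss_prod prod.distrib
    by (subst euclidean_inner) (simp add: exp_sum sum_distrib_left)
  show "integrable lborel (\<lambda>x. iexp (x \<bullet> u) * of_real (gauss x))"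
    unfolding eq by (rule integrable_lborel_prod[OF integrable_gauss_real])
  show "(LINT x|lborel. iexp (x \<bullet> u) * of_real (gauss x)) = of_real (sqrt (2 * pi) ^ DIM('a) * gauss u)"
    unfolding eq integral_lborel_prod[OF integrable_gauss_real] integral_gauss_real
    by (simp add: prod.distrib gauss_prod)
qed

lemma integrable_gauss: "integrable lborel (gauss :: 'a::euclidean_space \<Rightarrow> real)"
  and integral_gauss: "(LINT x|lborel. gauss (x::'a)) = sqrt (2 * pi) ^ DIM('a)"
proof -
  show "integrable lborel (gauss :: 'a::euclidean_space \<Rightarrow> real)"
    using integrable_Re[OF integrable_gauss_exp[of "0::'a"]] by simp
  have "complex_of_real (LINT x|lborel. gauss (x::'a)) = complex_of_real (sqrt (2 * pi) ^ DIM('a))"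
    using integral_gauss_exp[of "0::'a"] by (simp add: gauss_def)
  then show "(LINT x|lborel. gauss (x::'a)) = sqrt (2 * pi) ^ DIM('a)" by (simp only: of_real_eq_iff)
qed

lemma
  fixes f :: "'a::euclidean_space \<Rightarrow> complex"
  assumes [measurable]: "f \<in> borel_measurable borel" and c: "c \<noteq> 0"
  shows integral_affine: "(LINT x|lborel. f x) = \<bar>c\<bar> ^ DIM('a) *\<^sub>R (LINT x|lborel. f (t + c *\<^sub>R x))"
    and integrable_affine_iff: "integrable lborel (\<lambda>x. f (t + c *\<^sub>R x)) \<longleftrightarrow> integrable lborel f"
proof -
  note l = lborel_affine[OF c, of t]
  show "(LINT x|lborel. f x) = \<bar>c\<bar> ^ DIM('a) *\<^sub>R (LINT x|lborel. f (t + c *\<^sub>R x))"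
    by (subst l) (simp add: integral_density integral_distr)
  show "integrable lborel (\<lambda>x. f (t + c *\<^sub>R x)) \<longleftrightarrow> integrable lborel f"
  proof -
    let ?k = "\<bar>c\<bar> ^ DIM('a)"
    have "integrable lborel (\<lambda>x. ?k *\<^sub>R g x) \<longleftrightarrow> integrable lborel g" for g :: "'a \<Rightarrow> complex"
      using integrable_scaleR_right[of "1 / ?k" lborel "\<lambda>x. ?k *\<^sub>R g x"] c by auto
    moreover have "integrable lborel f \<longleftrightarrow> integrable lborel (\<lambda>x. ?k *\<^sub>R f (t + c *\<^sub>R x))"
      by (subst l) (simp add: integrable_density integrable_distr_eq)
    ultimately show ?thesis by simp
  qed
qed

definition ft :: "real \<Rightarrow> ('w::euclidean_space \<Rightarrow> complex) \<Rightarrow> 'w \<Rightarrow> complex" where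
  "ft c f x = (LINT w|lborel. e (c * (w \<bullet> x)) * f w)"

lemma e_eq_iexp: "e t = iexp (2 * pi * t)"
  unfolding e_def by (simp add: mult_ac)

lemma integrable_times_pair:
  fixes f :: "'a::euclidean_space \<Rightarrow> complex" and g :: "'b::euclidean_space \<Rightarrow> complex"
  assumes f: "integrable lborel f" and g: "integrable lborel g"
  shows "integrable (lborel \<Otimes>\<^sub>M lborel) (\<lambda>(x, y). f x * g y)"
proof (rule lborel_pair.Fubini_integrable)
  have [measurable]: "f \<in> borel_measurable borel" "g \<in> borel_measurable borel"
    using f g borel_measurable_integrable by fastforce+
  show "(\<lambda>(x, y). f x * g y) \<in> borel_measurable (lborel \<Otimes>\<^sub>M lborel)" by measurable
qed (use f g in \<open>auto simp: norm_mult\<close>)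

text \<open>A Gaussian cutoff gauss (x / m) makes the double integral absolutely convergent.
  Removing the cutoff gives the left-hand side by dominated convergence; exchanging the integrals
  first gives averages of f against Gaussians concentrating at p, which converge to f p by
  continuity and boundedness. The condition on c says that it is 1 or -1.\<close>

theorem fourier_inversion:
  fixes f :: "'w::euclidean_space \<Rightarrow> complex"
  assumes c: "c\<^sup>2 = 1" and cont: "continuous_on UNIV f" and f: "integrable lborel f"
    and bnd: "\<And>x. norm (f x) \<le> B" and ftf: "integrable lborel (ft c f)"
  shows "ft (- c) (ft c f) p = f p"
proof -
  define \<kappa> where "\<kappa> = sqrt (2 * pi) ^ DIM('w)"
  have [measurable]: "f \<in> borel_measurable borel" using cont by (rule borel_measurable_continuous_onI)
  have [measurable]: "ft c f \<in> borel_measurable borel"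
    using ftf borel_measurable_integrable by fastforce
  define m where "m i = real (Suc i)" for i
  have m: "0 < m i" for i unfolding m_def by simp
  have m_inf: "(\<lambda>i. 1 / m i) \<longlonglongrightarrow> 0"
    unfolding m_def by (rule LIMSEQ_Suc[OF lim_1_over_n])
  define A where "A i = (LINT x|lborel. e (- c * (x \<bullet> p)) * ft c f x * of_real (gauss ((1 / m i) *\<^sub>R x)))" for i
  have "A \<longlonglongrightarrow> (LINT x|lborel. e (- c * (x \<bullet> p)) * ft c f x)"
    unfolding A_def
  proof (rule integral_dominated_convergence[where w="\<lambda>x. norm (ft c f x)"])
    show "AE x in lborel. (\<lambda>i. e (- c * (x \<bullet> p)) * ft c f x * of_real (gauss ((1 / m i) *\<^sub>R x))) \<longlonglongrightarrow> e (- c * (x \<bullet> p)) * ft c f x"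
    proof (rule AE_I2)
      fix x :: 'w
      have "(\<lambda>i. gauss ((1 / m i) *\<^sub>R x)) \<longlonglongrightarrow> exp (- (norm (0 *\<^sub>R x))\<^sup>2 / 2)"
        unfolding gauss_def by (intro tendsto_intros m_inf) auto
      then have g: "(\<lambda>i. gauss ((1 / m i) *\<^sub>R x)) \<longlonglongrightarrow> 1" by simp
      show "(\<lambda>i. e (- c * (x \<bullet> p)) * ft c f x * of_real (gauss ((1 / m i) *\<^sub>R x))) \<longlonglongrightarrow> e (- c * (x \<bullet> p)) * ft c f x"
        using tendsto_mult_left[OF tendsto_of_real[OF g], of "e (- c * (x \<bullet> p)) * ft c f x"]
        by (simp only: of_real_1 mult_1_right)
    qed
    show "AE x in lborel. norm (e (- c * (x \<bullet> p)) * ft c f x * of_real (gauss ((1 / m i) *\<^sub>R x))) \<le> norm (ft c f x)" for i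
      by (intro AE_I2) (auto simp: norm_mult gauss_def mult_left_le)
  qed (use ftf in auto)
  then have lim1: "A \<longlonglongrightarrow> ft (- c) (ft c f) p" unfolding ft_def[of "- c"] by (simp add: inner_commute)
  \<comment> \<open>The substitution w = p + u / (2 pi m) cancels the powers of m; the constant left
    over is (2 pi)^(-n/2) with n = DIM.\<close>
  have A2: "A i = (\<kappa> / (2 * pi) ^ DIM('w)) *\<^sub>R (LINT u|lborel. f (p + (1 / (2 * pi * m i)) *\<^sub>R u) * of_real (gauss u))" for i
  proof -
    define K where "K x w = e (c * (x \<bullet> (w - p))) * (f w * of_real (gauss ((1 / m i) *\<^sub>R x)))" for x w
    have [measurable]: "(\<lambda>(x, w). K x w) \<in> borel_measurable (lborel \<Otimes>\<^sub>M lborel)" unfolding K_def by measurable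
    have g1: "integrable lborel (\<lambda>x::'w. complex_of_real (gauss ((1 / m i) *\<^sub>R x)))"
    proof -
      have "complex_integrable lborel (\<lambda>x::'w. complex_of_real (gauss (0 + (1 / m i) *\<^sub>R x)))"
        by (subst integrable_affine_iff[of "\<lambda>x::'w. complex_of_real (gauss x)" "1 / m i" 0])
           (use m[of i] in \<open>auto intro: integrable_of_real integrable_gauss\<close>)
      then show ?thesis by simp
    qed
    have intK: "integrable (lborel \<Otimes>\<^sub>M lborel) (\<lambda>(x, w). K x w)"
      by (rule Bochner_Integration.integrable_bound[OF integrable_times_pair[OF g1 f]])
         (auto simp: K_def norm_mult)
    have "A i = (LINT x|lborel. LINT w|lborel. K x w)"
    proof -
      have "e (- c * (x \<bullet> p)) * ft c f x * of_real (gauss ((1 / m i) *\<^sub>R x)) = (LINT w|lborel. K x w)" for x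
      proof -
        have e: "e (c * (x \<bullet> (w - p))) = e (- c * (x \<bullet> p)) * e (c * (w \<bullet> x))" for w
          by (simp add: e_add[symmetric] inner_diff_right right_diff_distrib inner_commute)
        have "e (- c * (x \<bullet> p)) * ft c f x * of_real (gauss ((1 / m i) *\<^sub>R x)) =
          (LINT w|lborel. (e (- c * (x \<bullet> p)) * of_real (gauss ((1 / m i) *\<^sub>R x))) * (e (c * (w \<bullet> x)) * f w))"
          unfolding ft_def by simp
        also have "\<dots> = (LINT w|lborel. K x w)"
          unfolding K_def e
          by (intro Bochner_Integration.integral_cong refl) (simp only: mult_ac)
        finally show ?thesis .
      qed
      then show ?thesis unfolding A_def by simp
    qed
    also have "\<dots> = (LINT w|lborel. LINT x|lborel. K x w)"
      by (rule lborel_pair.Fubini_integral[symmetric]) (use intK in simp)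
    also have "\<dots> = (LINT w|lborel. f w * of_real (m i ^ DIM('w) * \<kappa> * gauss ((2 * pi * m i) *\<^sub>R (w - p))))"
    proof (intro Bochner_Integration.integral_cong refl)
      fix w
      have "(LINT x|lborel. K x w) = f w * (LINT x|lborel. e (c * (x \<bullet> (w - p))) * of_real (gauss ((1 / m i) *\<^sub>R x)))"
        unfolding K_def by (simp add: mult.left_commute)
      also have "(LINT x|lborel. e (c * (x \<bullet> (w - p))) * of_real (gauss ((1 / m i) *\<^sub>R x)))
         = m i ^ DIM('w) *\<^sub>R (LINT x|lborel. e (c * ((m i *\<^sub>R x) \<bullet> (w - p))) * of_real (gauss (x::'w)))"
        using m[of i] by (subst integral_affine[where c="m i" and t=0]) auto
      also have "(LINT x|lborel. e (c * ((m i *\<^sub>R x) \<bullet> (w - p))) * of_real (gauss x)) =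
          (LINT x|lborel. iexp (x \<bullet> ((2 * pi * c * m i) *\<^sub>R (w - p))) * of_real (gauss x))"
        unfolding e_eq_iexp by (simp add: mult_ac)
      also have "\<dots> = of_real (\<kappa> * gauss ((2 * pi * c * m i) *\<^sub>R (w - p)))"
        unfolding integral_gauss_exp \<kappa>_def ..
      \<comment> \<open>The Gaussian sees only the norm of its argument, so the sign
        \<open>c\<close> drops out.\<close>
      also have "gauss ((2 * pi * c * m i) *\<^sub>R (w - p)) = gauss ((2 * pi * m i) *\<^sub>R (w - p))"
        unfolding gauss_def using c by (simp add: power_mult_distrib)
      finally show "(LINT x|lborel. K x w) = f w * of_real (m i ^ DIM('w) * \<kappa> * gauss ((2 * pi * m i) *\<^sub>R (w - p)))"
        by (simp add: scaleR_conv_of_real)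
    qed
    also have "\<dots> = (1 / (2 * pi * m i)) ^ DIM('w) *\<^sub>R
        (LINT u|lborel. f (p + (1 / (2 * pi * m i)) *\<^sub>R u) * of_real (m i ^ DIM('w) * \<kappa> * gauss u))"
      using m[of i] by (subst integral_affine[where c="1 / (2 * pi * m i)" and t=p]) auto
    also have "\<dots> = (1 / (2 * pi * m i)) ^ DIM('w) *\<^sub>R
        (of_real (m i ^ DIM('w) * \<kappa>) * (LINT u|lborel. f (p + (1 / (2 * pi * m i)) *\<^sub>R u) * of_real (gauss u)))"
      by (subst integral_mult_right_zero[symmetric]) (simp add: mult_ac)
    also have "\<dots> = (\<kappa> / (2 * pi) ^ DIM('w)) *\<^sub>R (LINT u|lborel. f (p + (1 / (2 * pi * m i)) *\<^sub>R u) * of_real (gauss u))"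
      using m[of i] by (simp add: scaleR_conv_of_real power_divide power_mult_distrib)
    finally show ?thesis .
  qed
  have "(\<lambda>i. LINT u|lborel. f (p + (1 / (2 * pi * m i)) *\<^sub>R u) * of_real (gauss u)) \<longlonglongrightarrow> (LINT u|lborel. f p * of_real (gauss (u::'w)))"
  proof (rule integral_dominated_convergence[where w="\<lambda>u. B * gauss u"])
    show "AE u in lborel. (\<lambda>i. f (p + (1 / (2 * pi * m i)) *\<^sub>R u) * of_real (gauss u)) \<longlonglongrightarrow> f p * of_real (gauss u)"
    proof (rule AE_I2)
      fix u :: 'w
      have "(\<lambda>i. (1 / m i) / (2 * pi)) \<longlonglongrightarrow> 0 / (2 * pi)" by (intro tendsto_intros m_inf) auto
      then have "(\<lambda>i. p + ((1 / m i) / (2 * pi)) *\<^sub>R u) \<longlonglongrightarrow> p + 0 *\<^sub>R u" by (intro tendsto_intros) auto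
      then have *: "(\<lambda>i. p + (1 / (2 * pi * m i)) *\<^sub>R u) \<longlonglongrightarrow> p"
        by (simp only: divide_divide_eq_left mult.commute[of "m _"] scaleR_zero_left add_0_right)
      have "isCont f p" using cont by (simp add: continuous_on_eq_continuous_at)
      then have "(\<lambda>i. f (p + (1 / (2 * pi * m i)) *\<^sub>R u)) \<longlonglongrightarrow> f p" using * by (rule isCont_tendsto_compose)
      then show "(\<lambda>i. f (p + (1 / (2 * pi * m i)) *\<^sub>R u) * of_real (gauss u)) \<longlonglongrightarrow> f p * of_real (gauss u)"
        by (intro tendsto_intros)
    qed
    show "AE u in lborel. norm (f (p + (1 / (2 * pi * m i)) *\<^sub>R u) * of_real (gauss u)) \<le> B * gauss u" for i
      by (intro AE_I2) (auto simp: norm_mult gauss_def intro: bnd)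
    show "integrable lborel (\<lambda>u::'w. B * gauss u)" by (intro integrable_mult_right integrable_gauss)
  qed auto
  moreover have "(LINT u|lborel. f p * of_real (gauss (u::'w))) = f p * of_real \<kappa>"
    using integral_gauss[where 'a='w] by (simp only: integral_mult_right_zero integral_complex_of_real \<kappa>_def)
  ultimately have "(\<lambda>i. LINT u|lborel. f (p + (1 / (2 * pi * m i)) *\<^sub>R u) * of_real (gauss u)) \<longlonglongrightarrow> f p * of_real \<kappa>"
    by (simp only:)
  from tendsto_scaleR[OF tendsto_const[of "\<kappa> / (2 * pi) ^ DIM('w)"] this]
  have lim2: "A \<longlonglongrightarrow> (\<kappa> / (2 * pi) ^ DIM('w)) *\<^sub>R (f p * of_real \<kappa>)"
    unfolding A2[symmetric] .
  \<comment> \<open>The Gaussian mass \<kappa> occurs twice, from the transform of the cutoff and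
    from the limiting average; together they cancel the Jacobian (2 pi)^n, so no normalising
    constant remains.\<close>
  have "\<kappa> * \<kappa> = (2 * pi) ^ DIM('w)" unfolding \<kappa>_def power_mult_distrib[symmetric] by simp
  then have "\<kappa> / (2 * pi) ^ DIM('w) * \<kappa> = 1" by simp
  then have "complex_of_real (\<kappa> / (2 * pi) ^ DIM('w)) * complex_of_real \<kappa> = 1"
    by (simp only: of_real_mult[symmetric] of_real_1)
  then have "(\<kappa> / (2 * pi) ^ DIM('w)) *\<^sub>R (f p * of_real \<kappa>) = f p"
    unfolding scaleR_conv_of_real by (subst mult.left_commute) (simp only: mult_1_right)
  with lim1 lim2 show ?thesis using LIMSEQ_unique by fastforce
qed

lemma pft_eq_ft: "pft c H (x, t) = ft c (\<lambda>w. H (w, t)) x"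
  unfolding pft_def ft_def by simp

lemma schwartz_slice_integrable:
  fixes H :: "'w::euclidean_space \<times> 't::euclidean_space \<Rightarrow> complex"
  assumes "schwartz H"
  shows "integrable lborel (\<lambda>w. H (w, t))"
  using pft_integrable[OF assms, of 0] by simp

lemma pft_inversion:
  fixes H :: "'w::euclidean_space \<times> 't::euclidean_space \<Rightarrow> complex"
  assumes "c\<^sup>2 = 1" and H: "schwartz H"
  shows "pft (- c) (pft c H) = H"
proof
  fix z :: "'w \<times> 't"
  obtain p t where z: "z = (p, t)" by (cases z)
  have "c \<noteq> 0" using assms(1) by auto
  obtain B where B: "\<And>x. (1 + norm x) ^ 0 * norm (H x) \<le> B"
    by (rule schwartz_bound[OF H, of 0]) blast
  have "ft (- c) (ft c (\<lambda>w. H (w, t))) p = H (p, t)"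
  proof (rule fourier_inversion[OF assms(1)])
    show "continuous_on UNIV (\<lambda>w. H (w, t))"
      by (intro continuous_on_compose2[OF schwartz_continuous_on[OF H, of UNIV]]) (auto intro: continuous_intros)
    show "integrable lborel (\<lambda>w. H (w, t))" by (rule schwartz_slice_integrable[OF H])
    show "norm (H (x, t)) \<le> B" for x using B by simp
    show "integrable lborel (ft c (\<lambda>w. H (w, t)))"
      using schwartz_slice_integrable[OF schwartz_pft[OF \<open>c \<noteq> 0\<close> H], of t] by (simp add: pft_eq_ft)
  qed
  then show "pft (- c) (pft c H) z = H z" unfolding z pft_eq_ft by simp
qed

type_synonym 'n W = "(real ^ 'n) \<times> (real ^ 'n)"

text \<open>The Fourier variables are collected in the first component, the parameters in the second.\<close>

definition sort1 :: "'n::finite G \<Rightarrow> 'n::finite W \<times> real" where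
  "sort1 = (\<lambda>(x, y, r). ((x, y), r))"

definition unsort1 :: "'n W \<times> real \<Rightarrow> 'n::finite G" where
  "unsort1 = (\<lambda>((x, y), r). (x, y, r))"

definition sort2 :: "'n::finite G \<times> 'n G \<Rightarrow>
    ('n W \<times> 'n W) \<times> (real \<times> real)" where
  "sort2 = (\<lambda>((x, y, r), (x', y', r')). (((x, y), (x', y')), (r, r')))"

definition unsort2 :: "('n W \<times> 'n W) \<times> (real \<times> real)
    \<Rightarrow> 'n::finite G \<times> 'n G" where
  "unsort2 = (\<lambda>(((x, y), (x', y')), (r, r')). ((x, y, r), (x', y', r')))"

lemma sort_apply [simp]:
  "sort1 (x, y, r) = ((x, y), r)" "unsort1 ((x, y), r) = (x, y, r)"
  "sort2 ((x, y, r), (x', y', r')) = (((x, y), (x', y')), (r, r'))"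
  "unsort2 (((x, y), (x', y')), (r, r')) = ((x, y, r), (x', y', r'))"
  unfolding sort1_def unsort1_def sort2_def unsort2_def by auto

lemma sort_inverse [simp]:
  "sort1 (unsort1 v) = v" "unsort1 (sort1 z) = z" "sort2 (unsort2 w) = w" "unsort2 (sort2 u) = u"
  unfolding sort1_def unsort1_def sort2_def unsort2_def by (auto split: prod.splits)

lemma norm_sort [simp]:
  "norm (sort1 z) = norm z" "norm (unsort1 v) = norm v" "norm (sort2 u) = norm u" "norm (unsort2 w) = norm w"
  unfolding sort1_def unsort1_def sort2_def unsort2_def
  by (auto simp: norm_Pair add_ac split: prod.splits)

lemma bounded_linear_sort:
  "bounded_linear (sort1 :: 'n::finite G \<Rightarrow> _)" "bounded_linear (unsort1 :: _ \<Rightarrow> 'n G)"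
  "bounded_linear (sort2 :: 'n G \<times> 'n G \<Rightarrow> _)" "bounded_linear (unsort2 :: _ \<Rightarrow> 'n G \<times> 'n G)"
  unfolding linear_conv_bounded_linear[symmetric] sort1_def unsort1_def sort2_def unsort2_def
  by (auto intro!: linearI)

lemma schwartz_isometry:
  assumes "schwartz H" "bounded_linear T" "\<And>z. norm (T z) = norm z"
  shows "schwartz (\<lambda>z. H (T z))"
  by (rule schwartz_linear[OF assms(1,2), of 1]) (simp_all add: assms(3))

lemma inv_fourier_pft: "inv_fourier \<phi> z = pft 1 (\<lambda>v. \<phi> (unsort1 v)) (sort1 z)"
  by (cases z) (simp add: inv_fourier_def pft_def case_prod_unfold unsort1_def inner_prod_def)

lemma inv_fourier2_pft: "inv_fourier2 F z = pft 1 (\<lambda>v. F (unsort2 v)) (sort2 z)"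
  by (cases z) (auto simp: inv_fourier2_def pft_def case_prod_unfold unsort2_def inner_prod_def add.assoc)

definition fourier2 :: "('n::finite G \<times> 'n G \<Rightarrow> complex) \<Rightarrow> 'n G \<times> 'n G \<Rightarrow> complex" where
  "fourier2 K z = pft (- 1) (\<lambda>v. K (unsort2 v)) (sort2 z)"

lemma schwartz_inv_fourier: "schwartz \<phi> \<Longrightarrow> schwartz (inv_fourier \<phi>)"
  unfolding inv_fourier_pft[abs_def]
  by (intro schwartz_isometry[OF schwartz_pft, OF _ schwartz_isometry] bounded_linear_sort) simp_all

lemma schwartz_inv_fourier2: "schwartz F \<Longrightarrow> schwartz (inv_fourier2 F)"
  unfolding inv_fourier2_pft[abs_def]
  by (intro schwartz_isometry[OF schwartz_pft, OF _ schwartz_isometry] bounded_linear_sort) simp_all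

lemma schwartz_fourier2: "schwartz F \<Longrightarrow> schwartz (fourier2 F)"
  unfolding fourier2_def[abs_def]
  by (intro schwartz_isometry[OF schwartz_pft, OF _ schwartz_isometry] bounded_linear_sort) simp_all

lemma inv_fourier2_fourier2:
  assumes "schwartz K" shows "inv_fourier2 (fourier2 K) = K"
proof
  fix z
  have "schwartz (\<lambda>v. K (unsort2 v))" by (intro schwartz_isometry[OF assms] bounded_linear_sort) simp
  from pft_inversion[OF _ this, of "- 1"] show "inv_fourier2 (fourier2 K) z = K z"
    unfolding inv_fourier2_pft fourier2_def by simp
qed

lemma fourier2_inv_fourier2:
  assumes "schwartz F" shows "fourier2 (inv_fourier2 F) = F"
proof
  fix z
  have "schwartz (\<lambda>v. F (unsort2 v))" by (intro schwartz_isometry[OF assms] bounded_linear_sort) simp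
  from pft_inversion[OF _ this, of "1"] show "fourier2 (inv_fourier2 F) z = F z"
    unfolding inv_fourier2_pft fourier2_def by simp
qed

lemma inv_fourier_support:
  assumes "\<And>p q. \<phi> (p, q, r) = 0" shows "inv_fourier \<phi> (x, y, r) = 0"
  unfolding inv_fourier_def using assms by (simp add: case_prod_unfold)

lemma fourier2_support:
  assumes "\<And>p q p' q'. K ((p, q, r), (p', q', r')) = 0"
  shows "fourier2 K ((x, y, r), (x', y', r')) = 0"
  unfolding fourier2_def pft_def using assms by (simp add: case_prod_unfold unsort2_def)

subsection \<open>The kernels of the two products\<close>

text \<open>The points at which f and g are evaluated in the kernels: displacement c = A' - s A at
  level r', and a = s A at level r + r'. Separating this map from the scalar factors brings the
  kernels into the form required by \<open>schwartz_pullback\<close>.\<close>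

definition twist :: "real \<Rightarrow> 'n::finite G \<times> 'n G \<Rightarrow> 'n G \<times> 'n G" where
  "twist lam = (\<lambda>((A, B, r), (A', B', r')).
     ((A' - exp (- lam * r') *\<^sub>R A, B' - exp (- lam * r') *\<^sub>R B, r'),
      (exp (- lam * r') *\<^sub>R A, exp (- lam * r') *\<^sub>R B, r + r')))"

text \<open>One family for both products. The coefficients (1, -1, 0, 1) give the phase (A' - s A) .
  s B of (1 \<otimes> \<phi>)(\<Delta>\<psi>), and (0, 1, 1, -1) give s A . (B' - s B) of
  (\<Delta>\<phi>)(1 \<otimes> \<psi>). The slot f belongs to the plain tensor factor, the slot g to
  the comultiplied one.\<close>

definition tker :: "real \<Rightarrow> real \<Rightarrow> real \<Rightarrow> real \<Rightarrow> real \<Rightarrow> ('n::finite G \<Rightarrow> complex) \<Rightarrow> ('n G \<Rightarrow> complex)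
    \<Rightarrow> 'n G \<times> 'n G \<Rightarrow> complex" where
  "tker lam u0 u1 v0 v1 f g = (\<lambda>((A, B, r), (A', B', r')). let s = exp (- lam * r') in
     of_real (s ^ (2 * CARD('n)))
     * ebar (eta lam r' * ((u0 *\<^sub>R A' + u1 *\<^sub>R (s *\<^sub>R A)) \<bullet> (v0 *\<^sub>R B' + v1 *\<^sub>R (s *\<^sub>R B))))
     * (f (A' - s *\<^sub>R A, B' - s *\<^sub>R B, r') * g (s *\<^sub>R A, s *\<^sub>R B, r + r')))"

lemma multipliers_diff: "m \<in> multipliers S \<Longrightarrow> n \<in> multipliers S \<Longrightarrow> (\<lambda>z. m z - n z) \<in> multipliers S"
  using multipliers.add[OF _ multipliers.mul[OF multipliers.const[of "- 1"]], of m S n] by simp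

lemma multipliers_of_real_inner:
  fixes u v :: "'a::euclidean_space \<Rightarrow> 'b::euclidean_space"
  assumes "\<And>b. b \<in> Basis \<Longrightarrow> (\<lambda>z. of_real (u z \<bullet> b)) \<in> multipliers S"
    "\<And>b. b \<in> Basis \<Longrightarrow> (\<lambda>z. of_real (v z \<bullet> b)) \<in> multipliers S"
  shows "(\<lambda>z. of_real (u z \<bullet> v z)) \<in> multipliers S"
proof -
  have "(\<lambda>z. \<Sum>b\<in>Basis. of_real (u z \<bullet> b) * of_real (v z \<bullet> b)) \<in> multipliers S"
    using assms by (intro multipliers_sum multipliers.mul) auto
  also have "(\<lambda>z. \<Sum>b\<in>Basis. of_real (u z \<bullet> b) * of_real (v z \<bullet> b)) = (\<lambda>z. of_real (u z \<bullet> v z))"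
    by (subst euclidean_inner) simp
  finally show ?thesis .
qed

lemma schwartz_tker:
  fixes f g :: "'n::finite G \<Rightarrow> complex" and lam :: real
  assumes f: "schwartz f" and g: "schwartz g"
    and fR: "\<And>p q r. \<bar>r\<bar> > R \<Longrightarrow> f (p, q, r) = 0" and gR: "\<And>p q r. \<bar>r\<bar> > R \<Longrightarrow> g (p, q, r) = 0"
  shows "schwartz (tker lam u0 u1 v0 v1 f g)"
proof -
  define s where "s z = exp (- lam * snd (snd (snd z)))" for z :: "'n G \<times> 'n G"
  define u :: "'n G \<times> 'n G \<Rightarrow> real ^ 'n" where "u = (\<lambda>((A, B, r), (A', B', r')). u0 *\<^sub>R A' + u1 *\<^sub>R (exp (- lam * r') *\<^sub>R A))"
  define v :: "'n G \<times> 'n G \<Rightarrow> real ^ 'n" where "v = (\<lambda>((A, B, r), (A', B', r')). v0 *\<^sub>R B' + v1 *\<^sub>R (exp (- lam * r') *\<^sub>R B))"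
  \<comment> \<open>Both r-arguments, r' and r + r', lie in [-R, R] on \<open>S\<close>; outside it
    one of the factors f and g vanishes.\<close>
  define S where "S = {z :: 'n G \<times> 'n G. \<bar>snd (snd (snd z))\<bar> \<le> R \<and> \<bar>snd (snd (fst z)) + snd (snd (snd z))\<bar> \<le> R}"
  let ?r' = "\<lambda>z :: 'n G \<times> 'n G. snd (snd (snd z))"
  have lin: "(\<lambda>z. of_real (l z)) \<in> multipliers S" if "bounded_linear l" for l
    using that by (rule multipliers.lin)
  have bl: "bounded_linear ?r'" "bounded_linear (\<lambda>z :: 'n G \<times> 'n G. snd (snd (fst z)))"
    "bounded_linear (\<lambda>z :: 'n G \<times> 'n G. fst (fst z))" "bounded_linear (\<lambda>z :: 'n G \<times> 'n G. fst (snd (fst z)))"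
    "bounded_linear (\<lambda>z :: 'n G \<times> 'n G. fst (snd z))" "bounded_linear (\<lambda>z :: 'n G \<times> 'n G. fst (snd (snd z)))"
    by (intro bounded_linear_compose[OF bounded_linear_fst] bounded_linear_compose[OF bounded_linear_snd]
         bounded_linear_fst bounded_linear_snd)+
  note mi = lin[OF bounded_linear_inner_left_comp[OF bl(3)]] lin[OF bounded_linear_inner_left_comp[OF bl(4)]]
     lin[OF bounded_linear_inner_left_comp[OF bl(5)]] lin[OF bounded_linear_inner_left_comp[OF bl(6)]]
  \<comment> \<open>On the whole space exp (c r') is not polynomially bounded; on \<open>S\<close>
    its exponent is at most |c| R.\<close>
  have rexp: "(\<lambda>z. of_real (exp (c * ?r' z))) \<in> multipliers S" for c
  proof -
    have "(\<lambda>z. exp (of_real c * of_real (?r' z))) \<in> multipliers S"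
    proof (rule multipliers.exp[where B="\<bar>c\<bar> * R"])
      show "Re (of_real c * of_real (?r' z)) \<le> \<bar>c\<bar> * R" if "z \<in> S" for z
      proof -
        have "c * ?r' z \<le> \<bar>c\<bar> * \<bar>?r' z\<bar>" by (metis abs_ge_self abs_mult)
        also have "\<dots> \<le> \<bar>c\<bar> * R" using that by (intro mult_left_mono) (auto simp: S_def)
        finally show ?thesis by simp
      qed
    qed (intro multipliers.intros bl)
    then show ?thesis unfolding of_real_mult[symmetric] exp_of_real .
  qed
  have sm: "(\<lambda>z. of_real (s z)) \<in> multipliers S" unfolding s_def by (rule rexp)
  have um: "(\<lambda>z. of_real (u z \<bullet> b)) \<in> multipliers S" for b
  proof -
    have "(\<lambda>z. of_real u0 * of_real (fst (snd z) \<bullet> b) + of_real u1 * (of_real (s z) * of_real (fst (fst z) \<bullet> b))) \<in> multipliers S"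
      by (intro multipliers.add multipliers.mul multipliers.const mi sm)
    then show ?thesis unfolding u_def s_def by (simp add: case_prod_beta inner_add_left mult.assoc)
  qed
  have vm: "(\<lambda>z. of_real (v z \<bullet> b)) \<in> multipliers S" for b
  proof -
    have "(\<lambda>z. of_real v0 * of_real (fst (snd (snd z)) \<bullet> b) + of_real v1 * (of_real (s z) * of_real (fst (snd (fst z)) \<bullet> b))) \<in> multipliers S"
      by (intro multipliers.add multipliers.mul multipliers.const mi sm)
    then show ?thesis unfolding v_def s_def by (simp add: case_prod_beta inner_add_left mult.assoc)
  qed
  have etam: "(\<lambda>z. of_real (eta lam (?r' z))) \<in> multipliers S"
  proof -
    have "(\<lambda>z. of_real (1 / (2 * lam)) * (of_real (exp (2 * lam * ?r' z)) - 1)) \<in> multipliers S"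
      by (intro multipliers_diff multipliers.mul multipliers.const rexp)
    moreover have "complex_of_real (eta lam t) = of_real (1 / (2 * lam)) * (of_real (exp (2 * lam * t)) - 1)" for t
      unfolding eta_def by simp
    ultimately show ?thesis by (simp only:)
  qed
  have phase: "(\<lambda>z. ebar (eta lam (?r' z) * (u z \<bullet> v z))) \<in> multipliers S"
  proof -
    \<comment> \<open>The exponent is purely imaginary, hence the bound 0 on its real part.\<close>
    have "(\<lambda>z. exp ((- (2 * of_real pi * \<i>)) * (of_real (eta lam (?r' z)) * of_real (u z \<bullet> v z)))) \<in> multipliers S"
      by (rule multipliers.exp[where B=0],
          intro multipliers.mul multipliers.const etam multipliers_of_real_inner[OF um vm], simp)
    then show ?thesis unfolding ebar_def by (simp add: mult.assoc)
  qed
  have "schwartz (\<lambda>z. (of_real (s z ^ (2 * CARD('n))) * ebar (eta lam (?r' z) * (u z \<bullet> v z)))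
    * (case twist lam z of (z, w) \<Rightarrow> f z * g w))"
  proof (rule schwartz_pullback[where H="\<lambda>(z, w). f z * g w" and T="twist lam" and S=S
        and m="\<lambda>z. of_real (s z ^ (2 * CARD('n))) * ebar (eta lam (?r' z) * (u z \<bullet> v z))"
        and j=1 and C="2 * exp (\<bar>lam\<bar> * R) + 7"])
    show "schwartz (\<lambda>(z, w). f z * g w)" by (rule schwartz_tensor[OF f g])
    show "(\<lambda>z. of_real (s z ^ (2 * CARD('n))) * ebar (eta lam (?r' z) * (u z \<bullet> v z))) \<in> multipliers S"
      unfolding of_real_power by (intro multipliers.mul multipliers_power sm phase)
    show "(\<lambda>z. of_real (twist lam z \<bullet> w)) \<in> multipliers S" for w :: "'n G \<times> 'n G"
    proof -
      obtain w1 w2 w3 w4 w5 w6 where w: "w = ((w1, w2, w3), (w4, w5, w6))"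
        by (cases w) auto
      have "(\<lambda>z. ((of_real (fst (snd z) \<bullet> w1) - of_real (s z) * of_real (fst (fst z) \<bullet> w1)) +
          ((of_real (fst (snd (snd z)) \<bullet> w2) - of_real (s z) * of_real (fst (snd (fst z)) \<bullet> w2)) +
          of_real (?r' z \<bullet> w3))) +
         (of_real (s z) * of_real (fst (fst z) \<bullet> w4) + (of_real (s z) * of_real (fst (snd (fst z)) \<bullet> w5) +
          (of_real (snd (snd (fst z)) \<bullet> w6) + of_real (?r' z \<bullet> w6))))) \<in> multipliers S"
        by (intro multipliers.add multipliers_diff multipliers.mul mi sm lin[OF bounded_linear_inner_left_comp[OF bl(1)]]
             lin[OF bounded_linear_inner_left_comp[OF bl(2)]])
      then show ?thesis unfolding twist_def w s_def
        by (simp add: case_prod_beta inner_diff_left distrib_right)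
    qed
    show "iter_deriv vs (\<lambda>(z, w). f z * g w) (twist lam z) = 0" if "z \<notin> S" for vs z
    proof (rule iter_deriv_eq_0_open)
      \<comment> \<open>Strict inequalities make this set open, so the derivatives of the tensor
        product vanish on it as well.\<close>
      let ?V = "{y :: 'n G \<times> 'n G. R < \<bar>snd (snd (fst y))\<bar> \<or> R < \<bar>snd (snd (snd y))\<bar>}"
      show "open ?V" by (intro open_Collect_disj open_Collect_less continuous_intros)
      show "(case y of (z, w) \<Rightarrow> f z * g w) = 0" if "y \<in> ?V" for y
        using that fR gR by (auto split: prod.splits)
      show "twist lam z \<in> ?V" using that unfolding S_def twist_def by (auto split: prod.splits)
    qed
    \<comment> \<open>The twist is solved for z: dividing s A and s B by s costs exp (|lam| R) each,
      while A', B' and r cost 2 each and r' costs 1. The sum is the constant 2 exp (|lam| R) +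
      7.\<close>
    show "norm z \<le> (2 * exp (\<bar>lam\<bar> * R) + 7) * (1 + norm (twist lam z)) ^ 1" if "z \<in> S" for z
    proof -
      obtain A B r A' B' r' where z: "z = ((A, B, r), (A', B', r'))"
        by (cases z) auto
      let ?s = "exp (- lam * r')"
      let ?N = "norm (twist lam z)"
      have tw: "twist lam z = ((A' - ?s *\<^sub>R A, B' - ?s *\<^sub>R B, r'), (?s *\<^sub>R A, ?s *\<^sub>R B, r + r'))"
        unfolding twist_def z by simp
      have c: "norm a1 \<le> norm ((a1, a2, a3), (a4, a5, a6))" "norm a2 \<le> norm ((a1, a2, a3), (a4, a5, a6))"
          "norm a3 \<le> norm ((a1, a2, a3), (a4, a5, a6))" "norm a4 \<le> norm ((a1, a2, a3), (a4, a5, a6))"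
          "norm a5 \<le> norm ((a1, a2, a3), (a4, a5, a6))" "norm a6 \<le> norm ((a1, a2, a3), (a4, a5, a6))"
        for a1 a2 a4 a5 :: "real ^ 'n" and a3 a6 :: real
        by (rule order_trans[OF norm_fst_le norm_fst_le] order_trans[OF order_trans[OF norm_fst_le norm_snd_le] norm_fst_le]
            order_trans[OF order_trans[OF norm_snd_le norm_snd_le] norm_fst_le] order_trans[OF norm_fst_le norm_snd_le]
            order_trans[OF order_trans[OF norm_fst_le norm_snd_le] norm_snd_le]
            order_trans[OF order_trans[OF norm_snd_le norm_snd_le] norm_snd_le])+
      note cc = c[where ?a1.0="A' - ?s *\<^sub>R A" and ?a2.0="B' - ?s *\<^sub>R B" and ?a3.0=r'
        and ?a4.0="?s *\<^sub>R A" and ?a5.0="?s *\<^sub>R B" and ?a6.0="r + r'", folded tw]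
      have "- lam * r' \<ge> - (\<bar>lam\<bar> * R)"
      proof -
        have "lam * r' \<le> \<bar>lam\<bar> * \<bar>r'\<bar>" by (metis abs_ge_self abs_mult)
        also have "\<dots> \<le> \<bar>lam\<bar> * R" using that by (intro mult_left_mono) (auto simp: S_def z)
        finally show ?thesis by simp
      qed
      then have s: "1 \<le> exp (\<bar>lam\<bar> * R) * ?s" by (simp add: exp_add[symmetric])
      have A: "norm A \<le> exp (\<bar>lam\<bar> * R) * ?N" "norm B \<le> exp (\<bar>lam\<bar> * R) * ?N"
      proof -
        have "norm X \<le> exp (\<bar>lam\<bar> * R) * norm (?s *\<^sub>R X)" for X :: "real ^ 'n"
          using mult_right_mono[OF s, of "norm X"] by (simp add: mult_ac)
        then show "norm A \<le> exp (\<bar>lam\<bar> * R) * ?N" "norm B \<le> exp (\<bar>lam\<bar> * R) * ?N"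
          using cc(4,5) by (meson exp_ge_zero mult_left_mono order_trans)+
      qed
      have A': "norm A' \<le> 2 * ?N" using norm_triangle_ineq[of "A' - ?s *\<^sub>R A" "?s *\<^sub>R A"] cc(1,4) by simp
      have B': "norm B' \<le> 2 * ?N" using norm_triangle_ineq[of "B' - ?s *\<^sub>R B" "?s *\<^sub>R B"] cc(2,5) by simp
      have r: "norm r \<le> 2 * ?N" "norm r' \<le> ?N" using cc(3,6) by auto
      have "norm z \<le> (norm A + (norm B + norm r)) + (norm A' + (norm B' + norm r'))"
        unfolding z by (intro order_trans[OF norm_Pair_le] add_mono order_refl)
      also have "\<dots> \<le> (exp (\<bar>lam\<bar> * R) * ?N + (exp (\<bar>lam\<bar> * R) * ?N + 2 * ?N)) + (2 * ?N + (2 * ?N + ?N))"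
        by (intro add_mono A A' B' r)
      also have "\<dots> \<le> (2 * exp (\<bar>lam\<bar> * R) + 7) * ?N" by (simp add: algebra_simps)
      also have "\<dots> \<le> (2 * exp (\<bar>lam\<bar> * R) + 7) * (1 + ?N) ^ 1" by (intro mult_left_mono) auto
      finally show ?thesis .
    qed
  qed
  also have "(\<lambda>z. (of_real (s z ^ (2 * CARD('n))) * ebar (eta lam (?r' z) * (u z \<bullet> v z)))
    * (case twist lam z of (z, w) \<Rightarrow> f z * g w)) = tker lam u0 u1 v0 v1 f g"
    by (auto simp: fun_eq_iff tker_def twist_def Let_def s_def u_def v_def)
  finally show ?thesis .
qed

subsection \<open>Uniqueness of the symbol\<close>

text \<open>The phase of \<open>LL\<close> in sorted coordinates: v is the evaluation point, c the
  displacement and t = (r, r').\<close>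

definition phase2 :: "real \<Rightarrow> 'n::finite W \<times> 'n W \<Rightarrow> 'n W \<times> 'n W \<Rightarrow> real \<times> real \<Rightarrow> complex" where
  "phase2 lam v c t = ebar (eta lam (fst t) * (fst (fst c) \<bullet> (snd (fst v) - snd (fst c)))
     + eta lam (snd t) * (fst (snd c) \<bullet> (snd (snd v) - snd (snd c))))"

lemma LL_unsort2:
  "LL lam F \<xi> (unsort2 (v, t)) = (LINT c|lborel.
     inv_fourier2 F (unsort2 (c, t)) * phase2 lam v c t * \<xi> (unsort2 (v - c, t)))"
  by (cases v; cases t) (auto simp: LL_def unsort2_def phase2_def case_prod_unfold)

text \<open>If G p were nonzero, continuity would keep G within half of its size at p on a small
  ball, and the integral there could not vanish. The hypothesis starts at some \<open>M\<close>
  because a test function reaches a given (r, r') only from some index on.\<close>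

lemma zero_if_averages_zero:
  fixes G :: "'a::euclidean_space \<Rightarrow> complex"
  assumes cont: "continuous_on UNIV G"
    and zero: "\<And>m. m \<ge> M \<Longrightarrow> (LINT c|lborel. indicator (cball p (1 / real (Suc m))) c *\<^sub>R G c) = 0"
  shows "G p = 0"
proof (rule ccontr)
  assume nz: "G p \<noteq> 0"
  define \<epsilon> where "\<epsilon> = norm (G p)"
  have \<epsilon>: "0 < \<epsilon>" using nz by (simp add: \<epsilon>_def)
  have "isCont G p" using cont by (simp add: continuous_on_eq_continuous_at)
  then obtain \<delta> where \<delta>: "0 < \<delta>" "\<And>c. dist c p < \<delta> \<Longrightarrow> dist (G c) (G p) < \<epsilon> / 2"
    unfolding continuous_at_eps_delta using \<epsilon> by (metis half_gt_zero)
  obtain k where k: "1 / real (Suc k) < \<delta>" using \<delta>(1) by (metis nat_approx_posE)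
  define m where "m = max k M"
  have "1 / real (Suc m) \<le> 1 / real (Suc k)" by (simp add: m_def field_simps)
  then have m: "1 / real (Suc m) < \<delta>" using k by simp
  define C where "C = cball p (1 / real (Suc m))"
  have C: "compact C" "C \<in> sets lborel" by (auto simp: C_def)
  have fin: "emeasure lborel C < \<infinity>" by (rule emeasure_compact_finite[OF C(1)])
  have "0 < emeasure lborel C"
  proof -
    have "0 < emeasure lborel (ball p (1 / real (Suc m)))"
      by (rule ccontr) (use open_not_negligible[of "ball p (1 / real (Suc m))"] in
         \<open>auto simp: negligible_iff_null_sets null_sets_def\<close>)
    also have "\<dots> \<le> emeasure lborel C" unfolding C_def by (intro emeasure_mono) auto
    finally show ?thesis .
  qed
  then have pos: "0 < measure lborel C" using fin by (simp add: measure_def enn2real_positive_iff)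
  have i1: "integrable lborel (\<lambda>c. indicator C c *\<^sub>R G c)"
    by (intro borel_integrable_compact C continuous_on_subset[OF cont]) auto
  have i2: "integrable lborel (\<lambda>c. indicator C c *\<^sub>R G p)" using C fin by (intro integrable_scaleR_left) auto
  have i3: "integrable lborel (\<lambda>c. indicator C c * (\<epsilon> / 2) :: real)"
    using C fin by (intro integrable_mult_left) auto
  have "measure lborel C * \<epsilon> = norm (LINT c|lborel. indicator C c *\<^sub>R G p)"
    using C fin by (simp add: \<epsilon>_def)
  also have "\<dots> = norm ((LINT c|lborel. indicator C c *\<^sub>R G c) - (LINT c|lborel. indicator C c *\<^sub>R G p))"
    using zero[of m] by (simp add: C_def m_def)
  also have "\<dots> = norm (LINT c|lborel. indicator C c *\<^sub>R G c - indicator C c *\<^sub>R G p)"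
    using i1 i2 by simp
  also have "\<dots> \<le> (LINT c|lborel. indicator C c * (\<epsilon> / 2))"
  proof (rule Bochner_Integration.integral_norm_bound_integral)
    show "norm (indicator C c *\<^sub>R G c - indicator C c *\<^sub>R G p) \<le> indicator C c * (\<epsilon> / 2)" for c
    proof (cases "c \<in> C")
      case True
      then have "dist c p < \<delta>" using m by (auto simp: C_def dist_commute)
      then show ?thesis using \<delta>(2)[of c] True by (simp add: dist_norm)
    qed simp
  qed (use i1 i2 i3 in auto)
  also have "\<dots> = measure lborel C * (\<epsilon> / 2)" using C fin by simp
  finally show False using pos \<epsilon> by simp
qed

lemma continuous_unsort2: "continuous_on S unsort2"
  by (rule linear_continuous_on[OF bounded_linear_sort(4)])

text \<open>The zero set is closed and of full measure, hence everything.\<close>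

lemma AE_zero_continuous:
  fixes D :: "'a::euclidean_space \<Rightarrow> complex"
  assumes "continuous_on UNIV D" "AE x in lborel. D x = 0"
  shows "D x = 0"
proof -
  have "closed {x. D x = 0}" by (intro closed_Collect_eq assms continuous_intros)
  moreover have "AE x in lebesgue. x \<in> {x. D x = 0}" using AE_completion[OF assms(2)] by simp
  ultimately show ?thesis using mem_closed_if_AE_lebesgue by blast
qed

lemma symbol_unique:
  assumes F1: "schwartz F1" and F2: "schwartz F2" and eq: "oper_eq (LL lam F1) (LL lam F2)"
  shows "F1 = (F2 :: 'n::finite G \<times> 'n G \<Rightarrow> complex)"
proof -
  define D where "D z = inv_fourier2 F1 z - inv_fourier2 F2 z" for z
  have c1: "continuous_on S (inv_fourier2 F1)" and c2: "continuous_on S (inv_fourier2 F2)" for S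
    by (intro schwartz_continuous_on schwartz_inv_fourier2 F1 F2)+
  \<comment> \<open>The ball shrinks in the four vector variables and grows in (r, r') to exhaust
    the plane. The family is countable and independent of the evaluation point, so one null set
    serves all m.\<close>
  define K where "K m = cball (0 :: 'n W \<times> 'n W) (1 / real (Suc m)) \<times> (cball (0 :: real \<times> real) (real m))" for m
  define \<xi> where "\<xi> m = (indicator (unsort2 ` K m) :: _ \<Rightarrow> complex)" for m
  have comp: "compact (unsort2 ` K m)" for m
    unfolding K_def by (intro compact_continuous_image continuous_unsort2 compact_Times compact_cball)
  have "\<xi> m \<in> L2" for m
  proof -
    have s: "unsort2 ` K m \<in> sets borel" using comp by (rule borel_compact)
    have n: "(norm (\<xi> m z))\<^sup>2 = indicator (unsort2 ` K m) z" for z unfolding \<xi>_def by (simp split: split_indicator)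
    have b: "\<xi> m \<in> borel_measurable borel" unfolding \<xi>_def using s by measurable
    then show ?thesis unfolding L2_def using emeasure_compact_finite[OF comp] s
      by (simp add: n integrable_indicator_iff)
  qed
  then have "AE z in lborel. LL lam F1 (\<xi> m) z = LL lam F2 (\<xi> m) z" for m
    using eq unfolding oper_eq_def by blast
  then have "AE z in lborel. \<forall>m. LL lam F1 (\<xi> m) z = LL lam F2 (\<xi> m) z"
    by (simp add: AE_all_countable)
  then have "AE z in lborel. D z = 0"
  proof (rule AE_mp, intro AE_I2 impI)
    fix z :: "'n G \<times> 'n G" assume z: "\<forall>m. LL lam F1 (\<xi> m) z = LL lam F2 (\<xi> m) z"
    obtain v t where vt: "z = unsort2 (v, t)" by (metis sort_inverse(4) surj_pair)
    obtain M where M: "norm t \<le> real M" using real_arch_simple by blast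
    have cp: "continuous_on UNIV (\<lambda>c. phase2 lam v c t)"
      unfolding phase2_def ebar_eq by (intro continuous_intros)
    have cu: "continuous_on UNIV (\<lambda>c. unsort2 (c, t) :: 'n G \<times> 'n G)"
      by (intro continuous_on_compose2[OF continuous_unsort2] continuous_intros) auto
    have cG1: "continuous_on UNIV (\<lambda>c. inv_fourier2 F1 (unsort2 (c, t)) * phase2 lam v c t)"
      by (intro continuous_on_mult cp continuous_on_compose2[OF c1 cu]) auto
    have cG2: "continuous_on UNIV (\<lambda>c. inv_fourier2 F2 (unsort2 (c, t)) * phase2 lam v c t)"
      by (intro continuous_on_mult cp continuous_on_compose2[OF c2 cu]) auto
    define G where "G c = inv_fourier2 F1 (unsort2 (c, t)) * phase2 lam v c t - inv_fourier2 F2 (unsort2 (c, t)) * phase2 lam v c t" for c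
    have "G v = 0"
    proof (rule zero_if_averages_zero[where M=M and G=G and p=v])
      show "continuous_on UNIV G" unfolding G_def by (intro continuous_on_diff cG1 cG2)
      fix m assume "m \<ge> M"
      let ?C = "cball v (1 / real (Suc m))"
      have ind: "\<xi> m (unsort2 (v - c, t)) = indicator ?C c" for c
      proof -
        have "unsort2 (v - c, t) \<in> unsort2 ` K m \<longleftrightarrow> (v - c, t) \<in> K m"
          by (metis image_iff sort_inverse(3))
        also have "\<dots> \<longleftrightarrow> c \<in> ?C"
          using M \<open>m \<ge> M\<close> unfolding K_def by (auto simp: dist_norm norm_minus_commute)
        finally show ?thesis unfolding \<xi>_def by (simp split: split_indicator)
      qed
      have I: "integrable lborel (\<lambda>c. indicator ?C c *\<^sub>R (inv_fourier2 F1 (unsort2 (c, t)) * phase2 lam v c t))"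
        "integrable lborel (\<lambda>c. indicator ?C c *\<^sub>R (inv_fourier2 F2 (unsort2 (c, t)) * phase2 lam v c t))"
        by (intro borel_integrable_compact compact_cball continuous_on_subset[OF cG1] continuous_on_subset[OF cG2] subset_UNIV)+
      have "LL lam F (\<xi> m) z = (LINT c|lborel. indicator ?C c *\<^sub>R (inv_fourier2 F (unsort2 (c, t)) * phase2 lam v c t))" for F
        unfolding vt LL_unsort2 ind
        by (intro Bochner_Integration.integral_cong refl) (simp split: split_indicator)
      then have "(LINT c|lborel. indicator ?C c *\<^sub>R (inv_fourier2 F1 (unsort2 (c, t)) * phase2 lam v c t))
         = (LINT c|lborel. indicator ?C c *\<^sub>R (inv_fourier2 F2 (unsort2 (c, t)) * phase2 lam v c t))"
        using z[rule_format, of m] by (simp only:)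
      then show "(LINT c|lborel. indicator ?C c *\<^sub>R G c) = 0"
        unfolding G_def scaleR_diff_right using I by simp
    qed
    \<comment> \<open>The averages are centred at the displacement c = v, where the phase is 1, so
      the vanishing value is the difference of the kernels itself.\<close>
    moreover have "phase2 lam v v t = 1" unfolding phase2_def ebar_eq by simp
    ultimately show "D z = 0" unfolding D_def vt G_def by simp
  qed
  then have "D z = 0" for z
    by (rule AE_zero_continuous[rotated]) (unfold D_def, intro continuous_on_diff c1 c2)
  then have "inv_fourier2 F1 = inv_fourier2 F2" unfolding D_def by auto
  then show ?thesis using fourier2_inv_fourier2 F1 F2 by metis
qed

subsection \<open>Integral operators on square-integrable functions\<close>

lemma AE_translate:
  fixes a :: "'v::euclidean_space"
  assumes "N \<in> null_sets lborel"
  shows "AE \<omega> in lborel. \<omega> - a \<notin> N"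
proof -
  have [measurable]: "N \<in> sets borel" using assms by auto
  have "AE \<omega> in distr lborel borel ((+) (- a)). \<omega> \<notin> N"
    unfolding lborel_distr_plus using AE_not_in[OF assms] .
  then show ?thesis by (subst (asm) AE_distr_iff) auto
qed

text \<open>For fixed c the translate of a null set is null, and Fubini's theorem exchanges the two
  quantifiers. Passing to a Borel null set \<open>N\<close> first gives the measurability that the
  exchange needs.\<close>

lemma AE_shift:
  fixes j :: "'c::euclidean_space \<Rightarrow> 'v::euclidean_space"
  assumes P: "AE \<omega> in lborel. P \<omega>" and j [measurable]: "j \<in> borel_measurable borel"
  shows "AE \<omega> in lborel. AE c in lborel. P (\<omega> - j c)"
proof -
  obtain N where N: "N \<in> null_sets lborel" "{\<omega>. \<not> P \<omega>} \<subseteq> N"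
    using P unfolding eventually_ae_filter by auto
  have [measurable]: "N \<in> sets borel" using N by auto
  have "AE c in lborel. AE \<omega> in lborel. \<omega> - j c \<notin> N" using AE_translate[OF N(1)] by simp
  moreover have "{x \<in> space (lborel \<Otimes>\<^sub>M lborel). snd x - j (fst x) \<notin> N} \<in> sets (lborel \<Otimes>\<^sub>M lborel)"
    by measurable
  ultimately have "AE \<omega> in lborel. AE c in lborel. \<omega> - j c \<notin> N"
    by (subst (asm) lborel_pair.AE_commute[where P="\<lambda>c \<omega>. \<omega> - j c \<notin> N"])
  then show ?thesis
  proof (rule eventually_mono)
    fix \<omega> assume "AE c in lborel. \<omega> - j c \<notin> N"
    then show "AE c in lborel. P (\<omega> - j c)"
      by (rule AE_mp, intro AE_I2 impI) (use N(2) in blast)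
  qed
qed

lemma nn_integral_translate:
  fixes f :: "'v::euclidean_space \<Rightarrow> ennreal"
  assumes [measurable]: "f \<in> borel_measurable borel"
  shows "(\<integral>\<^sup>+\<omega>. f (\<omega> - a) \<partial>lborel) = (\<integral>\<^sup>+\<omega>. f \<omega> \<partial>lborel)"
proof -
  have "(\<integral>\<^sup>+\<omega>. f \<omega> \<partial>lborel) = (\<integral>\<^sup>+\<omega>. f \<omega> \<partial>distr lborel borel ((+) (- a)))"
    by (simp add: lborel_distr_plus)
  then show ?thesis by (subst (asm) nn_integral_distr) (auto simp: add.commute)
qed

section \<open>Young-type bounds for averages of translates\<close>

lemma L2_borel [measurable_dest]: "\<xi> \<in> L2 \<Longrightarrow> \<xi> \<in> borel_measurable borel"
  unfolding L2_def by simp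

lemma L2_finite: "\<xi> \<in> L2 \<Longrightarrow> (\<integral>\<^sup>+z. ennreal ((norm (\<xi> z))\<^sup>2) \<partial>lborel) < \<infinity>"
  unfolding L2_def integrable_iff_bounded by simp

lemma L2I:
  "\<xi> \<in> borel_measurable borel \<Longrightarrow> (\<integral>\<^sup>+z. ennreal ((norm (\<xi> z))\<^sup>2) \<partial>lborel) < \<infinity> \<Longrightarrow> \<xi> \<in> L2"
  unfolding L2_def integrable_iff_bounded by simp

context
  fixes \<gamma> :: "'c::euclidean_space \<Rightarrow> real" and j :: "'c \<Rightarrow> 'v::euclidean_space" and \<xi> :: "'v \<Rightarrow> complex"
  assumes \<gamma>: "integrable lborel \<gamma>" "\<And>c. 0 \<le> \<gamma> c" and j [measurable]: "j \<in> borel_measurable borel"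
    and \<xi>: "\<xi> \<in> L2"
begin

text \<open>Tonelli and translation invariance factor the double integral into the mass of \<gamma>
  times the squared norm of \<xi>. The displacement \<open>j c\<close> may move only some of the
  coordinates.\<close>

lemma young_finite: "(\<integral>\<^sup>+\<omega>. (\<integral>\<^sup>+c. ennreal (\<gamma> c * (norm (\<xi> (\<omega> - j c)))\<^sup>2) \<partial>lborel) \<partial>lborel) < \<infinity>"
proof -
  have [measurable]: "\<gamma> \<in> borel_measurable borel" "\<xi> \<in> borel_measurable borel"
    using \<gamma>(1) borel_measurable_integrable L2_borel[OF \<xi>] by fastforce+
  have "(\<integral>\<^sup>+\<omega>. (\<integral>\<^sup>+c. ennreal (\<gamma> c * (norm (\<xi> (\<omega> - j c)))\<^sup>2) \<partial>lborel) \<partial>lborel)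
     = (\<integral>\<^sup>+c. (\<integral>\<^sup>+\<omega>. ennreal (\<gamma> c * (norm (\<xi> (\<omega> - j c)))\<^sup>2) \<partial>lborel) \<partial>lborel)"
    by (rule lborel_pair.Fubini') measurable
  also have "\<dots> = (\<integral>\<^sup>+c. ennreal (\<gamma> c) * (\<integral>\<^sup>+\<omega>. ennreal ((norm (\<xi> \<omega>))\<^sup>2) \<partial>lborel) \<partial>lborel)"
  proof (rule nn_integral_cong)
    fix c
    have "(\<integral>\<^sup>+\<omega>. ennreal (\<gamma> c * (norm (\<xi> (\<omega> - j c)))\<^sup>2) \<partial>lborel)
       = ennreal (\<gamma> c) * (\<integral>\<^sup>+\<omega>. ennreal ((norm (\<xi> (\<omega> - j c)))\<^sup>2) \<partial>lborel)"
      unfolding ennreal_mult[OF \<gamma>(2) zero_le_power2] by (rule nn_integral_cmult) measurable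
    then show "(\<integral>\<^sup>+\<omega>. ennreal (\<gamma> c * (norm (\<xi> (\<omega> - j c)))\<^sup>2) \<partial>lborel) = ennreal (\<gamma> c) * (\<integral>\<^sup>+\<omega>. ennreal ((norm (\<xi> \<omega>))\<^sup>2) \<partial>lborel)"
      by (subst (asm) nn_integral_translate[where f="\<lambda>\<omega>. ennreal ((norm (\<xi> \<omega>))\<^sup>2)"]) measurable
  qed
  also have "\<dots> = (\<integral>\<^sup>+c. ennreal (\<gamma> c) \<partial>lborel) * (\<integral>\<^sup>+\<omega>. ennreal ((norm (\<xi> \<omega>))\<^sup>2) \<partial>lborel)"
    by (rule nn_integral_multc) measurable
  also have "\<dots> < \<infinity>"
    using L2_finite[OF \<xi>] \<gamma> by (simp add: integrable_iff_bounded ennreal_mult_less_top)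
  finally show ?thesis .
qed

text \<open>By t <= 1 + t^2 the integrand is at most \<gamma> c plus the integrand of
  \<open>young_finite\<close>, and the integral of the latter over c is finite at almost every
  point.\<close>

lemma young_integrable: "AE \<omega> in lborel. integrable lborel (\<lambda>c. \<gamma> c * norm (\<xi> (\<omega> - j c)))"
proof -
  have [measurable]: "\<gamma> \<in> borel_measurable borel" "\<xi> \<in> borel_measurable borel"
    using \<gamma>(1) borel_measurable_integrable L2_borel[OF \<xi>] by fastforce+
  have "AE \<omega> in lborel. (\<integral>\<^sup>+c. ennreal (\<gamma> c * (norm (\<xi> (\<omega> - j c)))\<^sup>2) \<partial>lborel) \<noteq> \<infinity>"
    by (rule nn_integral_PInf_AE) (use young_finite in \<open>auto simp: less_top\<close>)
  then show ?thesis
  proof (rule AE_mp, intro AE_I2 impI)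
    fix \<omega> assume *: "(\<integral>\<^sup>+c. ennreal (\<gamma> c * (norm (\<xi> (\<omega> - j c)))\<^sup>2) \<partial>lborel) \<noteq> \<infinity>"
    have "integrable lborel (\<lambda>c. \<gamma> c * (norm (\<xi> (\<omega> - j c)))\<^sup>2)"
      by (intro integrableI_bounded) (use * \<gamma>(2) in \<open>auto simp: abs_mult less_top\<close>)
    then have i: "integrable lborel (\<lambda>c. \<gamma> c + \<gamma> c * (norm (\<xi> (\<omega> - j c)))\<^sup>2)" using \<gamma> by simp
    show "integrable lborel (\<lambda>c. \<gamma> c * norm (\<xi> (\<omega> - j c)))"
    proof (rule Bochner_Integration.integrable_bound[OF i])
      show "AE c in lborel. norm (\<gamma> c * norm (\<xi> (\<omega> - j c))) \<le> norm (\<gamma> c + \<gamma> c * (norm (\<xi> (\<omega> - j c)))\<^sup>2)"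
      proof (rule AE_I2)
        fix c
        have "t \<le> 1 + t\<^sup>2" for t :: real
          using zero_le_power2[of "t - 1 / 2"] by (simp add: power2_eq_square algebra_simps)
        then have "\<gamma> c * norm (\<xi> (\<omega> - j c)) \<le> \<gamma> c * (1 + (norm (\<xi> (\<omega> - j c)))\<^sup>2)"
          by (intro mult_left_mono \<gamma>)
        then show "norm (\<gamma> c * norm (\<xi> (\<omega> - j c))) \<le> norm (\<gamma> c + \<gamma> c * (norm (\<xi> (\<omega> - j c)))\<^sup>2)"
          using \<gamma>(2)[of c] by (simp add: abs_mult distrib_left)
      qed
    qed measurable
  qed
qed

text \<open>Cauchy-Schwarz with \<gamma> split into two square roots bounds the squared integral at
  each point by the mass of \<gamma> times the inner integral of
  \<open>young_finite\<close>.\<close>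

lemma young_L2:
  fixes k :: "'v \<Rightarrow> 'c \<Rightarrow> complex"
  assumes k [measurable]: "(\<lambda>(\<omega>, c). k \<omega> c) \<in> borel_measurable (borel \<Otimes>\<^sub>M borel)"
    and bnd: "\<And>\<omega> c. norm (k \<omega> c) \<le> \<gamma> c"
  shows "(\<lambda>\<omega>. LINT c|lborel. k \<omega> c * \<xi> (\<omega> - j c)) \<in> L2"
proof (rule L2I)
  have [measurable]: "\<gamma> \<in> borel_measurable borel" "\<xi> \<in> borel_measurable borel"
    using \<gamma>(1) borel_measurable_integrable L2_borel[OF \<xi>] by fastforce+
  show "(\<lambda>\<omega>. LINT c|lborel. k \<omega> c * \<xi> (\<omega> - j c)) \<in> borel_measurable borel" by measurable
  let ?\<Gamma> = "\<integral>\<^sup>+c. ennreal (\<gamma> c) \<partial>lborel"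
  have pt: "ennreal ((norm (LINT c|lborel. k \<omega> c * \<xi> (\<omega> - j c)))\<^sup>2) \<le>
      ?\<Gamma> * (\<integral>\<^sup>+c. ennreal (\<gamma> c * (norm (\<xi> (\<omega> - j c)))\<^sup>2) \<partial>lborel)" for \<omega>
  proof -
    have [measurable]: "k \<omega> \<in> borel_measurable borel"
      using measurable_compose[OF measurable_Pair1' k, of \<omega>] by simp
    have "ennreal (norm (LINT c|lborel. k \<omega> c * \<xi> (\<omega> - j c))) \<le> (\<integral>\<^sup>+c. ennreal (norm (k \<omega> c * \<xi> (\<omega> - j c))) \<partial>lborel)"
    proof (cases "integrable lborel (\<lambda>c. k \<omega> c * \<xi> (\<omega> - j c))")
      case True
      then show ?thesis by (rule integral_norm_bound_ennreal)
    qed (simp add: not_integrable_integral_eq)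
    also have "\<dots> \<le> (\<integral>\<^sup>+c. ennreal (sqrt (\<gamma> c)) * ennreal (sqrt (\<gamma> c) * norm (\<xi> (\<omega> - j c))) \<partial>lborel)"
    proof (rule nn_integral_mono)
      fix c
      have "norm (k \<omega> c * \<xi> (\<omega> - j c)) \<le> \<gamma> c * norm (\<xi> (\<omega> - j c))"
        unfolding norm_mult by (intro mult_right_mono bnd) auto
      also have "\<dots> = sqrt (\<gamma> c) * (sqrt (\<gamma> c) * norm (\<xi> (\<omega> - j c)))"
        using \<gamma>(2)[of c] by (simp flip: mult.assoc)
      finally show "ennreal (norm (k \<omega> c * \<xi> (\<omega> - j c))) \<le> ennreal (sqrt (\<gamma> c)) * ennreal (sqrt (\<gamma> c) * norm (\<xi> (\<omega> - j c)))"
        using \<gamma>(2)[of c] by (simp add: ennreal_mult[symmetric] ennreal_leI)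
    qed
    finally have "(ennreal (norm (LINT c|lborel. k \<omega> c * \<xi> (\<omega> - j c))))\<^sup>2 \<le>
       (\<integral>\<^sup>+c. ennreal (sqrt (\<gamma> c)) * ennreal (sqrt (\<gamma> c) * norm (\<xi> (\<omega> - j c))) \<partial>lborel)\<^sup>2"
      by (rule power_mono) simp
    also have "\<dots> \<le> (\<integral>\<^sup>+c. (ennreal (sqrt (\<gamma> c)))\<^sup>2 \<partial>lborel) * (\<integral>\<^sup>+c. (ennreal (sqrt (\<gamma> c) * norm (\<xi> (\<omega> - j c))))\<^sup>2 \<partial>lborel)"
      by (rule Cauchy_Schwarz_nn_integral) measurable
    also have "(\<integral>\<^sup>+c. (ennreal (sqrt (\<gamma> c)))\<^sup>2 \<partial>lborel) = ?\<Gamma>"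
      using \<gamma>(2) by (intro nn_integral_cong) (simp add: ennreal_power)
    also have "(\<integral>\<^sup>+c. (ennreal (sqrt (\<gamma> c) * norm (\<xi> (\<omega> - j c))))\<^sup>2 \<partial>lborel) = (\<integral>\<^sup>+c. ennreal (\<gamma> c * (norm (\<xi> (\<omega> - j c)))\<^sup>2) \<partial>lborel)"
      using \<gamma>(2) by (intro nn_integral_cong) (simp add: ennreal_power power_mult_distrib)
    finally show ?thesis by (simp add: ennreal_power)
  qed
  have "(\<integral>\<^sup>+\<omega>. ennreal ((norm (LINT c|lborel. k \<omega> c * \<xi> (\<omega> - j c)))\<^sup>2) \<partial>lborel)
     \<le> (\<integral>\<^sup>+\<omega>. ?\<Gamma> * (\<integral>\<^sup>+c. ennreal (\<gamma> c * (norm (\<xi> (\<omega> - j c)))\<^sup>2) \<partial>lborel) \<partial>lborel)"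
    by (intro nn_integral_mono pt)
  also have "\<dots> = ?\<Gamma> * (\<integral>\<^sup>+\<omega>. (\<integral>\<^sup>+c. ennreal (\<gamma> c * (norm (\<xi> (\<omega> - j c)))\<^sup>2) \<partial>lborel) \<partial>lborel)"
    by (rule nn_integral_cmult) measurable
  also have "\<dots> < \<infinity>"
    using young_finite \<gamma> by (simp add: integrable_iff_bounded ennreal_mult_less_top)
  finally show "(\<integral>\<^sup>+\<omega>. ennreal ((norm (LINT c|lborel. k \<omega> c * \<xi> (\<omega> - j c)))\<^sup>2) \<partial>lborel) < \<infinity>" .
qed

end

subsection \<open>Changes of variables\<close>

lemma nn_integral_affine:
  fixes f :: "'a::euclidean_space \<Rightarrow> ennreal"
  assumes [measurable]: "f \<in> borel_measurable borel" and c: "c \<noteq> 0"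
  shows "(\<integral>\<^sup>+x. f x \<partial>lborel) = ennreal (\<bar>c\<bar> ^ DIM('a)) * (\<integral>\<^sup>+x. f (t + c *\<^sub>R x) \<partial>lborel)"
  by (subst lborel_affine[OF c, of t]) (simp add: nn_integral_density nn_integral_distr nn_integral_cmult)

text \<open>The transformation formula for nonnegative functions says that \<sigma> pushes J dx
  forward to Lebesgue measure; complex integrals, integrability and null sets all follow from this,
  without derivatives or determinants.\<close>

locale change_of_variables =
  fixes \<sigma> :: "'a::euclidean_space \<Rightarrow> 'b::euclidean_space" and J :: "'a \<Rightarrow> real"
  assumes \<sigma> [measurable]: "\<sigma> \<in> borel_measurable borel" and J [measurable]: "J \<in> borel_measurable borel"
    and J_pos: "\<And>x. 0 < J x"
    and nn_integral: "\<And>f. f \<in> borel_measurable borel \<Longrightarrow>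
      (\<integral>\<^sup>+x. ennreal (J x) * f (\<sigma> x) \<partial>lborel) = (\<integral>\<^sup>+y. f y \<partial>lborel)"
begin

lemma distr: "distr (density lborel J) borel \<sigma> = lborel"
proof (rule measure_eqI)
  fix A assume "A \<in> sets (distr (density lborel J) borel \<sigma>)"
  then have [measurable]: "A \<in> sets borel" by simp
  have "emeasure (distr (density lborel J) borel \<sigma>) A = (\<integral>\<^sup>+x. indicator A (\<sigma> x) \<partial>density lborel J)"
    by (subst nn_integral_indicator[symmetric], simp, subst nn_integral_distr) auto
  also have "\<dots> = (\<integral>\<^sup>+x. ennreal (J x) * indicator A (\<sigma> x) \<partial>lborel)" by (subst nn_integral_density) auto
  also have "\<dots> = (\<integral>\<^sup>+y. indicator A y \<partial>lborel)" by (rule nn_integral) auto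
  finally show "emeasure (distr (density lborel J) borel \<sigma>) A = emeasure lborel A" by simp
qed simp

text \<open>Positivity of \<open>J\<close> makes a null set of the weighted measure null for
  Lebesgue measure.\<close>

lemma AE:
  assumes "AE y in lborel. P y"
  shows "AE x in lborel. P (\<sigma> x)"
proof -
  obtain N where N: "N \<in> null_sets lborel" "{y. \<not> P y} \<subseteq> N"
    using assms unfolding eventually_ae_filter by auto
  have [measurable]: "N \<in> sets borel" using N by auto
  have "AE y in distr (density lborel J) borel \<sigma>. y \<notin> N"
    unfolding distr using AE_not_in[OF N(1)] .
  then have "AE x in density lborel J. \<sigma> x \<notin> N" by (subst (asm) AE_distr_iff) auto
  then have "AE x in lborel. \<sigma> x \<notin> N" using J_pos by (subst (asm) AE_density) auto
  then show ?thesis by (rule AE_mp, intro AE_I2 impI) (use N(2) in auto)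
qed

lemma
  fixes f :: "'b \<Rightarrow> complex"
  assumes [measurable]: "f \<in> borel_measurable borel"
  shows integral: "(LINT x|lborel. J x *\<^sub>R f (\<sigma> x)) = (LINT y|lborel. f y)"
    and integrable: "integrable lborel (\<lambda>x. J x *\<^sub>R f (\<sigma> x)) \<longleftrightarrow> integrable lborel f"
proof -
  have "(LINT y|lborel. f y) = (LINT y|distr (density lborel J) borel \<sigma>. f y)" unfolding distr ..
  also have "\<dots> = (LINT x|density lborel J. f (\<sigma> x))" by (rule integral_distr) auto
  also have "\<dots> = (LINT x|lborel. J x *\<^sub>R f (\<sigma> x))"
    by (rule integral_density) (auto simp: less_imp_le[OF J_pos])
  finally show "(LINT x|lborel. J x *\<^sub>R f (\<sigma> x)) = (LINT y|lborel. f y)" by simp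
  have "integrable lborel f \<longleftrightarrow> integrable (distr (density lborel J) borel \<sigma>) f" unfolding distr ..
  also have "\<dots> \<longleftrightarrow> integrable (density lborel J) (\<lambda>x. f (\<sigma> x))" by (rule integrable_distr_eq) auto
  also have "\<dots> \<longleftrightarrow> integrable lborel (\<lambda>x. J x *\<^sub>R f (\<sigma> x))"
    by (rule integrable_density) (auto simp: less_imp_le[OF J_pos])
  finally show "integrable lborel (\<lambda>x. J x *\<^sub>R f (\<sigma> x)) \<longleftrightarrow> integrable lborel f" by simp
qed

end

section \<open>Measurability and iterated integrals in coordinates\<close>

lemma fst_borel [measurable]: "(fst :: 'a::second_countable_topology \<times> 'b::second_countable_topology \<Rightarrow> 'a) \<in> borel_measurable borel"
  and snd_borel [measurable]: "(snd :: 'a \<times> 'b \<Rightarrow> 'b) \<in> borel_measurable borel"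
  by (intro borel_measurable_continuous_onI continuous_intros)+

lemma ebar_borel [measurable]: "ebar \<in> borel_measurable borel"
  unfolding ebar_eq[abs_def] by measurable

lemma eta_borel [measurable]: "eta lam \<in> borel_measurable borel"
  unfolding eta_def[abs_def] by measurable

lemma cnj_borel [measurable]: "cnj \<in> borel_measurable borel"
  by (intro borel_measurable_continuous_onI continuous_intros)

lemma nn_integral_pair:
  fixes f :: "'a::euclidean_space \<times> 'b::euclidean_space \<Rightarrow> ennreal"
  assumes "f \<in> borel_measurable borel"
  shows "(\<integral>\<^sup>+z. f z \<partial>lborel) = (\<integral>\<^sup>+x. \<integral>\<^sup>+y. f (x, y) \<partial>lborel \<partial>lborel)"
proof -
  have "f \<in> borel_measurable (lborel \<Otimes>\<^sub>M lborel)" using assms by (simp add: lborel_prod)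
  from lborel.nn_integral_fst[OF this] show ?thesis by (simp add: lborel_prod)
qed

lemma nn_integral_triple:
  fixes f :: "'a::euclidean_space \<times> 'b::euclidean_space \<times> 'c::euclidean_space \<Rightarrow> ennreal"
  assumes [measurable]: "f \<in> borel_measurable borel"
  shows "(\<integral>\<^sup>+z. f z \<partial>lborel) = (\<integral>\<^sup>+x. \<integral>\<^sup>+y. \<integral>\<^sup>+r. f (x, y, r) \<partial>lborel \<partial>lborel \<partial>lborel)"
  by (subst nn_integral_pair, measurable, intro nn_integral_cong nn_integral_pair, measurable)

text \<open>Two copies of R^n are scaled by s and r is only translated, so the Jacobian is
  s^(2n).\<close>

lemma nn_integral_affine_G:
  fixes f :: "'n::finite G \<Rightarrow> ennreal"
  assumes [measurable]: "f \<in> borel_measurable borel" and s: "0 < s"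
  shows "(\<integral>\<^sup>+z. ennreal (s ^ (2 * CARD('n))) * f (s *\<^sub>R fst z, s *\<^sub>R fst (snd z), t + snd (snd z)) \<partial>lborel) = (\<integral>\<^sup>+z. f z \<partial>lborel)"
proof -
  have J: "ennreal (s ^ (2 * CARD('n))) = ennreal (\<bar>s\<bar> ^ DIM(real ^ 'n)) * ennreal (\<bar>s\<bar> ^ DIM(real ^ 'n))"
    using s by (simp add: ennreal_mult[symmetric] power_mult power2_eq_square power_mult_distrib mult.commute)
  have "(\<integral>\<^sup>+z. ennreal (s ^ (2 * CARD('n))) * f (s *\<^sub>R fst z, s *\<^sub>R fst (snd z), t + snd (snd z)) \<partial>lborel)
     = (\<integral>\<^sup>+x. \<integral>\<^sup>+y. \<integral>\<^sup>+r. ennreal (s ^ (2 * CARD('n))) * f (s *\<^sub>R x, s *\<^sub>R y, t + r) \<partial>lborel \<partial>lborel \<partial>lborel)"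
    by (subst nn_integral_triple) auto
  also have "\<dots> = (\<integral>\<^sup>+x. ennreal (\<bar>s\<bar> ^ DIM(real ^ 'n)) * (\<integral>\<^sup>+y. ennreal (\<bar>s\<bar> ^ DIM(real ^ 'n)) * (\<integral>\<^sup>+r. f (s *\<^sub>R x, s *\<^sub>R y, t + r) \<partial>lborel) \<partial>lborel) \<partial>lborel)"
    unfolding J by (simp add: nn_integral_cmult mult.assoc)
  also have "\<dots> = (\<integral>\<^sup>+x. ennreal (\<bar>s\<bar> ^ DIM(real ^ 'n)) * (\<integral>\<^sup>+y. ennreal (\<bar>s\<bar> ^ DIM(real ^ 'n)) * (\<integral>\<^sup>+r. f (0 + s *\<^sub>R x, 0 + s *\<^sub>R y, r) \<partial>lborel) \<partial>lborel) \<partial>lborel)"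
    by (subst (2) nn_integral_affine[where c=1 and t=t]) auto
  also have "\<dots> = (\<integral>\<^sup>+x. ennreal (\<bar>s\<bar> ^ DIM(real ^ 'n)) * (\<integral>\<^sup>+y. \<integral>\<^sup>+r. f (0 + s *\<^sub>R x, y, r) \<partial>lborel \<partial>lborel) \<partial>lborel)"
    using s by (subst nn_integral_affine[where c=s and t=0 and 'a="real ^ 'n" and f="\<lambda>y. \<integral>\<^sup>+r. f (_, y, r) \<partial>lborel"]) (auto simp: nn_integral_cmult)
  also have "\<dots> = (\<integral>\<^sup>+x. \<integral>\<^sup>+y. \<integral>\<^sup>+r. f (x, y, r) \<partial>lborel \<partial>lborel \<partial>lborel)"
    using s by (subst (2) nn_integral_affine[where c=s and t=0]) (auto simp: nn_integral_cmult)
  also have "\<dots> = (\<integral>\<^sup>+z. f z \<partial>lborel)"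
    by (rule nn_integral_triple[symmetric]) measurable
  finally show ?thesis .
qed

subsection \<open>The unitary operator and its adjoint\<close>

abbreviation sc :: "real \<Rightarrow> 'n::finite G \<times> 'n G \<Rightarrow> real" where
  "sc lam \<omega> \<equiv> exp (- lam * snd (snd (snd \<omega>)))"

text \<open>The point transformation inside \<open>U\<close>. Its Jacobian is s^(2n), of which the
  factor s^n in \<open>U\<close> is the square root, as unitarity demands.\<close>

definition shear :: "real \<Rightarrow> 'n::finite G \<times> 'n G \<Rightarrow> 'n G \<times> 'n G" where
  "shear lam = (\<lambda>((x, y, r), (x', y', r')). let s = exp (- lam * r') in
     ((s *\<^sub>R x, s *\<^sub>R y, r + r'), (x' - s *\<^sub>R x, y' - s *\<^sub>R y, r')))"

definition unshear :: "real \<Rightarrow> 'n::finite G \<times> 'n G \<Rightarrow> 'n G \<times> 'n G" where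
  "unshear lam = (\<lambda>((u, v, w), (u', v', r')). let s = exp (- lam * r') in
     ((u /\<^sub>R s, v /\<^sub>R s, w - r'), (u' + u, v' + v, r')))"

lemma unshear_shear: "unshear lam (shear lam \<omega>) = \<omega>"
  by (cases \<omega>) (auto simp: shear_def unshear_def Let_def)

lemma shear_borel [measurable]: "shear lam \<in> borel_measurable borel"
  unfolding shear_def Let_def case_prod_unfold by measurable

lemma unshear_borel [measurable]: "unshear lam \<in> borel_measurable borel"
  unfolding unshear_def Let_def case_prod_unfold by measurable

text \<open>The shear factors into two elementary maps: an affine map of the first point with the
  second fixed, then a translation of the second point with the first fixed.\<close>

interpretation shear: change_of_variables "shear lam :: 'n::finite G \<times> 'n G \<Rightarrow> _"
  "\<lambda>\<omega>. sc lam \<omega> ^ (2 * CARD('n))" for lam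
proof
  show "(\<lambda>\<omega> :: 'n G \<times> 'n G. sc lam \<omega> ^ (2 * CARD('n))) \<in> borel_measurable borel" by measurable
  show "0 < sc lam \<omega> ^ (2 * CARD('n))" for \<omega> :: "'n G \<times> 'n G" by simp
  fix f :: "'n G \<times> 'n G \<Rightarrow> ennreal" assume f [measurable]: "f \<in> borel_measurable borel"
  let ?s = "\<lambda>z' :: 'n G. exp (- lam * snd (snd z'))"
  let ?g = "\<lambda>(z' :: 'n G) z :: 'n G. f (z, z' - (fst z, fst (snd z), 0))"
  have [measurable]: "f \<in> borel_measurable (borel \<Otimes>\<^sub>M borel)" using f by (simp add: borel_prod)
  have "(\<integral>\<^sup>+\<omega>. ennreal (sc lam \<omega> ^ (2 * CARD('n))) * f (shear lam \<omega>) \<partial>lborel)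
     = (\<integral>\<^sup>+z'. \<integral>\<^sup>+z. ennreal (?s z' ^ (2 * CARD('n))) * f (shear lam (z, z')) \<partial>lborel \<partial>lborel)"
    unfolding lborel_prod[symmetric, where 'a="'n G" and 'b="'n G"]
    by (subst lborel_pair.nn_integral_snd[symmetric]) (auto simp: lborel_prod borel_prod)
  also have "\<dots> = (\<integral>\<^sup>+z'. \<integral>\<^sup>+z. ?g z' z \<partial>lborel \<partial>lborel)"
  proof (rule nn_integral_cong)
    fix z' :: "'n G"
    obtain x' y' r' where z': "z' = (x', y', r')" by (metis surj_pair)
    have "(\<integral>\<^sup>+z. ennreal (?s z' ^ (2 * CARD('n))) * f (shear lam (z, z')) \<partial>lborel)
      = (\<integral>\<^sup>+z. ennreal (?s z' ^ (2 * CARD('n))) * ?g z' (?s z' *\<^sub>R fst z, ?s z' *\<^sub>R fst (snd z), r' + snd (snd z)) \<partial>lborel)"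
      by (intro nn_integral_cong) (auto simp: z' shear_def Let_def add.commute)
    also have "\<dots> = (\<integral>\<^sup>+z. ?g z' z \<partial>lborel)"
      by (rule nn_integral_affine_G) auto
    finally show "(\<integral>\<^sup>+z. ennreal (?s z' ^ (2 * CARD('n))) * f (shear lam (z, z')) \<partial>lborel) = (\<integral>\<^sup>+z. ?g z' z \<partial>lborel)" .
  qed
  also have "\<dots> = (\<integral>\<^sup>+z. \<integral>\<^sup>+z'. ?g z' z \<partial>lborel \<partial>lborel)"
    by (rule lborel_pair.Fubini') measurable
  also have "\<dots> = (\<integral>\<^sup>+z. \<integral>\<^sup>+z'. f (z, z') \<partial>lborel \<partial>lborel)"
    by (intro nn_integral_cong nn_integral_translate[where f="\<lambda>z'. f (_, z')"]) measurable
  also have "\<dots> = (\<integral>\<^sup>+\<omega>. f \<omega> \<partial>lborel)"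
    unfolding lborel_prod[symmetric, where 'a="'n G" and 'b="'n G"]
    by (subst lborel.nn_integral_fst) (auto simp: borel_prod)
  finally show "(\<integral>\<^sup>+\<omega>. ennreal (sc lam \<omega> ^ (2 * CARD('n))) * f (shear lam \<omega>) \<partial>lborel) = (\<integral>\<^sup>+\<omega>. f \<omega> \<partial>lborel)" .
qed measurable

text \<open>After the shear u = s x and v' = y' - s y, so at a sheared point this is the argument of
  \<open>ebar\<close> in \<open>U\<close>.\<close>

definition uphase :: "real \<Rightarrow> 'n::finite G \<times> 'n G \<Rightarrow> real" where
  "uphase lam = (\<lambda>((u, v, w), (u', v', r')). eta lam r' * (u \<bullet> v'))"

text \<open>The candidate for the adjoint: undo the shear, conjugate the phase, invert the factor
  s^n. The shear leaves r' unchanged, so s is the same at both points.\<close>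

definition Uinv :: "real \<Rightarrow> ('n::finite G \<times> 'n G) oper" where
  "Uinv lam \<zeta> \<omega> = of_real ((1 / sc lam \<omega>) ^ CARD('n)) * e (uphase lam \<omega>) * \<zeta> (unshear lam \<omega>)"

lemma uphase_borel [measurable]: "uphase lam \<in> borel_measurable borel"
  unfolding uphase_def case_prod_unfold by measurable

lemma U_shear:
  "U lam \<xi> \<omega> = of_real (sc lam \<omega> ^ CARD('n)) * e (- uphase lam (shear lam \<omega>)) * \<xi> (shear lam (\<omega> :: 'n::finite G \<times> 'n G))"
  by (cases \<omega>) (auto simp: U_def shear_def uphase_def Let_def ebar_eq)

lemma sc_shear [simp]: "snd (snd (snd (shear lam \<omega>))) = snd (snd (snd \<omega>))"
  by (cases \<omega>) (auto simp: shear_def Let_def)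

lemma Uinv_shear:
  "Uinv lam \<zeta> (shear lam \<omega>) = of_real ((1 / sc lam \<omega>) ^ CARD('n)) * e (uphase lam (shear lam \<omega>)) * \<zeta> (\<omega> :: 'n::finite G \<times> 'n G)"
  unfolding Uinv_def unshear_shear by simp

lemma Uinv_L2:
  fixes \<zeta> :: "'n::finite G \<times> 'n G \<Rightarrow> complex"
  assumes "\<zeta> \<in> L2" shows "Uinv lam \<zeta> \<in> L2"
proof (rule L2I)
  have [measurable]: "\<zeta> \<in> borel_measurable borel" using assms by (rule L2_borel)
  show [measurable]: "Uinv lam \<zeta> \<in> borel_measurable borel" unfolding Uinv_def by measurable
  have eq: "sc lam \<omega> ^ (2 * CARD('n)) * (norm (Uinv lam \<zeta> (shear lam \<omega>)))\<^sup>2 = (norm (\<zeta> \<omega>))\<^sup>2" for \<omega>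
  proof -
    have "sc lam \<omega> ^ (2 * CARD('n)) * ((1 / sc lam \<omega>) ^ CARD('n))\<^sup>2 = 1"
      by (simp add: power_mult[symmetric] mult.commute[of 2] power_one_over)
    then show ?thesis unfolding Uinv_shear by (simp add: norm_mult power_mult_distrib norm_power norm_divide flip: mult.assoc)
  qed
  have "(\<integral>\<^sup>+\<omega>. ennreal ((norm (Uinv lam \<zeta> \<omega>))\<^sup>2) \<partial>lborel)
     = (\<integral>\<^sup>+\<omega>. ennreal (sc lam \<omega> ^ (2 * CARD('n))) * ennreal ((norm (Uinv lam \<zeta> (shear lam \<omega>)))\<^sup>2) \<partial>lborel)"
    by (rule shear.nn_integral[symmetric]) measurable
  also have "\<dots> = (\<integral>\<^sup>+\<omega>. ennreal ((norm (\<zeta> \<omega>))\<^sup>2) \<partial>lborel)"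
    by (intro nn_integral_cong) (simp only: ennreal_mult[symmetric] zero_le_power2 zero_le_power exp_ge_zero eq)
  also have "\<dots> < \<infinity>" by (rule L2_finite[OF assms])
  finally show "(\<integral>\<^sup>+\<omega>. ennreal ((norm (Uinv lam \<zeta> \<omega>))\<^sup>2) \<partial>lborel) < \<infinity>" .
qed

text \<open>Changing variables by the shear brings in s^(2n); against the s^(-n) of
  \<open>Uinv\<close> this leaves the s^n of \<open>U\<close>, and conjugating the phase of
  \<open>Uinv\<close> gives that of \<open>U\<close>.\<close>

lemma L2_inner_U:
  fixes \<zeta> :: "'n::finite G \<times> 'n G \<Rightarrow> complex"
  assumes "\<xi> \<in> L2" "\<zeta> \<in> L2"
  shows "L2_inner \<xi> (Uinv lam \<zeta>) = L2_inner (U lam \<xi>) \<zeta>"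
proof -
  have [measurable]: "\<xi> \<in> borel_measurable borel" "Uinv lam \<zeta> \<in> borel_measurable borel"
    using assms Uinv_L2 L2_borel by blast+
  have "L2_inner \<xi> (Uinv lam \<zeta>) = (LINT \<omega>|lborel. sc lam \<omega> ^ (2 * CARD('n)) *\<^sub>R (\<xi> (shear lam \<omega>) * cnj (Uinv lam \<zeta> (shear lam \<omega>))))"
    unfolding L2_inner_def by (rule shear.integral[symmetric]) measurable
  also have "\<dots> = L2_inner (U lam \<xi>) \<zeta>"
    unfolding L2_inner_def
  proof (rule Bochner_Integration.integral_cong[OF refl])
    fix \<omega> :: "'n G \<times> 'n G"
    have "sc lam \<omega> ^ (2 * CARD('n)) * (1 / sc lam \<omega>) ^ CARD('n) = sc lam \<omega> ^ CARD('n)"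
      by (simp add: power_one_over power_add mult_2)
    then have 1: "complex_of_real (sc lam \<omega> ^ (2 * CARD('n))) * of_real ((1 / sc lam \<omega>) ^ CARD('n)) = of_real (sc lam \<omega> ^ CARD('n))"
      unfolding of_real_mult[symmetric] by simp
    have "sc lam \<omega> ^ (2 * CARD('n)) *\<^sub>R (\<xi> (shear lam \<omega>) * cnj (Uinv lam \<zeta> (shear lam \<omega>))) =
       (complex_of_real (sc lam \<omega> ^ (2 * CARD('n))) * of_real ((1 / sc lam \<omega>) ^ CARD('n))) *
         (e (- uphase lam (shear lam \<omega>)) * \<xi> (shear lam \<omega>) * cnj (\<zeta> \<omega>))"
      unfolding Uinv_shear scaleR_conv_of_real complex_cnj_mult cnj_e complex_cnj_complex_of_real by (simp only: mult_ac)
    then show "sc lam \<omega> ^ (2 * CARD('n)) *\<^sub>R (\<xi> (shear lam \<omega>) * cnj (Uinv lam \<zeta> (shear lam \<omega>))) = U lam \<xi> \<omega> * cnj (\<zeta> \<omega>)"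
      unfolding 1 U_shear by (simp only: mult_ac)
  qed
  finally show ?thesis .
qed

lemma L2_mult_integrable:
  fixes \<xi> \<zeta> :: "'v::euclidean_space \<Rightarrow> complex"
  assumes "\<xi> \<in> L2" "\<zeta> \<in> L2" shows "integrable lborel (\<lambda>z. \<xi> z * cnj (\<zeta> z))"
proof (rule Bochner_Integration.integrable_bound)
  have [measurable]: "\<xi> \<in> borel_measurable borel" "\<zeta> \<in> borel_measurable borel" using assms L2_borel by auto
  show "integrable lborel (\<lambda>z. (norm (\<xi> z))\<^sup>2 + (norm (\<zeta> z))\<^sup>2)" using assms unfolding L2_def by simp
  show "(\<lambda>z. \<xi> z * cnj (\<zeta> z)) \<in> borel_measurable lborel" by measurable
  show "AE z in lborel. norm (\<xi> z * cnj (\<zeta> z)) \<le> norm ((norm (\<xi> z))\<^sup>2 + (norm (\<zeta> z))\<^sup>2)"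
  proof (rule AE_I2)
    fix z
    have "a * b \<le> a\<^sup>2 + b\<^sup>2" if "0 \<le> a" "0 \<le> b" for a b :: real
    proof -
      have "0 \<le> a * b" using that by simp
      moreover have "2 * (a * b) \<le> a\<^sup>2 + b\<^sup>2" using sum_squares_bound[of a b] by (simp only: mult.assoc)
      ultimately show ?thesis by linarith
    qed
    then show "norm (\<xi> z * cnj (\<zeta> z)) \<le> norm ((norm (\<xi> z))\<^sup>2 + (norm (\<zeta> z))\<^sup>2)" by (simp add: norm_mult)
  qed
qed

lemma L2_diff:
  fixes \<xi> \<zeta> :: "'v::euclidean_space \<Rightarrow> complex"
  assumes "\<xi> \<in> L2" "\<zeta> \<in> L2" shows "(\<lambda>z. \<xi> z - \<zeta> z) \<in> L2"
proof -
  have [measurable]: "\<xi> \<in> borel_measurable borel" "\<zeta> \<in> borel_measurable borel" using assms L2_borel by auto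
  have "integrable lborel (\<lambda>z. (norm (\<xi> z - \<zeta> z))\<^sup>2)"
  proof (rule Bochner_Integration.integrable_bound)
    show "integrable lborel (\<lambda>z. 2 * ((norm (\<xi> z))\<^sup>2 + (norm (\<zeta> z))\<^sup>2))" using assms unfolding L2_def by simp
    show "(\<lambda>z. (norm (\<xi> z - \<zeta> z))\<^sup>2) \<in> borel_measurable lborel" by measurable
    show "AE z in lborel. norm ((norm (\<xi> z - \<zeta> z))\<^sup>2) \<le> norm (2 * ((norm (\<xi> z))\<^sup>2 + (norm (\<zeta> z))\<^sup>2))"
    proof (rule AE_I2)
      fix z
      have "(norm (\<xi> z - \<zeta> z))\<^sup>2 \<le> (norm (\<xi> z) + norm (\<zeta> z))\<^sup>2"
        by (intro power_mono norm_triangle_ineq4) auto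
      also have "\<dots> \<le> 2 * ((norm (\<xi> z))\<^sup>2 + (norm (\<zeta> z))\<^sup>2)"
        using zero_le_power2[of "norm (\<xi> z) - norm (\<zeta> z)"] by (simp add: power2_eq_square algebra_simps)
      finally show "norm ((norm (\<xi> z - \<zeta> z))\<^sup>2) \<le> norm (2 * ((norm (\<xi> z))\<^sup>2 + (norm (\<zeta> z))\<^sup>2))" by simp
    qed
  qed
  then show ?thesis unfolding L2_def by simp
qed

text \<open>Testing against the difference itself makes its norm zero.\<close>

lemma L2_inner_unique:
  assumes 1: "\<zeta>1 \<in> L2" and 2: "\<zeta>2 \<in> L2" and eq: "\<And>\<xi>. \<xi> \<in> L2 \<Longrightarrow> L2_inner \<xi> \<zeta>1 = L2_inner \<xi> \<zeta>2"
  shows "AE z in lborel. \<zeta>1 z = \<zeta>2 z"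
proof -
  let ?d = "\<lambda>z. \<zeta>1 z - \<zeta>2 z"
  have d: "?d \<in> L2" by (rule L2_diff[OF 1 2])
  have "L2_inner ?d ?d = L2_inner ?d \<zeta>1 - L2_inner ?d \<zeta>2"
    unfolding L2_inner_def
    by (subst Bochner_Integration.integral_diff[symmetric])
       (auto intro!: L2_mult_integrable d 1 2 Bochner_Integration.integral_cong simp: algebra_simps)
  then have "L2_inner ?d ?d = 0" using eq[OF d] by simp
  moreover have "L2_inner ?d ?d = of_real (LINT z|lborel. (norm (?d z))\<^sup>2)"
    unfolding L2_inner_def integral_complex_of_real[symmetric]
    by (intro Bochner_Integration.integral_cong refl) (simp only: complex_norm_square)
  ultimately have "(LINT z|lborel. (norm (?d z))\<^sup>2) = 0" by simp
  then have "AE z in lborel. (norm (?d z))\<^sup>2 = 0"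
    using d unfolding L2_def by (subst (asm) integral_nonneg_eq_0_iff_AE) auto
  then show ?thesis by (rule eventually_mono) simp
qed

text \<open>\<open>Uinv\<close> witnesses that the choice in \<open>L2_adjoint\<close> succeeds, and
  two vectors with the same inner products agree almost everywhere.\<close>

lemma L2_adjoint_U:
  fixes \<zeta> :: "'n::finite G \<times> 'n G \<Rightarrow> complex"
  assumes "\<zeta> \<in> L2"
  shows "L2_adjoint (U lam) \<zeta> \<in> L2" "AE \<omega> in lborel. L2_adjoint (U lam) \<zeta> \<omega> = Uinv lam \<zeta> \<omega>"
proof -
  have "\<exists>\<zeta>'. \<zeta>' \<in> L2 \<and> (\<forall>\<xi> \<in> L2. L2_inner \<xi> \<zeta>' = L2_inner (U lam \<xi>) \<zeta>)"
    using Uinv_L2[OF assms] L2_inner_U[OF _ assms] by blast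
  then have *: "L2_adjoint (U lam) \<zeta> \<in> L2 \<and> (\<forall>\<xi> \<in> L2. L2_inner \<xi> (L2_adjoint (U lam) \<zeta>) = L2_inner (U lam \<xi>) \<zeta>)"
    unfolding L2_adjoint_def by (rule someI_ex)
  then show "L2_adjoint (U lam) \<zeta> \<in> L2" by blast
  show "AE \<omega> in lborel. L2_adjoint (U lam) \<zeta> \<omega> = Uinv lam \<zeta> \<omega>"
    by (rule L2_inner_unique) (use * Uinv_L2[OF assms] L2_inner_U[OF _ assms] in auto)
qed

subsection \<open>The comultiplication of an element of the algebra\<close>

definition lker :: "real \<Rightarrow> ('n::finite G \<Rightarrow> complex) \<Rightarrow> 'n G \<Rightarrow> 'n W \<Rightarrow> complex" where
  "lker lam f z c = f (fst c, snd c, snd (snd z)) * ebar (eta lam (snd (snd z)) * (fst c \<bullet> (fst (snd z) - snd c)))"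

text \<open>As an average of translates on the product space, the operator fits the lemmas on null
  sets and translations.\<close>

lemma tensor_one_L:
  "tensor_one (L lam \<phi>) \<xi> \<omega> =
     (LINT c|lborel. lker lam (inv_fourier \<phi>) (fst \<omega>) c * \<xi> (\<omega> - ((fst c, snd c, 0), 0)))"
  by (cases \<omega>) (auto simp: tensor_one_def L_def lker_def case_prod_unfold mult_ac zero_prod_def)

lemma one_tensor_L:
  "one_tensor (L lam \<phi>) \<xi> \<omega> =
     (LINT c|lborel. lker lam (inv_fourier \<phi>) (snd \<omega>) c * \<xi> (\<omega> - (0, (fst c, snd c, 0))))"
  by (cases \<omega>) (auto simp: one_tensor_def L_def lker_def case_prod_unfold mult_ac zero_prod_def)

lemma lker_borel:
  assumes [measurable]: "f \<in> borel_measurable borel" "p \<in> borel_measurable M" "q \<in> M \<rightarrow>\<^sub>M borel"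
  shows "(\<lambda>x. lker lam f (p x) (q x)) \<in> borel_measurable M"
  unfolding lker_def by measurable

lemma integral_cong_translates:
  fixes j :: "'c::euclidean_space \<Rightarrow> 'v::euclidean_space" and k :: "'v \<Rightarrow> 'c \<Rightarrow> complex"
  assumes "AE \<omega> in lborel. \<xi>1 \<omega> = \<xi>2 \<omega>"
    and [measurable]: "\<xi>1 \<in> borel_measurable borel" "\<xi>2 \<in> borel_measurable borel" "j \<in> borel_measurable borel"
      "\<And>\<omega>. k \<omega> \<in> borel_measurable borel"
  shows "AE \<omega> in lborel. (LINT c|lborel. k \<omega> c * \<xi>1 (\<omega> - j c)) = (LINT c|lborel. k \<omega> c * \<xi>2 (\<omega> - j c))"
  using AE_shift[OF assms(1,4)]
proof (rule eventually_mono)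
  fix \<omega> assume "AE c in lborel. \<xi>1 (\<omega> - j c) = \<xi>2 (\<omega> - j c)"
  then show "(LINT c|lborel. k \<omega> c * \<xi>1 (\<omega> - j c)) = (LINT c|lborel. k \<omega> c * \<xi>2 (\<omega> - j c))"
    by (intro integral_cong_AE) auto
qed

lemma tensor_one_L_borel:
  assumes f: "inv_fourier \<phi> \<in> borel_measurable borel" and \<xi> [measurable]: "\<xi> \<in> borel_measurable borel"
  shows "tensor_one (L lam \<phi>) \<xi> \<in> borel_measurable borel"
proof -
  note [measurable] = lker_borel[OF f]
  show ?thesis unfolding tensor_one_L[abs_def] by measurable
qed

text \<open>Each value depends only on a lower-dimensional slice of the argument, which is itself a
  null set; by \<open>AE_shift\<close> the slices through almost all points meet the exceptional set
  in a negligible part. This makes the chosen adjoint harmless.\<close>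

lemma
  assumes f: "inv_fourier \<phi> \<in> borel_measurable borel"
    and "AE \<omega> in lborel. \<xi>1 \<omega> = \<xi>2 \<omega>" "\<xi>1 \<in> borel_measurable borel" "\<xi>2 \<in> borel_measurable borel"
  shows tensor_one_L_AE: "AE \<omega> in lborel. tensor_one (L lam \<phi>) \<xi>1 \<omega> = tensor_one (L lam \<phi>) \<xi>2 \<omega>"
    and one_tensor_L_AE: "AE \<omega> in lborel. one_tensor (L lam \<phi>) \<xi>1 \<omega> = one_tensor (L lam \<phi>) \<xi>2 \<omega>"
proof -
  note [measurable] = lker_borel[OF f]
  show "AE \<omega> in lborel. tensor_one (L lam \<phi>) \<xi>1 \<omega> = tensor_one (L lam \<phi>) \<xi>2 \<omega>"
    unfolding tensor_one_L by (rule integral_cong_translates) (use assms in \<open>auto, measurable\<close>)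
  show "AE \<omega> in lborel. one_tensor (L lam \<phi>) \<xi>1 \<omega> = one_tensor (L lam \<phi>) \<xi>2 \<omega>"
    unfolding one_tensor_L by (rule integral_cong_translates) (use assms in \<open>auto, measurable\<close>)
qed

text \<open>In (\<Delta>\<phi>)(1 \<otimes> \<psi>) the adjoint of \<open>U\<close> is applied to
  such a vector, and its formula is available only on \<open>L2\<close>. A multiple of
  \<open>decay\<close> dominates the kernel at every point.\<close>

lemma one_tensor_L_L2:
  assumes \<phi>: "schwartz \<phi>" and \<xi>: "\<xi> \<in> L2"
  shows "one_tensor (L lam \<phi>) \<xi> \<in> L2"
proof -
  let ?f = "inv_fourier \<phi>"
  have f: "schwartz ?f" using \<phi> by (rule schwartz_inv_fourier)
  have "schwartz (\<lambda>v. ?f (unsort1 v))" by (intro schwartz_isometry[OF f] bounded_linear_sort) simp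
  then obtain B where B: "0 \<le> B" "\<And>w t. (1 + norm t) ^ 0 * ((1 + norm w) ^ 0 * norm (?f (unsort1 (w, t)))) \<le> B * decay w"
    by (rule schwartz_slice_decay[of _ 0 0]) blast
  have [measurable]: "?f \<in> borel_measurable borel" using f by (rule schwartz_borel)
  show ?thesis unfolding one_tensor_L[abs_def]
  proof (rule young_L2[where \<gamma>="\<lambda>c. B * decay c"])
    show "integrable lborel (\<lambda>c::'a W. B * decay c)" by (intro integrable_mult_right integrable_decay)
    show "0 \<le> B * decay c" for c :: "'a W" by (intro mult_nonneg_nonneg B(1) less_imp_le[OF decay_pos])
    show "norm (lker lam ?f (snd \<omega>) c) \<le> B * decay c" for \<omega> :: "'a G \<times> 'a G" and c
      using B(2)[of "snd (snd (snd \<omega>))" c] by (simp add: lker_def norm_mult ebar_eq unsort1_def case_prod_unfold)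
    have "(\<lambda>x :: ('a G \<times> 'a G) \<times> 'a W. lker lam ?f (snd (fst x)) (snd x)) \<in> borel_measurable borel"
      by (intro lker_borel schwartz_borel[OF f] borel_measurable_continuous_onI continuous_intros)
    then show "(\<lambda>(\<omega> :: 'a G \<times> 'a G, c). lker lam ?f (snd \<omega>) c) \<in> borel_measurable (borel \<Otimes>\<^sub>M borel)"
      by (simp add: borel_prod case_prod_unfold)
    show "(\<lambda>c::'a W. (0, fst c, snd c, 0) :: 'a G \<times> 'a G) \<in> borel_measurable borel" by measurable
  qed (rule \<xi>)
qed

text \<open>The kernel of the conjugated operator: its phase is that of \<open>LL\<close> for a
  displacement by (a/s, b/s) in the first factor and (a, b) in the second, and g sees the sum r +
  r'.\<close>

definition dker :: "real \<Rightarrow> ('n::finite G \<Rightarrow> complex) \<Rightarrow> 'n G \<times> 'n G \<Rightarrow> 'n W \<Rightarrow> complex" where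
  "dker lam g = (\<lambda>((x, y, r), (x', y', r')) (a, b). let s = exp (- lam * r') in
     g (a, b, r + r') * ebar (eta lam r * ((a /\<^sub>R s) \<bullet> (y - b /\<^sub>R s)) + eta lam r' * (a \<bullet> (y' - b))))"

definition dshift :: "real \<Rightarrow> real \<Rightarrow> 'n::finite W \<Rightarrow> 'n G \<times> 'n G" where
  "dshift lam r' = (\<lambda>(a, b). let s = exp (- lam * r') in ((a /\<^sub>R s, b /\<^sub>R s, 0), (a, b, 0)))"

text \<open>The denominator is absorbed by dividing both vectors of an inner product by s = exp (-
  lam r'); in this way one phase at level r + r' splits into phases at the levels r and r'.\<close>

lemma eta_add: "lam \<noteq> 0 \<Longrightarrow> eta lam (r + r') = eta lam r' + eta lam r / (exp (- lam * r'))\<^sup>2"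
  unfolding eta_def
  by (simp add: power2_eq_square exp_minus exp_add distrib_left field_simps flip: exp_double exp_add)

lemma U_tensor_Uinv:
  assumes lam: "lam \<noteq> 0"
  shows "U lam (tensor_one (L lam \<psi>) (Uinv lam \<xi>)) \<omega> =
    (LINT c|lborel. dker lam (inv_fourier \<psi>) \<omega> c * \<xi> (\<omega> - dshift lam (snd (snd (snd \<omega>))) c))"
proof -
  obtain x y r x' y' r' where \<omega>: "\<omega> = ((x, y, r), (x', y', r'))" by (cases \<omega>) auto
  define s where "s = exp (- lam * r')"
  have s: "s \<noteq> 0" "0 < s" and s': "exp (- (lam * r')) = s" by (auto simp: s_def)
  let ?g = "inv_fourier \<psi>"
  let ?n = "CARD('a)"
  have sh: "shear lam \<omega> = ((s *\<^sub>R x, s *\<^sub>R y, r + r'), (x' - s *\<^sub>R x, y' - s *\<^sub>R y, r'))"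
    by (simp add: \<omega> shear_def s_def Let_def)
  have "U lam (tensor_one (L lam \<psi>) (Uinv lam \<xi>)) \<omega> =
     (of_real (s ^ ?n) * e (- uphase lam (shear lam \<omega>))) *
     (LINT c|lborel. lker lam ?g (s *\<^sub>R x, s *\<^sub>R y, r + r') c * Uinv lam \<xi> (shear lam \<omega> - ((fst c, snd c, 0), 0)))"
    unfolding U_shear tensor_one_L by (simp add: sh) (simp add: \<omega> s_def)
  also have "\<dots> = (LINT c|lborel. (of_real (s ^ ?n) * e (- uphase lam (shear lam \<omega>))) *
     (lker lam ?g (s *\<^sub>R x, s *\<^sub>R y, r + r') c * Uinv lam \<xi> (shear lam \<omega> - ((fst c, snd c, 0), 0))))"
    by simp
  also have "\<dots> = (LINT c|lborel. dker lam ?g \<omega> c * \<xi> (\<omega> - dshift lam (snd (snd (snd \<omega>))) c))"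
  proof (rule Bochner_Integration.integral_cong[OF refl])
    fix c :: "'a W"
    obtain a b where c: "c = (a, b)" by (cases c)
    have z: "shear lam \<omega> - ((a, b, 0), 0) = ((s *\<^sub>R x - a, s *\<^sub>R y - b, r + r'), (x' - s *\<^sub>R x, y' - s *\<^sub>R y, r'))"
      unfolding sh by (simp add: zero_prod_def)
    have un: "unshear lam (shear lam \<omega> - ((a, b, 0), 0)) = \<omega> - dshift lam r' (a, b)"
      unfolding z using s
      by (simp add: unshear_def Let_def dshift_def \<omega> s' scaleR_diff_right)
    have Ui: "Uinv lam \<xi> (shear lam \<omega> - ((a, b, 0), 0)) = of_real ((1 / s) ^ ?n) *
        e (eta lam r' * ((s *\<^sub>R x - a) \<bullet> (y' - s *\<^sub>R y))) * \<xi> (\<omega> - dshift lam r' (a, b))"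
      unfolding Uinv_def un unfolding z by (simp add: uphase_def s_def)
    \<comment> \<open>Three phases meet: that of \<open>U\<close>, that of \<open>L\<close> at level
      r + r', and that of \<open>Uinv\<close> at the displaced point. By \<open>eta_add\<close> they
      combine into the two terms of \<open>dker\<close>, the terms eta(r') a . s y
      cancelling.\<close>
    have ph: "e (- uphase lam (shear lam \<omega>)) * e (- (eta lam (r + r') * (a \<bullet> (s *\<^sub>R y - b)))) *
        e (eta lam r' * ((s *\<^sub>R x - a) \<bullet> (y' - s *\<^sub>R y)))
      = e (- (eta lam r * ((a /\<^sub>R s) \<bullet> (y - b /\<^sub>R s)) + eta lam r' * (a \<bullet> (y' - b))))"
      unfolding e_add[symmetric] sh uphase_def prod.case eta_add[OF lam] s_def[symmetric] using s
      by (intro arg_cong[where f=e]) (simp add: inner_diff_left inner_diff_right field_simps power2_eq_square)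
    have assoc: "N * M = 1 \<Longrightarrow> (N * p) * ((g * q) * (M * q' * X)) = g * (p * q * q') * X"
      for N M p q q' g X :: complex
    proof -
      assume "N * M = 1"
      moreover have "(N * p) * ((g * q) * (M * q' * X)) = (N * M) * (g * (p * q * q') * X)"
        by (simp only: mult_ac)
      ultimately show ?thesis by simp
    qed
    have "complex_of_real (s ^ ?n) * of_real ((1 / s) ^ ?n) = 1"
      using s unfolding of_real_mult[symmetric] power_mult_distrib[symmetric] by simp
    then have "(of_real (s ^ ?n) * e (- uphase lam (shear lam \<omega>))) *
       (lker lam ?g (s *\<^sub>R x, s *\<^sub>R y, r + r') c * Uinv lam \<xi> (shear lam \<omega> - ((fst c, snd c, 0), 0)))
      = ?g (a, b, r + r') * (e (- uphase lam (shear lam \<omega>)) * e (- (eta lam (r + r') * (a \<bullet> (s *\<^sub>R y - b)))) *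
        e (eta lam r' * ((s *\<^sub>R x - a) \<bullet> (y' - s *\<^sub>R y)))) * \<xi> (\<omega> - dshift lam r' (a, b))"
      unfolding c fst_conv snd_conv Ui lker_def ebar_eq by (rule assoc)
    also have "\<dots> = dker lam ?g \<omega> c * \<xi> (\<omega> - dshift lam (snd (snd (snd \<omega>))) c)"
      unfolding ph unfolding dker_def \<omega> c by (simp add: Let_def s_def ebar_eq)
    finally show "(of_real (s ^ ?n) * e (- uphase lam (shear lam \<omega>))) *
       (lker lam ?g (s *\<^sub>R x, s *\<^sub>R y, r + r') c * Uinv lam \<xi> (shear lam \<omega> - ((fst c, snd c, 0), 0)))
      = dker lam ?g \<omega> c * \<xi> (\<omega> - dshift lam (snd (snd (snd \<omega>))) c)" .
  qed
  finally show ?thesis .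
qed

lemma U_borel:
  assumes [measurable]: "\<xi> \<in> borel_measurable borel"
  shows "U lam \<xi> \<in> borel_measurable borel"
  unfolding U_shear[abs_def] by measurable

text \<open>Exceptional sets are followed outwards: the adjoint equals \<open>Uinv\<close> almost
  everywhere, \<open>tensor_one\<close> of an \<open>L\<close> respects this, and so does
  \<open>U\<close>, because preimages of null sets under the shear are null.\<close>

lemma
  fixes \<psi> :: "'n::finite G \<Rightarrow> complex"
  assumes lam: "lam \<noteq> 0" and \<psi>: "schwartz \<psi>" and \<xi>: "\<xi> \<in> L2"
  defines "\<zeta> \<equiv> \<lambda>\<omega>. LINT c|lborel. dker lam (inv_fourier \<psi>) \<omega> c * \<xi> (\<omega> - dshift lam (snd (snd (snd \<omega>))) c)"
  shows Delta_L: "AE \<omega> in lborel. Delta lam (L lam \<psi>) \<xi> \<omega> = \<zeta> \<omega>"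
    and Delta_L_borel: "Delta lam (L lam \<psi>) \<xi> \<in> borel_measurable borel"
    and dker_integral_borel: "\<zeta> \<in> borel_measurable borel"
proof -
  have f: "inv_fourier \<psi> \<in> borel_measurable borel" using \<psi> by (intro schwartz_borel schwartz_inv_fourier)
  have b: "L2_adjoint (U lam) \<xi> \<in> borel_measurable borel" "Uinv lam \<xi> \<in> borel_measurable borel"
    using L2_adjoint_U(1)[OF \<xi>] Uinv_L2[OF \<xi>] L2_borel by blast+
  have eq: "U lam (tensor_one (L lam \<psi>) (Uinv lam \<xi>)) = \<zeta>"
    unfolding \<zeta>_def using U_tensor_Uinv[OF lam] by blast
  have "AE \<omega> in lborel. tensor_one (L lam \<psi>) (L2_adjoint (U lam) \<xi>) \<omega> = tensor_one (L lam \<psi>) (Uinv lam \<xi>) \<omega>"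
    by (rule tensor_one_L_AE[OF f L2_adjoint_U(2)[OF \<xi>] b])
  from shear.AE[OF this, of lam] have "AE \<omega> in lborel. U lam (tensor_one (L lam \<psi>) (L2_adjoint (U lam) \<xi>)) \<omega> = U lam (tensor_one (L lam \<psi>) (Uinv lam \<xi>)) \<omega>"
    by (rule eventually_mono) (simp add: U_shear)
  then show "AE \<omega> in lborel. Delta lam (L lam \<psi>) \<xi> \<omega> = \<zeta> \<omega>"
    unfolding Delta_def eq comp_def .
  show "Delta lam (L lam \<psi>) \<xi> \<in> borel_measurable borel"
    unfolding Delta_def comp_def by (intro U_borel tensor_one_L_borel f b)
  show "\<zeta> \<in> borel_measurable borel" unfolding eq[symmetric] by (intro U_borel tensor_one_L_borel f b)
qed

subsection \<open>The symbols of the two products\<close>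

text \<open>Sends the total displacements (A, A') to those of the two operators in a product. It is
  used on pairs of vectors, where its Jacobian is s^(2n).\<close>

definition wshear :: "real \<Rightarrow> 'w::euclidean_space \<times> 'w \<Rightarrow> 'w \<times> 'w" where
  "wshear s p = (snd p - s *\<^sub>R fst p, s *\<^sub>R fst p)"

lemma change_of_variables_wshear:
  assumes s: "0 < s"
  shows "change_of_variables (wshear s :: 'w::euclidean_space \<times> 'w \<Rightarrow> _) (\<lambda>_. s ^ DIM('w))"
proof
  show "wshear s \<in> borel_measurable (borel :: ('w \<times> 'w) measure)" unfolding wshear_def[abs_def] by measurable
  show "0 < s ^ DIM('w)" using s by simp
  fix f :: "'w \<times> 'w \<Rightarrow> ennreal" assume f [measurable]: "f \<in> borel_measurable borel"
  have [measurable]: "f \<in> borel_measurable (borel \<Otimes>\<^sub>M borel)" using f by (simp add: borel_prod)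
  let ?J = "ennreal (s ^ DIM('w))"
  have "(\<integral>\<^sup>+p. ?J * f (wshear s p) \<partial>lborel) = (\<integral>\<^sup>+A. \<integral>\<^sup>+A'. ?J * f (A' - s *\<^sub>R A, s *\<^sub>R A) \<partial>lborel \<partial>lborel)"
    unfolding wshear_def by (subst nn_integral_pair) auto
  also have "\<dots> = (\<integral>\<^sup>+A. ?J * (\<integral>\<^sup>+A'. f (A' - s *\<^sub>R A, s *\<^sub>R A) \<partial>lborel) \<partial>lborel)"
    by (intro nn_integral_cong nn_integral_cmult) measurable
  also have "\<dots> = (\<integral>\<^sup>+A. ?J * (\<integral>\<^sup>+c. f (c, 0 + s *\<^sub>R A) \<partial>lborel) \<partial>lborel)"
    by (subst nn_integral_translate[where f="\<lambda>c. f (c, _)"]) auto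
  also have "\<dots> = ennreal (\<bar>s\<bar> ^ DIM('w)) * (\<integral>\<^sup>+A. (\<integral>\<^sup>+c. f (c, 0 + s *\<^sub>R A) \<partial>lborel) \<partial>lborel)"
    using s by (subst nn_integral_cmult) auto
  also have "\<dots> = (\<integral>\<^sup>+a. (\<integral>\<^sup>+c. f (c, a) \<partial>lborel) \<partial>lborel)"
    using s by (intro nn_integral_affine[symmetric]) auto
  also have "\<dots> = (\<integral>\<^sup>+c. (\<integral>\<^sup>+a. f (c, a) \<partial>lborel) \<partial>lborel)"
    by (rule lborel_pair.Fubini') measurable
  also have "\<dots> = (\<integral>\<^sup>+p. f p \<partial>lborel)" by (rule nn_integral_pair[symmetric]) measurable
  finally show "(\<integral>\<^sup>+p. ?J * f (wshear s p) \<partial>lborel) = (\<integral>\<^sup>+p. f p \<partial>lborel)" .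
qed measurable

lemma fourier2_tker_A2:
  assumes "schwartz f" "schwartz g" "0 \<le> R"
    and f: "\<And>p q r. \<bar>r\<bar> > R \<Longrightarrow> f (p, q, r) = 0" and g: "\<And>p q r. \<bar>r\<bar> > R \<Longrightarrow> g (p, q, r) = 0"
  shows "fourier2 (tker lam u0 u1 v0 v1 f g) \<in> \<A>2"
proof -
  \<comment> \<open>The supports bound r' and r + r' by R, hence r only by 2 R.\<close>
  have "fourier2 (tker lam u0 u1 v0 v1 f g) ((p, q, r), (p', q', r')) = 0"
    if "\<bar>r\<bar> > 2 * R \<or> \<bar>r'\<bar> > 2 * R" for p q r p' q' r'
  proof (rule fourier2_support)
    have "\<bar>r'\<bar> > R \<or> \<bar>r + r'\<bar> > R" using that \<open>0 \<le> R\<close> by linarith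
    then show "tker lam u0 u1 v0 v1 f g ((p, q, r), (p', q', r')) = 0" for p q p' q'
      using f g by (auto simp: tker_def Let_def)
  qed
  then show ?thesis unfolding \<A>2_def
    using schwartz_fourier2[OF schwartz_tker[OF assms(1,2) f g]] by blast
qed

lemma dker_borel:
  assumes [measurable]: "g \<in> borel_measurable borel" "p \<in> borel_measurable M" "q \<in> borel_measurable M"
  shows "(\<lambda>x. dker lam g (p x) (q x)) \<in> borel_measurable M"
  unfolding dker_def Let_def case_prod_unfold by measurable

lemma dshift_borel:
  assumes [measurable]: "q \<in> borel_measurable M"
  shows "(\<lambda>x. dshift lam r' (q x)) \<in> borel_measurable M"
  unfolding dshift_def Let_def case_prod_unfold by measurable

text \<open>
  A composition of two integral operators is an iterated integral over \<open>c = A' - s A\<close> and \<open>a = s A\<close>.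
\<close>

lemma LL_fubini:
  fixes Q :: "'n::finite W \<Rightarrow> 'n W \<Rightarrow> complex"
  assumes K: "schwartz K" and s: "0 < s"
    and eq: "\<And>p. K (unsort2 (p, t)) * phase2 lam v p t * \<xi> (unsort2 (v - p, t))
      = of_real (s ^ (2 * CARD('n))) * Q (fst (wshear s p)) (snd (wshear s p))"
    and Q [measurable]: "(\<lambda>p. Q (fst p) (snd p)) \<in> borel_measurable borel"
    and int: "integrable lborel (\<lambda>p. K (unsort2 (p, t)) * phase2 lam v p t * \<xi> (unsort2 (v - p, t)))"
  shows "LL lam (fourier2 K) \<xi> (unsort2 (v, t)) = (LINT c|lborel. LINT a|lborel. Q c a)"
    and "LL lam (fourier2 K) \<xi> (unsort2 (v, t)) = (LINT a|lborel. LINT c|lborel. Q c a)"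
proof -
  have dim: "DIM('n W) = 2 * CARD('n)" by simp
  interpret change_of_variables "wshear s :: 'n W \<times> 'n W \<Rightarrow> _" "\<lambda>_. s ^ DIM('n W)"
    by (rule change_of_variables_wshear[OF s])
  have LL: "LL lam (fourier2 K) \<xi> (unsort2 (v, t)) = (LINT p|lborel. Q (fst p) (snd p))"
    unfolding LL_unsort2 inv_fourier2_fourier2[OF K] eq using integral[OF Q]
    by (simp only: dim scaleR_conv_of_real)
  have "integrable lborel (\<lambda>p. Q (fst p) (snd p))"
    using int integrable[OF Q] unfolding eq by (simp only: dim scaleR_conv_of_real)
  then have iQ: "integrable (lborel \<Otimes>\<^sub>M lborel) (\<lambda>(c, a). Q c a)"
    by (simp add: lborel_prod case_prod_unfold)
  show "LL lam (fourier2 K) \<xi> (unsort2 (v, t)) = (LINT c|lborel. LINT a|lborel. Q c a)"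
    unfolding LL lborel_pair.integral_fst[OF iQ] by (simp add: lborel_prod case_prod_unfold)
  show "LL lam (fourier2 K) \<xi> (unsort2 (v, t)) = (LINT a|lborel. LINT c|lborel. Q c a)"
    unfolding LL lborel_pair.integral_snd[OF iQ] by (simp add: lborel_prod case_prod_unfold)
qed

text \<open>The kernel is at most a multiple of \<open>decay\<close> in the displacement, uniformly
  in t, so \<open>young_integrable\<close> gives absolute convergence at almost every point. This
  justifies Fubini's theorem in \<open>LL_fubini\<close>.\<close>

lemma AE_integrable_LL:
  fixes K :: "'n::finite G \<times> 'n G \<Rightarrow> complex"
  assumes K: "schwartz K" and \<xi>: "\<xi> \<in> L2"
  shows "AE \<omega> in lborel. \<forall>v t. \<omega> = unsort2 (v, t) \<longrightarrow>
     integrable lborel (\<lambda>p. K (unsort2 (p, t)) * phase2 lam v p t * \<xi> (unsort2 (v - p, t)))"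
proof -
  have sK: "schwartz (\<lambda>v. K (unsort2 v))" by (intro schwartz_isometry[OF K] bounded_linear_sort) simp
  then obtain B where B: "0 \<le> B" "\<And>w t. (1 + norm t) ^ 0 * ((1 + norm w) ^ 0 * norm (K (unsort2 (w, t)))) \<le> B * decay w"
    by (rule schwartz_slice_decay[of _ 0 0]) blast
  have [measurable]: "\<xi> \<in> borel_measurable borel" using \<xi> by (rule L2_borel)
  have j: "(\<lambda>c. unsort2 (c, 0) :: 'n G \<times> 'n G) \<in> borel_measurable borel"
    by (intro borel_measurable_continuous_onI continuous_on_compose2[OF continuous_unsort2[of UNIV]] continuous_intros) auto
  have "AE \<omega> in lborel. integrable lborel (\<lambda>c. (B * decay c) * norm (\<xi> (\<omega> - unsort2 (c, 0))))"
    by (rule young_integrable[OF _ _ j \<xi>])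
       (auto intro!: integrable_mult_right integrable_decay mult_nonneg_nonneg B(1) less_imp_le[OF decay_pos])
  then show ?thesis
  proof (rule eventually_mono, intro allI impI)
    fix \<omega> :: "'n G \<times> 'n G" and v t
    assume i: "integrable lborel (\<lambda>c. (B * decay c) * norm (\<xi> (\<omega> - unsort2 (c, 0))))" and \<omega>: "\<omega> = unsort2 (v, t)"
    have sub: "\<omega> - unsort2 (c, 0) = unsort2 (v - c, t)" for c
      unfolding \<omega> by (simp add: unsort2_def case_prod_unfold)
    have [measurable]: "(\<lambda>p. K (unsort2 (p, t))) \<in> borel_measurable borel" by (rule schwartz_slice_borel[OF sK])
    have [measurable]: "(\<lambda>p. phase2 lam v p t) \<in> borel_measurable borel" unfolding phase2_def by measurable
    have [measurable]: "(\<lambda>p. unsort2 (v - p, t) :: 'n G \<times> 'n G) \<in> borel_measurable borel"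
      by (intro borel_measurable_continuous_onI continuous_on_compose2[OF continuous_unsort2[of UNIV]] continuous_intros) auto
    show "integrable lborel (\<lambda>p. K (unsort2 (p, t)) * phase2 lam v p t * \<xi> (unsort2 (v - p, t)))"
    proof (rule Bochner_Integration.integrable_bound[OF i])
      show "(\<lambda>p. K (unsort2 (p, t)) * phase2 lam v p t * \<xi> (unsort2 (v - p, t))) \<in> borel_measurable lborel" by measurable
      show "AE p in lborel. norm (K (unsort2 (p, t)) * phase2 lam v p t * \<xi> (unsort2 (v - p, t))) \<le>
          norm (B * decay p * norm (\<xi> (\<omega> - unsort2 (p, 0))))"
      proof (rule AE_I2)
        fix p
        have "norm (K (unsort2 (p, t))) * norm (\<xi> (unsort2 (v - p, t))) \<le> (B * decay p) * norm (\<xi> (unsort2 (v - p, t)))"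
          using B(2)[of t p] by (intro mult_right_mono) auto
        also have "\<dots> \<le> norm (B * decay p * norm (\<xi> (unsort2 (v - p, t))))" by simp
        finally show "norm (K (unsort2 (p, t)) * phase2 lam v p t * \<xi> (unsort2 (v - p, t))) \<le>
          norm (B * decay p * norm (\<xi> (\<omega> - unsort2 (p, 0))))"
          unfolding sub by (simp add: norm_mult phase2_def ebar_eq)
      qed
    qed
  qed
qed

lemma ebar_add: "ebar (a + b) = ebar a * ebar b"
  unfolding ebar_eq minus_add_distrib e_add ..

lemma one_tensor_Delta_symbol:
  fixes \<phi> \<psi> :: "'n::finite G \<Rightarrow> complex"
  assumes lam: "lam \<noteq> 0" and \<phi>: "schwartz \<phi>" and \<psi>: "schwartz \<psi>"
    and K: "K = tker lam 1 (- 1) 0 1 (inv_fourier \<phi>) (inv_fourier \<psi>)" and sK: "schwartz K"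
  shows "oper_eq (one_tensor (L lam \<phi>) \<circ> Delta lam (L lam \<psi>)) (LL lam (fourier2 K))"
  unfolding oper_eq_def
proof
  fix \<xi> :: "'n G \<times> 'n G \<Rightarrow> complex" assume \<xi>: "\<xi> \<in> L2"
  let ?f = "inv_fourier \<phi>" and ?g = "inv_fourier \<psi>"
  have fb: "?f \<in> borel_measurable borel" and gb: "?g \<in> borel_measurable borel"
    using \<phi> \<psi> schwartz_borel schwartz_inv_fourier by blast+
  have [measurable]: "\<xi> \<in> borel_measurable borel" using \<xi> by (rule L2_borel)
  define \<zeta> where "\<zeta> \<omega> = (LINT c|lborel. dker lam ?g \<omega> c * \<xi> (\<omega> - dshift lam (snd (snd (snd \<omega>))) c))" for \<omega>
  have "AE \<omega> in lborel. one_tensor (L lam \<phi>) (Delta lam (L lam \<psi>) \<xi>) \<omega> = one_tensor (L lam \<phi>) \<zeta> \<omega>"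
    by (rule one_tensor_L_AE[OF fb]) (unfold \<zeta>_def, (intro Delta_L Delta_L_borel dker_integral_borel lam \<psi> \<xi>)+)
  moreover note AE_integrable_LL[OF sK \<xi>, of lam]
  ultimately show "AE \<omega> in lborel. (one_tensor (L lam \<phi>) \<circ> Delta lam (L lam \<psi>)) \<xi> \<omega> = LL lam (fourier2 K) \<xi> \<omega>"
  proof eventually_elim
    case (elim \<omega>)
    obtain x y r x' y' r' where \<omega>: "\<omega> = ((x, y, r), (x', y', r'))" by (cases \<omega>) auto
    let ?v = "((x, y), (x', y'))" and ?t = "(r, r')"
    have \<omega>': "\<omega> = unsort2 (?v, ?t)" by (simp add: \<omega>)
    define s where "s = exp (- lam * r')"
    have s: "0 < s" "s \<noteq> 0" and s': "exp (- (lam * r')) = s" by (auto simp: s_def)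
    have inv: "s * (inverse s * X) = X" for X using s by simp
    \<comment> \<open>The outer operator displaces the second factor by c, and the kernel of the
      comultiplied operator is evaluated at the displaced point.\<close>
    define Q where "Q c a = lker lam ?f (snd \<omega>) c * (dker lam ?g (\<omega> - (0, (fst c, snd c, 0))) a *
        \<xi> (\<omega> - (0, (fst c, snd c, 0)) - dshift lam r' a))" for c a
    have "LL lam (fourier2 K) \<xi> \<omega> = (LINT c|lborel. LINT a|lborel. Q c a)"
      unfolding \<omega>'
    proof (rule LL_fubini(1)[OF sK s(1)])
      show "integrable lborel (\<lambda>p. K (unsort2 (p, ?t)) * phase2 lam ?v p ?t * \<xi> (unsort2 (?v - p, ?t)))"
        using elim(2) \<omega>' by blast
      note [measurable] = lker_borel[OF fb] dker_borel[OF gb] dshift_borel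
      show "(\<lambda>p. Q (fst p) (snd p)) \<in> borel_measurable borel" unfolding Q_def by measurable
      fix p :: "'n W \<times> 'n W"
      obtain A B A' B' where p: "p = ((A, B), (A', B'))" by (cases p) auto
      \<comment> \<open>Left: the phase of \<open>K\<close> plus the phase built into
        \<open>LL\<close>. Right: the phases of the two operators, the second at the point displaced
        by the first. The mismatch is the cross term (A' - s A) . s B, which is why \<open>K\<close>
        carries it.\<close>
      have ph: "eta lam r' * ((A' - s *\<^sub>R A) \<bullet> (s *\<^sub>R B)) + (eta lam r * (A \<bullet> (y - B)) + eta lam r' * (A' \<bullet> (y' - B')))
         = eta lam r' * ((A' - s *\<^sub>R A) \<bullet> (y' - (B' - s *\<^sub>R B))) + (eta lam r * (A \<bullet> (y - B)) +
           eta lam r' * ((s *\<^sub>R A) \<bullet> (y' - (B' - s *\<^sub>R B) - s *\<^sub>R B)))"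
        by (simp add: inner_diff_left inner_diff_right algebra_simps)
      have \<xi>eq: "\<omega> - (0, (A' - s *\<^sub>R A, B' - s *\<^sub>R B, 0)) - dshift lam r' (s *\<^sub>R A, s *\<^sub>R B) = unsort2 (?v - p, ?t)"
        using s by (simp add: \<omega> p dshift_def Let_def s' zero_prod_def)
      have "K (unsort2 (p, ?t)) * phase2 lam ?v p ?t = of_real (s ^ (2 * CARD('n))) *
        (?f (A' - s *\<^sub>R A, B' - s *\<^sub>R B, r') * ?g (s *\<^sub>R A, s *\<^sub>R B, r + r')) *
        ebar (eta lam r' * ((A' - s *\<^sub>R A) \<bullet> (s *\<^sub>R B)) + (eta lam r * (A \<bullet> (y - B)) + eta lam r' * (A' \<bullet> (y' - B'))))"
        unfolding K tker_def p phase2_def ebar_add by (simp add: Let_def s' mult_ac)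
      also have "\<dots> = of_real (s ^ (2 * CARD('n))) * (lker lam ?f (snd \<omega>) (A' - s *\<^sub>R A, B' - s *\<^sub>R B) *
         dker lam ?g (\<omega> - (0, (A' - s *\<^sub>R A, B' - s *\<^sub>R B, 0))) (s *\<^sub>R A, s *\<^sub>R B))"
        unfolding ph unfolding ebar_add using s
        by (simp add: lker_def dker_def \<omega> Let_def s' zero_prod_def ebar_add mult_ac inv)
      finally show "K (unsort2 (p, ?t)) * phase2 lam ?v p ?t * \<xi> (unsort2 (?v - p, ?t))
        = of_real (s ^ (2 * CARD('n))) * Q (fst (wshear s p)) (snd (wshear s p))"
        unfolding Q_def wshear_def by (simp add: p \<xi>eq[unfolded p] mult.assoc)
    qed
    also have "\<dots> = one_tensor (L lam \<phi>) \<zeta> \<omega>"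
      unfolding one_tensor_L \<zeta>_def Q_def by (simp add: \<omega> zero_prod_def)
    finally show ?case using elim(1) by simp
  qed
qed

text \<open>Compared with \<open>one_tensor_Delta_symbol\<close>, the displacement a comes outside
  and c inside, so the other order of integration is used and the cross term of the phase becomes s
  A . (B' - s B).\<close>

lemma Delta_one_tensor_symbol:
  fixes \<phi> \<psi> :: "'n::finite G \<Rightarrow> complex"
  assumes lam: "lam \<noteq> 0" and \<phi>: "schwartz \<phi>" and \<psi>: "schwartz \<psi>"
    and K: "K = tker lam 0 1 1 (- 1) (inv_fourier \<psi>) (inv_fourier \<phi>)" and sK: "schwartz K"
  shows "oper_eq (Delta lam (L lam \<phi>) \<circ> one_tensor (L lam \<psi>)) (LL lam (fourier2 K))"
  unfolding oper_eq_def
proof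
  fix \<xi> :: "'n G \<times> 'n G \<Rightarrow> complex" assume \<xi>: "\<xi> \<in> L2"
  let ?f = "inv_fourier \<phi>" and ?g = "inv_fourier \<psi>"
  have fb: "?f \<in> borel_measurable borel" and gb: "?g \<in> borel_measurable borel"
    using \<phi> \<psi> schwartz_borel schwartz_inv_fourier by blast+
  have [measurable]: "\<xi> \<in> borel_measurable borel" using \<xi> by (rule L2_borel)
  note Delta_L[OF lam \<phi> one_tensor_L_L2[OF \<psi> \<xi>, of lam]]
  moreover note AE_integrable_LL[OF sK \<xi>, of lam]
  ultimately show "AE \<omega> in lborel. (Delta lam (L lam \<phi>) \<circ> one_tensor (L lam \<psi>)) \<xi> \<omega> = LL lam (fourier2 K) \<xi> \<omega>"
  proof eventually_elim
    case (elim \<omega>)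
    obtain x y r x' y' r' where \<omega>: "\<omega> = ((x, y, r), (x', y', r'))" by (cases \<omega>) auto
    let ?v = "((x, y), (x', y'))" and ?t = "(r, r')"
    have \<omega>': "\<omega> = unsort2 (?v, ?t)" by (simp add: \<omega>)
    define s where "s = exp (- lam * r')"
    have s: "0 < s" "s \<noteq> 0" and s': "exp (- (lam * r')) = s" by (auto simp: s_def)
    have inv: "s * (inverse s * X) = X" for X using s by simp
    define Q where "Q c a = dker lam ?f \<omega> a * (lker lam ?g (snd (\<omega> - dshift lam r' a)) c *
        \<xi> (\<omega> - dshift lam r' a - (0, (fst c, snd c, 0))))" for c a
    have "LL lam (fourier2 K) \<xi> \<omega> = (LINT a|lborel. LINT c|lborel. Q c a)"
      unfolding \<omega>'
    proof (rule LL_fubini(2)[OF sK s(1)])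
      show "integrable lborel (\<lambda>p. K (unsort2 (p, ?t)) * phase2 lam ?v p ?t * \<xi> (unsort2 (?v - p, ?t)))"
        using elim(2) \<omega>' by blast
      note [measurable] = lker_borel[OF gb] dker_borel[OF fb] dshift_borel
      show "(\<lambda>p. Q (fst p) (snd p)) \<in> borel_measurable borel" unfolding Q_def by measurable
      fix p :: "'n W \<times> 'n W"
      obtain A B A' B' where p: "p = ((A, B), (A', B'))" by (cases p) auto
      have ph: "eta lam r' * ((s *\<^sub>R A) \<bullet> (B' - s *\<^sub>R B)) + (eta lam r * (A \<bullet> (y - B)) + eta lam r' * (A' \<bullet> (y' - B')))
         = (eta lam r * (A \<bullet> (y - B)) + eta lam r' * ((s *\<^sub>R A) \<bullet> (y' - s *\<^sub>R B))) +
           eta lam r' * ((A' - s *\<^sub>R A) \<bullet> (y' - s *\<^sub>R B - (B' - s *\<^sub>R B)))"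
        by (simp add: inner_diff_left inner_diff_right algebra_simps)
      have \<xi>eq: "\<omega> - dshift lam r' (s *\<^sub>R A, s *\<^sub>R B) - (0, (A' - s *\<^sub>R A, B' - s *\<^sub>R B, 0)) = unsort2 (?v - p, ?t)"
        using s by (simp add: \<omega> p dshift_def Let_def s' zero_prod_def)
      have "K (unsort2 (p, ?t)) * phase2 lam ?v p ?t = of_real (s ^ (2 * CARD('n))) *
        (?g (A' - s *\<^sub>R A, B' - s *\<^sub>R B, r') * ?f (s *\<^sub>R A, s *\<^sub>R B, r + r')) *
        ebar (eta lam r' * ((s *\<^sub>R A) \<bullet> (B' - s *\<^sub>R B)) + (eta lam r * (A \<bullet> (y - B)) + eta lam r' * (A' \<bullet> (y' - B'))))"
        unfolding K tker_def p phase2_def ebar_add by (simp add: Let_def s' mult_ac)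
      also have "\<dots> = of_real (s ^ (2 * CARD('n))) * (dker lam ?f \<omega> (s *\<^sub>R A, s *\<^sub>R B) *
         lker lam ?g (snd (\<omega> - dshift lam r' (s *\<^sub>R A, s *\<^sub>R B))) (A' - s *\<^sub>R A, B' - s *\<^sub>R B))"
        unfolding ph unfolding ebar_add using s
        by (simp add: lker_def dker_def dshift_def \<omega> Let_def s' zero_prod_def ebar_add mult_ac inv)
      finally show "K (unsort2 (p, ?t)) * phase2 lam ?v p ?t * \<xi> (unsort2 (?v - p, ?t))
        = of_real (s ^ (2 * CARD('n))) * Q (fst (wshear s p)) (snd (wshear s p))"
        unfolding Q_def wshear_def by (simp add: p \<xi>eq[unfolded p] mult.assoc)
    qed
    also have "\<dots> = (LINT c|lborel. dker lam ?f \<omega> c * one_tensor (L lam \<psi>) \<xi> (\<omega> - dshift lam (snd (snd (snd \<omega>))) c))"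
      unfolding one_tensor_L Q_def by (simp add: \<omega>)
    finally show ?case using elim(1) by simp
  qed
qed

subsection \<open>The Haar functional and the antipode\<close>

definition assoc3 :: "'a \<times> 'b \<times> 'c \<Rightarrow> ('a \<times> 'b) \<times> 'c" where
  "assoc3 = (\<lambda>(x, y, z). ((x, y), z))"

interpretation assoc3: change_of_variables
  "assoc3 :: 'a::euclidean_space \<times> 'b::euclidean_space \<times> 'c::euclidean_space \<Rightarrow> _" "\<lambda>_. 1"
proof
  show "assoc3 \<in> borel_measurable (borel :: ('a \<times> 'b \<times> 'c) measure)"
    unfolding assoc3_def case_prod_unfold by measurable
  fix f :: "('a \<times> 'b) \<times> 'c \<Rightarrow> ennreal" assume f [measurable]: "f \<in> borel_measurable borel"
  have "(\<integral>\<^sup>+z. ennreal 1 * f (assoc3 z) \<partial>lborel) = (\<integral>\<^sup>+x. \<integral>\<^sup>+y. \<integral>\<^sup>+r. f ((x, y), r) \<partial>lborel \<partial>lborel \<partial>lborel)"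
    unfolding assoc3_def case_prod_unfold by (subst nn_integral_triple) auto
  also have "\<dots> = (\<integral>\<^sup>+p. \<integral>\<^sup>+r. f (p, r) \<partial>lborel \<partial>lborel)"
    by (rule nn_integral_pair[symmetric]) measurable
  also have "\<dots> = (\<integral>\<^sup>+z. f z \<partial>lborel)" by (rule nn_integral_pair[symmetric]) measurable
  finally show "(\<integral>\<^sup>+z. ennreal 1 * f (assoc3 z) \<partial>lborel) = (\<integral>\<^sup>+z. f z \<partial>lborel)" .
qed auto

lemma schwartz_slice:
  fixes H :: "'w::euclidean_space \<times> 't::euclidean_space \<Rightarrow> complex"
  assumes "schwartz H"
  shows "schwartz (\<lambda>t. H (w0, t))"
proof -
  have "schwartz (\<lambda>t. 1 * H (w0, t))"
  proof (rule schwartz_pullback[where S=UNIV and H=H and T="\<lambda>t. (w0, t)" and m="\<lambda>_. 1" and j=1 and C=1])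
    show "(\<lambda>t. complex_of_real ((w0, t) \<bullet> w)) \<in> multipliers UNIV" for w
    proof -
      have "(\<lambda>t. complex_of_real (w0 \<bullet> fst w) + of_real (t \<bullet> snd w)) \<in> multipliers UNIV"
        by (intro multipliers.add multipliers.const multipliers.lin bounded_linear_inner_left)
      then show ?thesis by (simp add: inner_prod_def)
    qed
    show "norm t \<le> 1 * (1 + norm (w0, t)) ^ 1" for t
      using norm_snd_le[of t w0] by simp
  qed (auto intro: multipliers.const assms)
  then show ?thesis by simp
qed

lemma h_eq: "h \<phi> = (LINT z|lborel. \<phi> z)"
  unfolding h_def by (simp add: case_prod_unfold)

text \<open>Integrating over the second point is the partial transform in that variable at frequency
  0, so the claim reduces to \<open>schwartz_pft\<close> and a slice.\<close>

lemma schwartz_h: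
  fixes F :: "'n::finite G \<times> 'n G \<Rightarrow> complex"
  assumes F: "schwartz F" shows "schwartz (\<lambda>z. h (\<lambda>z'. F (z, z')))"
proof -
  have "schwartz (\<lambda>p :: 'n G \<times> 'n G. F (snd p, fst p))"
    by (rule schwartz_isometry[OF F])
       (auto intro!: bounded_linear_Pair bounded_linear_snd bounded_linear_fst simp: norm_prod_def add.commute)
  from schwartz_slice[OF schwartz_pft[OF _ this, of 1], of 0] show ?thesis
    by (simp add: pft_def h_eq)
qed

text \<open>Integrating over p', q' is evaluating the transform at frequency 0, which leaves the
  integral over r'; the rest is Fubini, with r' moved outermost.\<close>

lemma inv_fourier_h:
  fixes F :: "'n::finite G \<times> 'n G \<Rightarrow> complex"
  assumes F: "schwartz F"
  shows "inv_fourier (\<lambda>z. h (\<lambda>z'. F (z, z'))) (x, y, r) = (LINT r'|lborel. inv_fourier2 F ((x, y, r), (0, 0, r')))"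
proof -
  \<comment> \<open>All variables to be integrated, r' included, form the first component and r is
    the only parameter, so joint integrability is a single instance of
    \<open>pft_integrable\<close>.\<close>
  define H where "H p = F (unsort2 (fst (fst p), (snd p, snd (fst p))))" for p :: "(('n W \<times> 'n W) \<times> real) \<times> real"
  have H: "schwartz H" unfolding H_def
    by (rule schwartz_isometry[OF F])
       (auto intro!: bounded_linear_compose[OF bounded_linear_sort(4)] bounded_linear_Pair
          bounded_linear_compose[OF bounded_linear_fst] bounded_linear_compose[OF bounded_linear_snd]
          bounded_linear_fst bounded_linear_snd simp: norm_prod_def add_ac)
  define M where "M q = e (fst (fst q) \<bullet> (x, y)) * H (q, r)" for q
  have M: "integrable lborel M"
    using pft_integrable[OF H, of 1 "(((x, y), 0), 0)" r] unfolding M_def by (simp add: inner_prod_def)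
  have [measurable]: "M \<in> borel_measurable borel" using borel_measurable_integrable[OF M] by simp
  have N: "integrable lborel (\<lambda>z. M (assoc3 z))"
    using assoc3.integrable[of M] M by simp
  have [measurable]: "F \<in> borel_measurable borel" using F by (rule schwartz_borel)
  have [measurable]: "unsort1 \<in> borel_measurable (borel :: ('n W \<times> real) measure)"
    by (intro borel_measurable_continuous_onI linear_continuous_on bounded_linear_sort)
  have inner: "e (w \<bullet> (x, y)) * h (\<lambda>z'. F (unsort1 (w, r), z')) = (LINT z|lborel. M (assoc3 (w, z)))" for w
  proof -
    have "h (\<lambda>z'. F (unsort1 (w, r), z')) = (LINT z'|lborel. 1 *\<^sub>R F (unsort1 (w, r), unsort1 (assoc3 z')))"
      unfolding h_eq by (intro Bochner_Integration.integral_cong) (auto simp: assoc3_def unsort1_def)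
    also have "\<dots> = (LINT v|lborel. F (unsort1 (w, r), unsort1 v))"
      by (rule assoc3.integral) measurable
    finally have "e (w \<bullet> (x, y)) * h (\<lambda>z'. F (unsort1 (w, r), z')) = (LINT v|lborel. e (w \<bullet> (x, y)) * F (unsort1 (w, r), unsort1 v))"
      by simp
    also have "\<dots> = (LINT z|lborel. M (assoc3 (w, z)))"
      unfolding M_def H_def
      by (intro Bochner_Integration.integral_cong) (auto simp: assoc3_def unsort1_def unsort2_def split: prod.splits)
    finally show ?thesis .
  qed
  have "inv_fourier (\<lambda>z. h (\<lambda>z'. F (z, z'))) (x, y, r) = (LINT w|lborel. LINT z|lborel. M (assoc3 (w, z)))"
    unfolding inv_fourier_pft pft_def by (simp add: inner)
  also have "\<dots> = (LINT z|lborel. M (assoc3 z))"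
    using lborel_pair.integral_fst[of "\<lambda>w z. M (assoc3 (w, z))"] N by (simp add: lborel_prod case_prod_unfold)
  also have "\<dots> = (LINT q|lborel. M q)" using assoc3.integral[of M] by simp
  also have "\<dots> = (LINT r'|lborel. LINT c|lborel. M (c, r'))"
    using lborel_pair.integral_snd[of "\<lambda>c r'. M (c, r')"] M by (simp add: lborel_prod)
  also have "\<dots> = (LINT r'|lborel. inv_fourier2 F ((x, y, r), (0, 0, r')))"
    unfolding inv_fourier2_pft pft_def M_def H_def by (simp add: inner_prod_def)
  finally show ?thesis .
qed

text \<open>Multiplying - x / s(r) by s (r + r') = s r * s r' gives - s(r') x, and - r + (r + r') =
  r', so f and g receive the same arguments on both sides. In the phase, \<open>eta_add\<close>
  produces an extra term eta(r) x . y that cancels against the phase of the antipode.\<close>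

lemma tker_antipode:
  fixes f g :: "'n::finite G \<Rightarrow> complex"
  assumes lam: "lam \<noteq> 0"
  defines "s \<equiv> \<lambda>r. exp (- lam * r)"
  shows "ebar (eta lam r * (x \<bullet> y)) * (of_real ((1 / s r) ^ (2 * CARD('n))) *
      tker lam 0 1 1 (- 1) g f ((- (x /\<^sub>R s r), - (y /\<^sub>R s r), - r), (0, 0, r + r')))
    = tker lam 1 (- 1) 0 1 f g ((x, y, r), (0, 0, r'))"
proof -
  have s: "s r \<noteq> 0" "s r' \<noteq> 0" by (auto simp: s_def)
  have s_app: "exp (- lam * t) = s t" for t by (simp add: s_def)
  have sadd: "s (r + r') = s r * s r'" unfolding s_def exp_add[symmetric] by (simp add: algebra_simps)
  let ?X = "s r' *\<^sub>R x" and ?Y = "s r' *\<^sub>R y"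
  have sX: "(s r * s r') *\<^sub>R (- (v /\<^sub>R s r)) = - (s r' *\<^sub>R v)" for v :: "real ^ 'n"
    using s by simp
  have T2: "tker lam 0 1 1 (- 1) g f ((- (x /\<^sub>R s r), - (y /\<^sub>R s r), - r), (0, 0, r + r')) =
     of_real ((s r * s r') ^ (2 * CARD('n))) * ebar (eta lam (r + r') * ((- ?X) \<bullet> ?Y)) * (g (?X, ?Y, r + r') * f (- ?X, - ?Y, r'))"
    unfolding tker_def prod.case Let_def s_app sadd sX by simp
  have T1: "tker lam 1 (- 1) 0 1 f g ((x, y, r), (0, 0, r')) =
     of_real (s r' ^ (2 * CARD('n))) * ebar (eta lam r' * ((- ?X) \<bullet> ?Y)) * (f (- ?X, - ?Y, r') * g (?X, ?Y, r + r'))"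
    unfolding tker_def prod.case Let_def s_app by simp
  have "complex_of_real ((1 / s r) ^ (2 * CARD('n))) * of_real ((s r * s r') ^ (2 * CARD('n))) = of_real (s r' ^ (2 * CARD('n)))"
    unfolding of_real_mult[symmetric] power_mult_distrib[symmetric] using s by simp
  moreover have "ebar (eta lam r * (x \<bullet> y)) * ebar (eta lam (r + r') * ((- ?X) \<bullet> ?Y)) = ebar (eta lam r' * ((- ?X) \<bullet> ?Y))"
    unfolding ebar_add[symmetric] eta_add[OF lam] s_app using s
    by (intro arg_cong[where f=ebar]) (simp add: field_simps power2_eq_square)
  moreover have "a * (N * (N' * b * (G * F))) = (N * N') * (a * b) * (F * G)" for a b N N' F G :: complex
    by (simp only: mult_ac)
  ultimately show ?thesis unfolding T1 T2 by (simp only:)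
qed

text \<open>For fixed (x, y) the inner integral of \<open>kappa\<close> is the inverse transform of
  a dilated slice function, which \<open>tker_antipode\<close> converts under the integral over r';
  the outer integral is then Fourier inversion. This order follows the iterated form of
  \<open>kappa\<close>.\<close>

lemma kappa_h:
  fixes f g :: "'n::finite G \<Rightarrow> complex"
  assumes lam: "lam \<noteq> 0"
    and K1: "schwartz (tker lam 1 (- 1) 0 1 f g)" and K2: "schwartz (tker lam 0 1 1 (- 1) g f)"
  defines "F1 \<equiv> fourier2 (tker lam 1 (- 1) 0 1 f g)" and "F2 \<equiv> fourier2 (tker lam 0 1 1 (- 1) g f)"
  shows "(\<lambda>z. h (\<lambda>z'. F1 (z, z'))) = kappa lam (\<lambda>z. h (\<lambda>z'. F2 (z, z')))"
proof
  fix z :: "'n G"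
  obtain p q r where z: "z = (p, q, r)" by (cases z) auto
  define P1 where "P1 z = h (\<lambda>z'. F1 (z, z'))" for z
  define P2 where "P2 z = h (\<lambda>z'. F2 (z, z'))" for z
  have F1: "schwartz F1" and F2: "schwartz F2" unfolding F1_def F2_def by (intro schwartz_fourier2 K1 K2)+
  have P1: "schwartz P1" and P2: "schwartz P2" unfolding P1_def P2_def by (intro schwartz_h F1 F2)+
  have P1h: "inv_fourier P1 (x, y, r) = (LINT r'|lborel. tker lam 1 (- 1) 0 1 f g ((x, y, r), (0, 0, r')))" for x y r
    unfolding P1_def inv_fourier_h[OF F1] unfolding F1_def inv_fourier2_fourier2[OF K1] ..
  have P2h: "inv_fourier P2 (x, y, r) = (LINT r'|lborel. tker lam 0 1 1 (- 1) g f ((x, y, r), (0, 0, r')))" for x y r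
    unfolding P2_def inv_fourier_h[OF F2] unfolding F2_def inv_fourier2_fourier2[OF K2] ..
  define s where "s = exp (- lam * r)"
  have s: "0 < s" "s \<noteq> 0" and s': "exp (- (lam * r)) = s" by (auto simp: s_def)
  have inv: "inverse s * (s * X) = X" for X using s by simp
  have sP2: "schwartz (\<lambda>v. P2 (unsort1 v))" by (intro schwartz_isometry[OF P2] bounded_linear_sort) simp
  have sP1: "schwartz (\<lambda>v. P1 (unsort1 v))" by (intro schwartz_isometry[OF P1] bounded_linear_sort) simp
  have inner: "(LINT w'|lborel. P2 (- s *\<^sub>R fst w', - s *\<^sub>R snd w', - r) * ebar ((p - fst w') \<bullet> x + (q - snd w') \<bullet> y)
       * ebar (eta lam r * (x \<bullet> y))) = ebar (p \<bullet> x + q \<bullet> y) * inv_fourier P1 (x, y, r)" for x y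
  proof -
    let ?w = "(x, y) :: 'n W"
    \<comment> \<open>Dilating the integration variable by - s divides the frequency (x, y) by -
      s.\<close>
    let ?u = "((- (x /\<^sub>R s)), (- (y /\<^sub>R s))) :: 'n W"
    have [measurable]: "(\<lambda>w. P2 (unsort1 (w, - r))) \<in> borel_measurable borel"
      by (rule schwartz_slice_borel[OF sP2])
    have dim: "DIM('n W) = 2 * CARD('n)" by simp
    have "inv_fourier P2 (fst ?u, snd ?u, - r) = (LINT w'|lborel. e (w' \<bullet> ?u) * P2 (unsort1 (w', - r)))"
      unfolding inv_fourier_pft pft_def by simp
    also have "\<dots> = \<bar>- s\<bar> ^ DIM('n W) *\<^sub>R (LINT w'|lborel. e ((0 + (- s) *\<^sub>R w') \<bullet> ?u) * P2 (unsort1 (0 + (- s) *\<^sub>R w', - r)))"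
      using s by (intro integral_affine) auto
    also have "\<dots> = of_real (s ^ (2 * CARD('n))) * (LINT w'|lborel. e (w' \<bullet> ?w) * P2 (- s *\<^sub>R fst w', - s *\<^sub>R snd w', - r))"
      unfolding dim scaleR_conv_of_real[where 'a=complex] using s
      by (simp add: unsort1_def case_prod_unfold inner_prod_def inv)
    finally have "(LINT w'|lborel. e (w' \<bullet> ?w) * P2 (- s *\<^sub>R fst w', - s *\<^sub>R snd w', - r)) =
       of_real ((1 / s) ^ (2 * CARD('n))) * inv_fourier P2 (fst ?u, snd ?u, - r)"
      using s by (simp add: power_one_over field_simps)
    also have "inv_fourier P2 (fst ?u, snd ?u, - r) = (LINT r'|lborel. tker lam 0 1 1 (- 1) g f ((fst ?u, snd ?u, - r), (0, 0, r + 1 * r')))"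
      unfolding P2h by (subst lborel_integral_real_affine[where c=1 and t=r]) auto
    finally have 1: "(LINT w'|lborel. e (w' \<bullet> ?w) * P2 (- s *\<^sub>R fst w', - s *\<^sub>R snd w', - r)) =
       of_real ((1 / s) ^ (2 * CARD('n))) * (LINT r'|lborel. tker lam 0 1 1 (- 1) g f ((fst ?u, snd ?u, - r), (0, 0, r + r')))"
      by simp
    have "(LINT w'|lborel. P2 (- s *\<^sub>R fst w', - s *\<^sub>R snd w', - r) * ebar ((p - fst w') \<bullet> x + (q - snd w') \<bullet> y)
       * ebar (eta lam r * (x \<bullet> y))) = (LINT w'|lborel. (ebar (p \<bullet> x + q \<bullet> y) * ebar (eta lam r * (x \<bullet> y))) *
         (e (w' \<bullet> ?w) * P2 (- s *\<^sub>R fst w', - s *\<^sub>R snd w', - r)))"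
    proof (rule Bochner_Integration.integral_cong[OF refl])
      fix w' :: "'n W"
      have "ebar ((p - fst w') \<bullet> x + (q - snd w') \<bullet> y) = ebar (p \<bullet> x + q \<bullet> y) * e (w' \<bullet> ?w)"
        unfolding ebar_eq e_add[symmetric] by (intro arg_cong[where f=e]) (simp add: inner_prod_def inner_diff_left)
      then show "P2 (- s *\<^sub>R fst w', - s *\<^sub>R snd w', - r) * ebar ((p - fst w') \<bullet> x + (q - snd w') \<bullet> y) * ebar (eta lam r * (x \<bullet> y))
        = (ebar (p \<bullet> x + q \<bullet> y) * ebar (eta lam r * (x \<bullet> y))) * (e (w' \<bullet> ?w) * P2 (- s *\<^sub>R fst w', - s *\<^sub>R snd w', - r))"
        by (simp only: mult_ac)
    qed
    also have "\<dots> = ebar (p \<bullet> x + q \<bullet> y) * (LINT r'|lborel. ebar (eta lam r * (x \<bullet> y)) * (of_real ((1 / s) ^ (2 * CARD('n))) *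
        tker lam 0 1 1 (- 1) g f ((fst ?u, snd ?u, - r), (0, 0, r + r'))))"
      unfolding integral_mult_right_zero 1 by (simp only: mult.assoc)
    also have "\<dots> = ebar (p \<bullet> x + q \<bullet> y) * inv_fourier P1 (x, y, r)"
      unfolding P1h s_def fst_conv snd_conv tker_antipode[OF lam] ..
    finally show ?thesis .
  qed
  have "kappa lam P2 z = (LINT w|lborel. ebar (p \<bullet> fst w + q \<bullet> snd w) * inv_fourier P1 (fst w, snd w, r))"
    unfolding z kappa_def case_prod_unfold using inner by (simp add: s')
  also have "\<dots> = pft (- 1) (pft 1 (\<lambda>v. P1 (unsort1 v))) ((p, q), r)"
    unfolding inv_fourier_pft unfolding pft_def[of "- 1"]
    by (simp add: ebar_eq inner_prod_def inner_commute)
  also have "\<dots> = P1 z" using pft_inversion[OF _ sP1, of 1] by (simp add: z)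
  finally show "h (\<lambda>z'. F1 (z, z')) = kappa lam (\<lambda>z. h (\<lambda>z'. F2 (z, z'))) z"
    unfolding P1_def P2_def by simp
qed

text \<open>Two symbols of one operator have almost everywhere equal \<open>LL\<close> operators, so
  \<open>symbol_unique\<close> applies, and the description by \<open>THE\<close> evaluates to the
  given symbol.\<close>

lemma symbol_unique_exists:
  assumes "F \<in> \<A>2" "oper_eq T (LL lam F)"
  shows "has_symbol lam T" "id_tensor_h lam T = (\<lambda>z. h (\<lambda>z'. F (z, z')))"
proof -
  have F: "is_symbol lam T F" unfolding is_symbol_def using assms by blast
  have uniq: "F' = F" if "is_symbol lam T F'" for F'
  proof (rule symbol_unique[of F' F lam])
    show "schwartz F'" "schwartz F" using that F unfolding is_symbol_def \<A>2_def by auto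
    show "oper_eq (LL lam F') (LL lam F)"
      unfolding oper_eq_def
    proof
      fix \<xi> :: "'a G \<times> 'a G \<Rightarrow> complex" assume "\<xi> \<in> L2"
      then have "AE z in lborel. T \<xi> z = LL lam F' \<xi> z" "AE z in lborel. T \<xi> z = LL lam F \<xi> z"
        using that F unfolding is_symbol_def oper_eq_def by auto
      then show "AE z in lborel. LL lam F' \<xi> z = LL lam F \<xi> z" by eventually_elim simp
    qed
  qed
  show "has_symbol lam T" unfolding has_symbol_def using F uniq by blast
  have "(THE F. is_symbol lam T F) = F" using F uniq by (rule the_equality)
  then show "id_tensor_h lam T = (\<lambda>z. h (\<lambda>z'. F (z, z')))" unfolding id_tensor_h_def by simp
qed

theorem proposition5p2:
  fixes lam :: real and \<phi> \<psi> :: "'n::finite G \<Rightarrow> complex"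
  assumes "lam \<noteq> 0" and "\<phi> \<in> \<A>" and "\<psi> \<in> \<A>"
  shows "has_symbol lam (one_tensor (L lam \<phi>) \<circ> Delta lam (L lam \<psi>)) \<and>
    has_symbol lam (Delta lam (L lam \<phi>) \<circ> one_tensor (L lam \<psi>)) \<and>
    id_tensor_h lam (one_tensor (L lam \<phi>) \<circ> Delta lam (L lam \<psi>)) =
      kappa lam (id_tensor_h lam (Delta lam (L lam \<phi>) \<circ> one_tensor (L lam \<psi>)))"
proof -
  from assms obtain R1 R2 where \<phi>: "schwartz \<phi>" and \<psi>: "schwartz \<psi>"
    and R1: "\<And>p q r. \<bar>r\<bar> > R1 \<Longrightarrow> \<phi> (p, q, r) = 0" and R2: "\<And>p q r. \<bar>r\<bar> > R2 \<Longrightarrow> \<psi> (p, q, r) = 0"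
    unfolding \<A>_def by blast
  \<comment> \<open>A common support radius; the maximum with 0 provides the nonnegativity that
    \<open>fourier2_tker_A2\<close> asks for.\<close>
  define R where "R = max 0 (max R1 R2)"
  have R: "0 \<le> R" by (simp add: R_def)
  define f where "f = inv_fourier \<phi>"
  define g where "g = inv_fourier \<psi>"
  have f: "schwartz f" and g: "schwartz g" unfolding f_def g_def by (intro schwartz_inv_fourier \<phi> \<psi>)+
  have fR: "f (p, q, r) = 0" and gR: "g (p, q, r) = 0" if "\<bar>r\<bar> > R" for p q r
    using that R1 R2 unfolding f_def g_def R_def by (auto intro!: inv_fourier_support)
  let ?K1 = "tker lam 1 (- 1) 0 1 f g" and ?K2 = "tker lam 0 1 1 (- 1) g f"
  have K1: "schwartz ?K1" by (rule schwartz_tker[OF f g fR gR])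
  have K2: "schwartz ?K2" by (rule schwartz_tker[OF g f gR fR])
  have 1: "fourier2 ?K1 \<in> \<A>2" by (rule fourier2_tker_A2[OF f g R fR gR])
  have 2: "fourier2 ?K2 \<in> \<A>2" by (rule fourier2_tker_A2[OF g f R gR fR])
  note s1 = symbol_unique_exists[OF 1 one_tensor_Delta_symbol[OF assms(1) \<phi> \<psi> _ K1, unfolded f_def g_def, OF refl, folded f_def g_def]]
  note s2 = symbol_unique_exists[OF 2 Delta_one_tensor_symbol[OF assms(1) \<phi> \<psi> _ K2, unfolded f_def g_def, OF refl, folded f_def g_def]]
  show ?thesis
    using s1(1) s2(1) unfolding s1(2) s2(2) kappa_h[OF assms(1) K1 K2] by blast
qed

end
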